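(* Let $(M,\Gamma,\kappa,\varepsilon)$ be a weak Hopf $C^*$-algebra such that $\kappa^2|_{\varepsilon_t(M)}=\mathrm{id}$, $h$ its normalized Haar measure, $E_h^s$ (resp. $E_h^t$) its source (resp. range) Haar conditional expectation, and $\varepsilon_t(M)$ its range Cartan subalgebra. Put $N=\varepsilon_t(M)$, $\alpha=\mathrm{id}|_N$, $\beta=\kappa|_N$, let $\widetilde\Gamma$ be the co-product $\Gamma$ viewed as taking values in $M\,{}_\beta\star_\alpha M\simeq(M\otimes M)_{\Gamma(1)}$, and $\mu=h\circ\alpha=h\circ\beta$. Then $(N,M,\alpha,\beta,\widetilde\Gamma,\mu,E_h^t,E_h^s)$ is an adapted measured quantum groupoid.
   Context: Weak Hopf $C^*$-algebra (finite quantum groupoid) $(M,\Gamma,\kappa,\varepsilon)$: $M$ is a finite-dimensional $C^*$-algebra with a (coassociative) co-product $\Gamma:M\to M\otimes M$, a co-unit $\varepsilon$ and an antipode $\kappa:M\to M$ such that for all $x,y\in M$: (i) $\Gamma$ is a (not necessarily unital) $*$-homomorphism; (ii) $(\varepsilon\otimes\varepsilon)((x\otimes1)\Gamma(1)(1\otimes y))=\varepsilon(xy)$; (iii) $\kappa$ is an anti-homomorphism of algebra and co-algebra with $(\kappa\circ* )^2=\mathrm{id}$ and $(m(\kappa\otimes\mathrm{id})\otimes\mathrm{id})(\Gamma\otimes\mathrm{id})\Gamma(x)=(1\otimes x)\Gamma(1)$, $m$ the multiplication. $\varepsilon_t=m(\mathrm{id}\otimes\kappa)\Gamma$, $\varepsilon_s=m(\kappa\otimes\mathrm{id})\Gamma$;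 $\varepsilon_t(M),\varepsilon_s(M)$ are commuting subalgebras (range and source Cartan subalgebras). The normalized Haar measure is the unique faithful positive linear form $h$, $\kappa$-invariant, with $(\mathrm{id}\otimes h)(\Gamma(1))=1$ and $(\mathrm{id}\otimes h)((1\otimes y)\Gamma(x))=\kappa((\mathrm{id}\otimes h)(\Gamma(y)(1\otimes x)))$. $E_h^s=(h\otimes\mathrm{id})\Gamma$ and $E_h^t=(\mathrm{id}\otimes h)\Gamma$ are the source and range Haar conditional expectations onto $\varepsilon_s(M)$ and $\varepsilon_t(M)$, with $h\circ E^s_h=h=h\circ E^t_h$. In finite dimension, the relative tensor product below embeds isometrically in the ordinary tensor product with range projection in $\beta(N)\otimes\alpha(N)$, here $\Gamma(1)$, and the fiber product $M\,{}_\beta\star_\alpha M$ is identified with the reduced algebra $(M\otimes M)_{\Gamma(1)}=\Gamma(1)(M\otimes M)\Gamma(1)$. General definitions. nsf = normal, semifinite, faithful; $\mathcal N_\psi=\{x:\psi(x^*x)<\infty\}$, $H_\psi,\Lambda_\psi,J_\psi,\sigma^\psi$ as in Tomita–Takesaki theory; for an nsf operator-valued weight $T$ from $M$ to $P$: $\mathcal M_T^+=\{x\ge0:T(x)\in P^+\}$, $\sigma^T_t=\sigma_t^{\varphi\circ T}|_{M\cap P'}$. For an nsf weight $\psi$ on $N$, a representation $\alpha$ of $N$ on $K$ and an anti-representation $\beta$ on $H$: $D(H_\beta,\psi^o)$ is the set of $\xi$ with $\|\beta(y^* )\xi\|\le C\|\Lambda_\psi(y)\|$ for all $y\in\mathcal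 N_\psi$, $R^{\beta,\psi^o}(\xi)J_\psi\Lambda_\psi(y)=\beta(y^* )\xi$, $\langle\xi,\xi'\rangle=R^{\beta,\psi^o}(\xi')^*R^{\beta,\psi^o}(\xi)\in N$; $H\,{}_\beta\otimes_\alpha K$ is the completion of $D(H_\beta,\psi^o)\odot K$ for $(\xi\odot\eta|\xi'\odot\eta')=(\alpha(\langle\xi,\xi'\rangle)\eta|\eta')$. $M_1\,{}_\beta\star_\alpha M_2$ is the commutant of $\{x\,{}_\beta\otimes_\alpha y:x\in M_1',y\in M_2'\}$. With $\lambda_\xi\eta=\xi\otimes\eta$, $(\omega_{\xi}\star\mathrm{id})(A)=\lambda_{\xi}^*A\lambda_\xi$; $(\mathrm{id}\star T)(A)$ for $A\ge0$ is given by $\|((\mathrm{id}\star T)(A))^{1/2}(\xi\otimes\eta)\|^2=\|T((\omega_{\xi}\star\mathrm{id})(A))^{1/2}\eta\|^2$, and $(T\star\mathrm{id})(A)$ symmetrically. A Hopf bimodule $(N,M,\alpha,\beta,\Gamma)$: faithful normal nondegenerate representation $\alpha$ and anti-representation $\beta$ of $N$ into $M$ with commuting ranges, and a normal $*$-homomorphism $\Gamma:M\to M\,{}_\beta\star_\alpha M$ with $\Gamma(\alpha(n)\beta(m))=\alpha(n)\,{}_\beta\otimes_\alpha\beta(m)$, $(\Gamma\star\mathrm{id})\Gamma=(\mathrm{id}\star\Gamma)\Gamma$. $T_L$ from $M$ to $\alpha(N)$ is left invariant if $(\mathrm{id}\star T_L)\Gamma(x)=T_L(x)\,{}_\beta\otimes_\alpha1$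 for $x\in\mathcal M_{T_L}^+$; $T_R$ from $M$ to $\beta(N)$ is right invariant if $(T_R\star\mathrm{id})\Gamma(x)=1\,{}_\beta\otimes_\alpha T_R(x)$ for $x\in\mathcal M_{T_R}^+$. An adapted measured quantum groupoid $(N,M,\alpha,\beta,\Gamma,\nu,T_L,T_R)$ is a Hopf bimodule with nsf left invariant $T_L$, nsf right invariant $T_R$ and an nsf weight $\nu$ on $N$ such that $\sigma_t^{T_L}(\beta(n))=\beta(\sigma^{\nu}_{-t}(n))$ and $\sigma_t^{T_R}(\alpha(n))=\alpha(\sigma_t^{\nu}(n))$. *)

theory Defs
  imports "HOL-Analysis.Analysis"
begin

text \<open>
  Every finite-dimensional C*-algebra (equivalently: von Neumann algebra) is represented here as a
  unital *-subalgebra of the algebra of all complex matrices indexed by a finite type, acting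
  faithfully and nondegenerately on the Hilbert space \<open>complex ^ 'n\<close>. The index type, and hence the
  faithful representation, is arbitrary. Linear maps between such algebras are HOL functions of
  which only the values on the algebra matter.

  In finite dimension a semifinite weight is finite on the positive cone and normality is automatic.
  So nsf weights are given by their (linear) extensions to the whole algebra, i.e. by faithful
  positive linear forms; likewise nsf operator-valued weights are given by faithful positive linear
  bimodule maps.
\<close>

section \<open>Matrices and finite-dimensional *-algebras\<close>

text \<open>The scalar product is linear in the first argument.\<close>

definition cinner :: "complex ^ 'a \<Rightarrow> complex ^ 'a \<Rightarrow> complex" where
  "cinner \<xi> \<eta> = (\<Sum>i\<in>UNIV. \<xi> $ i * cnj (\<eta> $ i))"

definition cadj :: "complex ^ 'a ^ 'b \<Rightarrow> complex ^ 'b ^ 'a" where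
  "cadj A = (\<chi> i j. cnj (A $ j $ i))"

definition smat :: "complex \<Rightarrow> complex ^ 'a ^ 'b \<Rightarrow> complex ^ 'a ^ 'b"  (infixr "\<cdot>\<^sub>C" 75) where
  "c \<cdot>\<^sub>C A = (\<chi> i j. c * A $ i $ j)"

definition tensor_vec :: "complex ^ 'a \<Rightarrow> complex ^ 'b \<Rightarrow> complex ^ ('a \<times> 'b)"
    (infixr "\<otimes>\<^sub>v" 75) where
  "\<xi> \<otimes>\<^sub>v \<eta> = (\<chi> p. \<xi> $ fst p * \<eta> $ snd p)"

definition tensor_mat :: "complex ^ 'a ^ 'a \<Rightarrow> complex ^ 'b ^ 'b \<Rightarrow> complex ^ ('a \<times> 'b) ^ ('a \<times> 'b)"
    (infixr "\<otimes>\<^sub>m" 75) where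
  "A \<otimes>\<^sub>m B = (\<chi> p q. A $ fst p $ fst q * B $ snd p $ snd q)"

definition psd :: "complex ^ 'a ^ 'a \<Rightarrow> bool" where
  "psd A \<longleftrightarrow> (\<forall>\<xi>. cinner (A *v \<xi>) \<xi> \<in> \<real>\<^sub>\<ge>\<^sub>0)"

definition psd_sqrt :: "complex ^ 'a ^ 'a \<Rightarrow> complex ^ 'a ^ 'a" where
  "psd_sqrt A = (THE S. psd S \<and> S ** S = A)"

definition fd_vn_algebra :: "(complex ^ 'a ^ 'a) set \<Rightarrow> bool" where
  "fd_vn_algebra A \<longleftrightarrow> mat 1 \<in> A
     \<and> (\<forall>x\<in>A. \<forall>y\<in>A. x + y \<in> A \<and> x ** y \<in> A)
     \<and> (\<forall>x\<in>A. cadj x \<in> A \<and> (\<forall>c. c \<cdot>\<^sub>C x \<in> A))"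

definition commutant :: "(complex ^ 'a ^ 'a) set \<Rightarrow> (complex ^ 'a ^ 'a) set" where
  "commutant A = {x. \<forall>y\<in>A. x ** y = y ** x}"

definition linear_form_on :: "(complex ^ 'a ^ 'a) set \<Rightarrow> (complex ^ 'a ^ 'a \<Rightarrow> complex) \<Rightarrow> bool" where
  "linear_form_on A f \<longleftrightarrow> (\<forall>x\<in>A. \<forall>y\<in>A. f (x + y) = f x + f y) \<and> (\<forall>c. \<forall>x\<in>A. f (c \<cdot>\<^sub>C x) = c * f x)"

definition linear_map_on ::
    "(complex ^ 'a ^ 'a) set \<Rightarrow> (complex ^ 'a ^ 'a \<Rightarrow> complex ^ 'b ^ 'b) \<Rightarrow> bool" where
  "linear_map_on A f \<longleftrightarrow>
     (\<forall>x\<in>A. \<forall>y\<in>A. f (x + y) = f x + f y) \<and> (\<forall>c. \<forall>x\<in>A. f (c \<cdot>\<^sub>C x) = c \<cdot>\<^sub>C f x)"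

definition star_hom_on ::
    "(complex ^ 'a ^ 'a) set \<Rightarrow> (complex ^ 'a ^ 'a \<Rightarrow> complex ^ 'b ^ 'b) \<Rightarrow> bool" where
  "star_hom_on A f \<longleftrightarrow> linear_map_on A f
     \<and> (\<forall>x\<in>A. \<forall>y\<in>A. f (x ** y) = f x ** f y) \<and> (\<forall>x\<in>A. f (cadj x) = cadj (f x))"

definition star_antihom_on ::
    "(complex ^ 'a ^ 'a) set \<Rightarrow> (complex ^ 'a ^ 'a \<Rightarrow> complex ^ 'b ^ 'b) \<Rightarrow> bool" where
  "star_antihom_on A f \<longleftrightarrow> linear_map_on A f
     \<and> (\<forall>x\<in>A. \<forall>y\<in>A. f (x ** y) = f y ** f x) \<and> (\<forall>x\<in>A. f (cadj x) = cadj (f x))"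

definition alg_tensor ::
    "(complex ^ 'a ^ 'a) set \<Rightarrow> (complex ^ 'b ^ 'b) set \<Rightarrow> (complex ^ ('a \<times> 'b) ^ ('a \<times> 'b)) set" where
  "alg_tensor A B =
     {t. \<exists>(k::nat) x y. (\<forall>i<k. x i \<in> A \<and> y i \<in> B) \<and> t = (\<Sum>i<k. x i \<otimes>\<^sub>m y i)}"

text \<open>
  The linear map on the tensor product of \<open>A\<close> and \<open>B\<close> induced by a bilinear map \<open>b\<close> on
  \<open>A \<times> B\<close>. Maps such as \<open>f \<otimes> id\<close>, \<open>id \<otimes> h\<close> or \<open>m (\<kappa> \<otimes> id)\<close> are all obtained this way.
\<close>

definition tensor_lift ::
    "(complex ^ 'a ^ 'a) set \<Rightarrow> (complex ^ 'b ^ 'b) set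
      \<Rightarrow> (complex ^ 'a ^ 'a \<Rightarrow> complex ^ 'b ^ 'b \<Rightarrow> 'v::comm_monoid_add)
      \<Rightarrow> complex ^ ('a \<times> 'b) ^ ('a \<times> 'b) \<Rightarrow> 'v" where
  "tensor_lift A B b t =
     (THE v. \<exists>(k::nat) x y. (\<forall>i<k. x i \<in> A \<and> y i \<in> B)
        \<and> t = (\<Sum>i<k. x i \<otimes>\<^sub>m y i) \<and> v = (\<Sum>i<k. b (x i) (y i)))"

definition reassoc ::
    "complex ^ (('a::finite \<times> 'b::finite) \<times> 'c::finite) ^ (('a \<times> 'b) \<times> 'c) \<Rightarrow> complex ^ ('a \<times> ('b \<times> 'c)) ^ ('a \<times> ('b \<times> 'c))"
  where
  "reassoc A = (\<chi> p q. A $ ((fst p, fst (snd p)), snd (snd p)) $ ((fst q, fst (snd q)), snd (snd q)))"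


section \<open>Weak Hopf C*-algebras\<close>

definition weak_hopf_cstar ::
    "(complex ^ 'n ^ 'n) set \<Rightarrow> (complex ^ 'n ^ 'n \<Rightarrow> complex ^ ('n \<times> 'n) ^ ('n \<times> 'n))
      \<Rightarrow> (complex ^ 'n ^ 'n \<Rightarrow> complex ^ 'n ^ 'n) \<Rightarrow> (complex ^ 'n ^ 'n \<Rightarrow> complex) \<Rightarrow> bool" where
  "weak_hopf_cstar M \<Gamma> \<kappa> \<epsilon> \<longleftrightarrow>
     fd_vn_algebra M
     \<comment> \<open>co-product\<close>
   \<and> (\<forall>x\<in>M. \<Gamma> x \<in> alg_tensor M M) \<and> star_hom_on M \<Gamma>
   \<and> (\<forall>x\<in>M. reassoc (tensor_lift M M (\<lambda>a b. \<Gamma> a \<otimes>\<^sub>m b) (\<Gamma> x)) = tensor_lift M M (\<lambda>a b. a \<otimes>\<^sub>m \<Gamma> b) (\<Gamma> x))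
     \<comment> \<open>co-unit\<close>
   \<and> linear_form_on M \<epsilon>
   \<and> (\<forall>x\<in>M. tensor_lift M M (\<lambda>a b. \<epsilon> a \<cdot>\<^sub>C b) (\<Gamma> x) = x \<and> tensor_lift M M (\<lambda>a b. \<epsilon> b \<cdot>\<^sub>C a) (\<Gamma> x) = x)
   \<and> (\<forall>x\<in>M. \<forall>y\<in>M. tensor_lift M M (\<lambda>a b. \<epsilon> a * \<epsilon> b) ((x \<otimes>\<^sub>m mat 1) ** \<Gamma> (mat 1) ** (mat 1 \<otimes>\<^sub>m y))
        = \<epsilon> (x ** y))
     \<comment> \<open>antipode\<close>
   \<and> linear_map_on M \<kappa> \<and> (\<forall>x\<in>M. \<kappa> x \<in> M)
   \<and> (\<forall>x\<in>M. \<forall>y\<in>M. \<kappa> (x ** y) = \<kappa> y ** \<kappa> x)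
   \<and> (\<forall>x\<in>M. \<Gamma> (\<kappa> x) = tensor_lift M M (\<lambda>a b. \<kappa> b \<otimes>\<^sub>m \<kappa> a) (\<Gamma> x) \<and> \<epsilon> (\<kappa> x) = \<epsilon> x)
   \<and> (\<forall>x\<in>M. \<kappa> (cadj (\<kappa> (cadj x))) = x)
   \<and> (\<forall>x\<in>M. tensor_lift (alg_tensor M M) M
                (\<lambda>t c. tensor_lift M M (\<lambda>a b. \<kappa> a ** b) t \<otimes>\<^sub>m c)
                (tensor_lift M M (\<lambda>a b. \<Gamma> a \<otimes>\<^sub>m b) (\<Gamma> x))
        = (mat 1 \<otimes>\<^sub>m x) ** \<Gamma> (mat 1))"

definition eps_t ::
    "(complex ^ 'n ^ 'n) set \<Rightarrow> (complex ^ 'n ^ 'n \<Rightarrow> complex ^ ('n \<times> 'n) ^ ('n \<times> 'n))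
      \<Rightarrow> (complex ^ 'n ^ 'n \<Rightarrow> complex ^ 'n ^ 'n) \<Rightarrow> complex ^ 'n ^ 'n \<Rightarrow> complex ^ 'n ^ 'n" where
  "eps_t M \<Gamma> \<kappa> x = tensor_lift M M (\<lambda>a b. a ** \<kappa> b) (\<Gamma> x)"

definition positive_form_on :: "(complex ^ 'a ^ 'a) set \<Rightarrow> (complex ^ 'a ^ 'a \<Rightarrow> complex) \<Rightarrow> bool" where
  "positive_form_on A \<psi> \<longleftrightarrow> linear_form_on A \<psi> \<and> (\<forall>x\<in>A. psd x \<longrightarrow> \<psi> x \<in> \<real>\<^sub>\<ge>\<^sub>0)"

definition faithful_form_on :: "(complex ^ 'a ^ 'a) set \<Rightarrow> (complex ^ 'a ^ 'a \<Rightarrow> complex) \<Rightarrow> bool" where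
  "faithful_form_on A \<psi> \<longleftrightarrow> (\<forall>x\<in>A. psd x \<longrightarrow> \<psi> x = 0 \<longrightarrow> x = 0)"

definition haar_measure ::
    "(complex ^ 'n ^ 'n) set \<Rightarrow> (complex ^ 'n ^ 'n \<Rightarrow> complex ^ ('n \<times> 'n) ^ ('n \<times> 'n))
      \<Rightarrow> (complex ^ 'n ^ 'n \<Rightarrow> complex ^ 'n ^ 'n) \<Rightarrow> (complex ^ 'n ^ 'n \<Rightarrow> complex) \<Rightarrow> bool" where
  "haar_measure M \<Gamma> \<kappa> h \<longleftrightarrow>
     positive_form_on M h \<and> faithful_form_on M h
   \<and> (\<forall>x\<in>M. h (\<kappa> x) = h x)
   \<and> tensor_lift M M (\<lambda>a b. h b \<cdot>\<^sub>C a) (\<Gamma> (mat 1)) = mat 1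
   \<and> (\<forall>x\<in>M. \<forall>y\<in>M. tensor_lift M M (\<lambda>a b. h b \<cdot>\<^sub>C a) ((mat 1 \<otimes>\<^sub>m y) ** \<Gamma> x)
        = \<kappa> (tensor_lift M M (\<lambda>a b. h b \<cdot>\<^sub>C a) (\<Gamma> y ** (mat 1 \<otimes>\<^sub>m x))))"

definition haar_source_exp ::
    "(complex ^ 'n ^ 'n) set \<Rightarrow> (complex ^ 'n ^ 'n \<Rightarrow> complex ^ ('n \<times> 'n) ^ ('n \<times> 'n))
      \<Rightarrow> (complex ^ 'n ^ 'n \<Rightarrow> complex) \<Rightarrow> complex ^ 'n ^ 'n \<Rightarrow> complex ^ 'n ^ 'n" where
  "haar_source_exp M \<Gamma> h x = tensor_lift M M (\<lambda>a b. h a \<cdot>\<^sub>C b) (\<Gamma> x)"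

definition haar_range_exp ::
    "(complex ^ 'n ^ 'n) set \<Rightarrow> (complex ^ 'n ^ 'n \<Rightarrow> complex ^ ('n \<times> 'n) ^ ('n \<times> 'n))
      \<Rightarrow> (complex ^ 'n ^ 'n \<Rightarrow> complex) \<Rightarrow> complex ^ 'n ^ 'n \<Rightarrow> complex ^ 'n ^ 'n" where
  "haar_range_exp M \<Gamma> h x = tensor_lift M M (\<lambda>a b. h b \<cdot>\<^sub>C a) (\<Gamma> x)"


section \<open>Weights and Tomita--Takesaki theory\<close>

definition nsf_weight :: "(complex ^ 'a ^ 'a) set \<Rightarrow> (complex ^ 'a ^ 'a \<Rightarrow> complex) \<Rightarrow> bool" where
  "nsf_weight A \<psi> \<longleftrightarrow> positive_form_on A \<psi> \<and> faithful_form_on A \<psi>"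

text \<open>
  The GNS space \<open>H\<^sub>\<psi>\<close> is \<open>A\<close> itself with the scalar product below, \<open>\<Lambda>\<^sub>\<psi>\<close> is the identity, and \<open>A\<close>
  acts by left multiplication. Tomita's operator is \<open>S = cadj\<close>; being antilinear, its adjoint
  satisfies \<open>(S\<^sup>* u | b) = (S b | u)\<close>, so that \<open>\<Delta> = S\<^sup>* S\<close> means \<open>(\<Delta> a | b) = (S b | S a)\<close>.
\<close>

definition gns_inner ::
    "(complex ^ 'a ^ 'a \<Rightarrow> complex) \<Rightarrow> complex ^ 'a ^ 'a \<Rightarrow> complex ^ 'a ^ 'a \<Rightarrow> complex" where
  "gns_inner \<psi> a b = \<psi> (cadj b ** a)"

definition gns_norm :: "(complex ^ 'a ^ 'a \<Rightarrow> complex) \<Rightarrow> complex ^ 'a ^ 'a \<Rightarrow> real" where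
  "gns_norm \<psi> a = sqrt (Re (gns_inner \<psi> a a))"

definition modular_op ::
    "(complex ^ 'a ^ 'a) set \<Rightarrow> (complex ^ 'a ^ 'a \<Rightarrow> complex) \<Rightarrow> complex ^ 'a ^ 'a \<Rightarrow> complex ^ 'a ^ 'a" where
  "modular_op A \<psi> a = (THE c. c \<in> A \<and> (\<forall>b\<in>A. gns_inner \<psi> c b = gns_inner \<psi> (cadj b) (cadj a)))"

text \<open>The power \<open>\<Delta>\<^sup>z\<close>, applied to \<open>a\<close> by decomposing \<open>a\<close> into eigenvectors of \<open>\<Delta>\<close>.\<close>

definition modular_power ::
    "(complex ^ 'a ^ 'a) set \<Rightarrow> (complex ^ 'a ^ 'a \<Rightarrow> complex) \<Rightarrow> complex
      \<Rightarrow> complex ^ 'a ^ 'a \<Rightarrow> complex ^ 'a ^ 'a" where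
  "modular_power A \<psi> z a =
     (THE c. \<exists>(k::nat) (r :: nat \<Rightarrow> real) v.
        (\<forall>i<k. 0 < r i \<and> v i \<in> A \<and> modular_op A \<psi> (v i) = complex_of_real (r i) \<cdot>\<^sub>C v i)
      \<and> a = (\<Sum>i<k. v i) \<and> c = (\<Sum>i<k. (complex_of_real (r i) powr z) \<cdot>\<^sub>C v i))"

text \<open>The modular conjugation \<open>J = S \<Delta>\<^sup>-\<^sup>1\<^sup>/\<^sup>2\<close>.\<close>

definition modular_conj ::
    "(complex ^ 'a ^ 'a) set \<Rightarrow> (complex ^ 'a ^ 'a \<Rightarrow> complex) \<Rightarrow> complex ^ 'a ^ 'a \<Rightarrow> complex ^ 'a ^ 'a" where
  "modular_conj A \<psi> a = cadj (modular_power A \<psi> (- 1 / 2) a)"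

text \<open>\<open>\<sigma>\<^sub>t(x) = \<Delta>\<^sup>i\<^sup>t x \<Delta>\<^sup>-\<^sup>i\<^sup>t\<close> as an operator on the GNS space.\<close>

definition modular_aut ::
    "(complex ^ 'a ^ 'a) set \<Rightarrow> (complex ^ 'a ^ 'a \<Rightarrow> complex) \<Rightarrow> real \<Rightarrow> complex ^ 'a ^ 'a \<Rightarrow> complex ^ 'a ^ 'a"
  where
  "modular_aut A \<psi> t x =
     (THE y. y \<in> A \<and> (\<forall>a\<in>A. y ** a =
        modular_power A \<psi> (\<i> * complex_of_real t) (x ** modular_power A \<psi> (- \<i> * complex_of_real t) a)))"

definition nsf_op_valued_weight ::
    "(complex ^ 'a ^ 'a) set \<Rightarrow> (complex ^ 'a ^ 'a) set \<Rightarrow> (complex ^ 'a ^ 'a \<Rightarrow> complex ^ 'a ^ 'a) \<Rightarrow> bool"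
  where
  "nsf_op_valued_weight M P T \<longleftrightarrow>
     fd_vn_algebra M \<and> fd_vn_algebra P \<and> P \<subseteq> M
   \<and> linear_map_on M T \<and> (\<forall>x\<in>M. T x \<in> P)
   \<and> (\<forall>x\<in>M. psd x \<longrightarrow> psd (T x))
   \<and> (\<forall>x\<in>M. \<forall>a\<in>P. T (cadj a ** x ** a) = cadj a ** T x ** a)
   \<and> (\<forall>x\<in>M. psd x \<longrightarrow> T x = 0 \<longrightarrow> x = 0)"

definition op_weight_domain ::
    "(complex ^ 'a ^ 'a) set \<Rightarrow> (complex ^ 'a ^ 'a) set \<Rightarrow> (complex ^ 'a ^ 'a \<Rightarrow> complex ^ 'a ^ 'a)
      \<Rightarrow> (complex ^ 'a ^ 'a) set" where
  "op_weight_domain M P T = {x \<in> M. psd x \<and> T x \<in> P \<and> psd (T x)}"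

text \<open>
  \<open>\<sigma>\<^sup>T\<^sub>t\<close>, for arguments in \<open>M \<inter> commutant P\<close>: the value common to all \<open>\<sigma>\<^sub>t\<close> of
  \<open>\<phi> \<circ> T\<close>, with \<open>\<phi>\<close> an nsf weight on \<open>P\<close>.
\<close>

definition op_weight_modular_aut ::
    "(complex ^ 'a ^ 'a) set \<Rightarrow> (complex ^ 'a ^ 'a) set \<Rightarrow> (complex ^ 'a ^ 'a \<Rightarrow> complex ^ 'a ^ 'a)
      \<Rightarrow> real \<Rightarrow> complex ^ 'a ^ 'a \<Rightarrow> complex ^ 'a ^ 'a" where
  "op_weight_modular_aut M P T t x =
     (THE y. \<forall>\<phi>. nsf_weight P \<phi> \<longrightarrow> y = modular_aut M (\<phi> \<circ> T) t x)"


section \<open>Relative tensor products\<close>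

text \<open>
  Throughout, \<open>\<beta>\<close> is an anti-representation of \<open>N\<close> on \<open>H = complex ^ 'a\<close> and \<open>\<alpha>\<close> a representation of
  \<open>N\<close> on \<open>K = complex ^ 'b\<close>. A Hilbert space which is only a subspace of \<open>complex ^ 'a\<close> is handled
  by operators vanishing on its orthogonal complement (so \<open>\<beta>\<close> may fail to be unital); vectors in
  the complement then contribute nothing below.
\<close>

definition bounded_right_vectors ::
    "(complex ^ 'k ^ 'k) set \<Rightarrow> (complex ^ 'k ^ 'k \<Rightarrow> complex) \<Rightarrow> (complex ^ 'k ^ 'k \<Rightarrow> complex ^ 'a ^ 'a)
      \<Rightarrow> (complex ^ 'a) set" where
  "bounded_right_vectors N \<psi> \<beta> = {\<xi>. \<exists>C. \<forall>y\<in>N. norm (\<beta> (cadj y) *v \<xi>) \<le> C * gns_norm \<psi> y}"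

definition bounded_left_vectors ::
    "(complex ^ 'k ^ 'k) set \<Rightarrow> (complex ^ 'k ^ 'k \<Rightarrow> complex) \<Rightarrow> (complex ^ 'k ^ 'k \<Rightarrow> complex ^ 'b ^ 'b)
      \<Rightarrow> (complex ^ 'b) set" where
  "bounded_left_vectors N \<psi> \<alpha> = {\<eta>. \<exists>C. \<forall>y\<in>N. norm (\<alpha> y *v \<eta>) \<le> C * gns_norm \<psi> y}"

definition R_op ::
    "(complex ^ 'k ^ 'k) set \<Rightarrow> (complex ^ 'k ^ 'k \<Rightarrow> complex) \<Rightarrow> (complex ^ 'k ^ 'k \<Rightarrow> complex ^ 'a ^ 'a)
      \<Rightarrow> complex ^ 'a \<Rightarrow> complex ^ 'k ^ 'k \<Rightarrow> complex ^ 'a" where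
  "R_op N \<psi> \<beta> \<xi> a = (THE v. \<exists>y\<in>N. a = modular_conj N \<psi> y \<and> v = \<beta> (cadj y) *v \<xi>)"

text \<open>\<open>\<langle>\<xi>,\<xi>'\<rangle> = R(\<xi>')\<^sup>* R(\<xi>)\<close>, as an element of \<open>N\<close> acting on the GNS space.\<close>

definition N_inner ::
    "(complex ^ 'k ^ 'k) set \<Rightarrow> (complex ^ 'k ^ 'k \<Rightarrow> complex) \<Rightarrow> (complex ^ 'k ^ 'k \<Rightarrow> complex ^ 'a ^ 'a)
      \<Rightarrow> complex ^ 'a \<Rightarrow> complex ^ 'a \<Rightarrow> complex ^ 'k ^ 'k" where
  "N_inner N \<psi> \<beta> \<xi> \<xi>' =
     (THE n. n \<in> N \<and> (\<forall>a\<in>N. \<forall>b\<in>N.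
        gns_inner \<psi> (n ** a) b = cinner (R_op N \<psi> \<beta> \<xi> a) (R_op N \<psi> \<beta> \<xi>' b)))"

text \<open>
  The Gram operator, on the ordinary tensor product \<open>complex ^ ('a \<times> 'b)\<close>, of the sesquilinear form
  defining the relative tensor product. If \<open>G\<close> is this operator, then \<open>\<xi> \<otimes> \<eta> \<mapsto> G\<^sup>1\<^sup>/\<^sup>2 (\<xi> \<otimes> \<eta>)\<close>
  induces the canonical isometric embedding of the relative tensor product into the ordinary one,
  with range projection in the tensor product of \<open>\<beta>(N)\<close> and \<open>\<alpha>(N)\<close>. From now on the relative tensor
  product is identified with its image, and operators on it with matrices on the ordinary tensor
  product living under the range projection.
\<close>

definition rtp_gram ::
    "(complex ^ 'k ^ 'k) set \<Rightarrow> (complex ^ 'k ^ 'k \<Rightarrow> complex)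
      \<Rightarrow> (complex ^ 'k ^ 'k \<Rightarrow> complex ^ 'a ^ 'a) \<Rightarrow> (complex ^ 'k ^ 'k \<Rightarrow> complex ^ 'b ^ 'b)
      \<Rightarrow> complex ^ ('a \<times> 'b) ^ ('a \<times> 'b)" where
  "rtp_gram N \<psi> \<beta> \<alpha> =
     (THE G. \<forall>\<xi>\<in>bounded_right_vectors N \<psi> \<beta>. \<forall>\<xi>'\<in>bounded_right_vectors N \<psi> \<beta>. \<forall>\<eta> \<eta>'.
        cinner (G *v (\<xi> \<otimes>\<^sub>v \<eta>)) (\<xi>' \<otimes>\<^sub>v \<eta>') = cinner (\<alpha> (N_inner N \<psi> \<beta> \<xi> \<xi>') *v \<eta>) \<eta>')"

definition rtp_embed ::
    "(complex ^ 'k ^ 'k) set \<Rightarrow> (complex ^ 'k ^ 'k \<Rightarrow> complex)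
      \<Rightarrow> (complex ^ 'k ^ 'k \<Rightarrow> complex ^ 'a ^ 'a) \<Rightarrow> (complex ^ 'k ^ 'k \<Rightarrow> complex ^ 'b ^ 'b)
      \<Rightarrow> complex ^ ('a \<times> 'b) ^ ('a \<times> 'b)" where
  "rtp_embed N \<psi> \<beta> \<alpha> = psd_sqrt (rtp_gram N \<psi> \<beta> \<alpha>)"

definition rtp_vec ::
    "(complex ^ 'k ^ 'k) set \<Rightarrow> (complex ^ 'k ^ 'k \<Rightarrow> complex)
      \<Rightarrow> (complex ^ 'k ^ 'k \<Rightarrow> complex ^ 'a ^ 'a) \<Rightarrow> (complex ^ 'k ^ 'k \<Rightarrow> complex ^ 'b ^ 'b)
      \<Rightarrow> complex ^ 'a \<Rightarrow> complex ^ 'b \<Rightarrow> complex ^ ('a \<times> 'b)" where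
  "rtp_vec N \<psi> \<beta> \<alpha> \<xi> \<eta> = rtp_embed N \<psi> \<beta> \<alpha> *v (\<xi> \<otimes>\<^sub>v \<eta>)"

definition rtp_proj ::
    "(complex ^ 'k ^ 'k) set \<Rightarrow> (complex ^ 'k ^ 'k \<Rightarrow> complex)
      \<Rightarrow> (complex ^ 'k ^ 'k \<Rightarrow> complex ^ 'a ^ 'a) \<Rightarrow> (complex ^ 'k ^ 'k \<Rightarrow> complex ^ 'b ^ 'b)
      \<Rightarrow> complex ^ ('a \<times> 'b) ^ ('a \<times> 'b)" where
  "rtp_proj N \<psi> \<beta> \<alpha> =
     (THE p. p ** p = p \<and> cadj p = p \<and> range ((*v) p) = range ((*v) (rtp_embed N \<psi> \<beta> \<alpha>)))"

definition rtp_ops ::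
    "(complex ^ 'k ^ 'k) set \<Rightarrow> (complex ^ 'k ^ 'k \<Rightarrow> complex)
      \<Rightarrow> (complex ^ 'k ^ 'k \<Rightarrow> complex ^ 'a ^ 'a) \<Rightarrow> (complex ^ 'k ^ 'k \<Rightarrow> complex ^ 'b ^ 'b)
      \<Rightarrow> (complex ^ ('a \<times> 'b) ^ ('a \<times> 'b)) set" where
  "rtp_ops N \<psi> \<beta> \<alpha> = {A. rtp_proj N \<psi> \<beta> \<alpha> ** A ** rtp_proj N \<psi> \<beta> \<alpha> = A}"

text \<open>The operator \<open>x \<^sub>\<beta>\<otimes>\<^sub>\<alpha> y\<close>, for \<open>x\<close> in the commutant of \<open>\<beta>(N)\<close> and \<open>y\<close> in that of \<open>\<alpha>(N)\<close>.\<close>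

definition rtp_op ::
    "(complex ^ 'k ^ 'k) set \<Rightarrow> (complex ^ 'k ^ 'k \<Rightarrow> complex)
      \<Rightarrow> (complex ^ 'k ^ 'k \<Rightarrow> complex ^ 'a ^ 'a) \<Rightarrow> (complex ^ 'k ^ 'k \<Rightarrow> complex ^ 'b ^ 'b)
      \<Rightarrow> complex ^ 'a ^ 'a \<Rightarrow> complex ^ 'b ^ 'b \<Rightarrow> complex ^ ('a \<times> 'b) ^ ('a \<times> 'b)" where
  "rtp_op N \<psi> \<beta> \<alpha> x y =
     (THE A. A \<in> rtp_ops N \<psi> \<beta> \<alpha>
        \<and> (\<forall>\<xi> \<eta>. A *v rtp_vec N \<psi> \<beta> \<alpha> \<xi> \<eta> = rtp_vec N \<psi> \<beta> \<alpha> (x *v \<xi>) (y *v \<eta>)))"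

definition fiber_product ::
    "(complex ^ 'k ^ 'k) set \<Rightarrow> (complex ^ 'k ^ 'k \<Rightarrow> complex)
      \<Rightarrow> (complex ^ 'k ^ 'k \<Rightarrow> complex ^ 'a ^ 'a) \<Rightarrow> (complex ^ 'k ^ 'k \<Rightarrow> complex ^ 'b ^ 'b)
      \<Rightarrow> (complex ^ 'a ^ 'a) set \<Rightarrow> (complex ^ 'b ^ 'b) set \<Rightarrow> (complex ^ ('a \<times> 'b) ^ ('a \<times> 'b)) set" where
  "fiber_product N \<psi> \<beta> \<alpha> M1 M2 =
     {A \<in> rtp_ops N \<psi> \<beta> \<alpha>. \<forall>x\<in>commutant M1. \<forall>y\<in>commutant M2.
        A ** rtp_op N \<psi> \<beta> \<alpha> x y = rtp_op N \<psi> \<beta> \<alpha> x y ** A}"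

text \<open>The creation operators \<open>\<eta> \<mapsto> \<xi> \<otimes> \<eta>\<close> and \<open>\<xi> \<mapsto> \<xi> \<otimes> \<eta>\<close> into the relative tensor product.\<close>

definition rtp_lambda ::
    "(complex ^ 'k ^ 'k) set \<Rightarrow> (complex ^ 'k ^ 'k \<Rightarrow> complex)
      \<Rightarrow> (complex ^ 'k ^ 'k \<Rightarrow> complex ^ 'a ^ 'a) \<Rightarrow> (complex ^ 'k ^ 'k \<Rightarrow> complex ^ 'b ^ 'b)
      \<Rightarrow> complex ^ 'a \<Rightarrow> complex ^ 'b ^ ('a \<times> 'b)" where
  "rtp_lambda N \<psi> \<beta> \<alpha> \<xi> = matrix (\<lambda>\<eta>. rtp_vec N \<psi> \<beta> \<alpha> \<xi> \<eta>)"

definition rtp_rho ::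
    "(complex ^ 'k ^ 'k) set \<Rightarrow> (complex ^ 'k ^ 'k \<Rightarrow> complex)
      \<Rightarrow> (complex ^ 'k ^ 'k \<Rightarrow> complex ^ 'a ^ 'a) \<Rightarrow> (complex ^ 'k ^ 'k \<Rightarrow> complex ^ 'b ^ 'b)
      \<Rightarrow> complex ^ 'b \<Rightarrow> complex ^ 'a ^ ('a \<times> 'b)" where
  "rtp_rho N \<psi> \<beta> \<alpha> \<eta> = matrix (\<lambda>\<xi>. rtp_vec N \<psi> \<beta> \<alpha> \<xi> \<eta>)"

text \<open>The slices \<open>(\<omega>\<^sub>\<xi> \<star> id)(A)\<close> and \<open>(id \<star> \<omega>\<^sub>\<eta>)(A)\<close>.\<close>

definition left_slice ::
    "(complex ^ 'k ^ 'k) set \<Rightarrow> (complex ^ 'k ^ 'k \<Rightarrow> complex)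
      \<Rightarrow> (complex ^ 'k ^ 'k \<Rightarrow> complex ^ 'a ^ 'a) \<Rightarrow> (complex ^ 'k ^ 'k \<Rightarrow> complex ^ 'b ^ 'b)
      \<Rightarrow> complex ^ 'a \<Rightarrow> complex ^ ('a \<times> 'b) ^ ('a \<times> 'b) \<Rightarrow> complex ^ 'b ^ 'b" where
  "left_slice N \<psi> \<beta> \<alpha> \<xi> A = cadj (rtp_lambda N \<psi> \<beta> \<alpha> \<xi>) ** A ** rtp_lambda N \<psi> \<beta> \<alpha> \<xi>"

definition right_slice ::
    "(complex ^ 'k ^ 'k) set \<Rightarrow> (complex ^ 'k ^ 'k \<Rightarrow> complex)
      \<Rightarrow> (complex ^ 'k ^ 'k \<Rightarrow> complex ^ 'a ^ 'a) \<Rightarrow> (complex ^ 'k ^ 'k \<Rightarrow> complex ^ 'b ^ 'b)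
      \<Rightarrow> complex ^ 'b \<Rightarrow> complex ^ ('a \<times> 'b) ^ ('a \<times> 'b) \<Rightarrow> complex ^ 'a ^ 'a" where
  "right_slice N \<psi> \<beta> \<alpha> \<eta> A = cadj (rtp_rho N \<psi> \<beta> \<alpha> \<eta>) ** A ** rtp_rho N \<psi> \<beta> \<alpha> \<eta>"

definition id_star_weight ::
    "(complex ^ 'k ^ 'k) set \<Rightarrow> (complex ^ 'k ^ 'k \<Rightarrow> complex)
      \<Rightarrow> (complex ^ 'k ^ 'k \<Rightarrow> complex ^ 'a ^ 'a) \<Rightarrow> (complex ^ 'k ^ 'k \<Rightarrow> complex ^ 'b ^ 'b)
      \<Rightarrow> (complex ^ 'b ^ 'b \<Rightarrow> complex ^ 'b ^ 'b)
      \<Rightarrow> complex ^ ('a \<times> 'b) ^ ('a \<times> 'b) \<Rightarrow> complex ^ ('a \<times> 'b) ^ ('a \<times> 'b)" where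
  "id_star_weight N \<psi> \<beta> \<alpha> T A =
     (THE B. psd B \<and> B \<in> rtp_ops N \<psi> \<beta> \<alpha> \<and>
        (\<forall>\<xi>\<in>bounded_right_vectors N \<psi> \<beta>. \<forall>\<eta>.
           (norm (psd_sqrt B *v rtp_vec N \<psi> \<beta> \<alpha> \<xi> \<eta>))\<^sup>2
             = (norm (psd_sqrt (T (left_slice N \<psi> \<beta> \<alpha> \<xi> A)) *v \<eta>))\<^sup>2))"

definition weight_star_id ::
    "(complex ^ 'k ^ 'k) set \<Rightarrow> (complex ^ 'k ^ 'k \<Rightarrow> complex)
      \<Rightarrow> (complex ^ 'k ^ 'k \<Rightarrow> complex ^ 'a ^ 'a) \<Rightarrow> (complex ^ 'k ^ 'k \<Rightarrow> complex ^ 'b ^ 'b)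
      \<Rightarrow> (complex ^ 'a ^ 'a \<Rightarrow> complex ^ 'a ^ 'a)
      \<Rightarrow> complex ^ ('a \<times> 'b) ^ ('a \<times> 'b) \<Rightarrow> complex ^ ('a \<times> 'b) ^ ('a \<times> 'b)" where
  "weight_star_id N \<psi> \<beta> \<alpha> T A =
     (THE B. psd B \<and> B \<in> rtp_ops N \<psi> \<beta> \<alpha> \<and>
        (\<forall>\<eta>\<in>bounded_left_vectors N \<psi> \<alpha>. \<forall>\<xi>.
           (norm (psd_sqrt B *v rtp_vec N \<psi> \<beta> \<alpha> \<xi> \<eta>))\<^sup>2
             = (norm (psd_sqrt (T (right_slice N \<psi> \<beta> \<alpha> \<eta> A)) *v \<xi>))\<^sup>2))"

text \<open>
  For \<open>\<Gamma>\<close> with values in the operators on the relative tensor square of \<open>complex ^ 'n\<close>, the maps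
  \<open>\<Gamma> \<star> id\<close> and \<open>id \<star> \<Gamma>\<close>, determined by their slices:
  \<open>(id \<star> \<omega>\<^sub>\<eta>) ((\<Gamma> \<star> id) A) = \<Gamma> ((id \<star> \<omega>\<^sub>\<eta>) A)\<close> and symmetrically. The square carries the
  anti-representation \<open>n \<mapsto> 1 \<^sub>\<beta>\<otimes>\<^sub>\<alpha> \<beta>(n)\<close> and the representation \<open>n \<mapsto> \<alpha>(n) \<^sub>\<beta>\<otimes>\<^sub>\<alpha> 1\<close>, from which the
  two iterated relative tensor products are formed. Since \<open>\<alpha>(N)\<close> and \<open>\<beta>(N)\<close> commute, so do the Gram
  operators acting on legs 1, 2 and on legs 2, 3; both iterated products are therefore embedded in
  the triple tensor product by the product of the two square roots, and their canonical
  identification is simply \<open>reassoc\<close>.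
\<close>

definition cop_star_id ::
    "(complex ^ 'k ^ 'k) set \<Rightarrow> (complex ^ 'k ^ 'k \<Rightarrow> complex)
      \<Rightarrow> (complex ^ 'k ^ 'k \<Rightarrow> complex ^ 'n ^ 'n) \<Rightarrow> (complex ^ 'k ^ 'k \<Rightarrow> complex ^ 'n ^ 'n)
      \<Rightarrow> (complex ^ 'n ^ 'n \<Rightarrow> complex ^ ('n \<times> 'n) ^ ('n \<times> 'n))
      \<Rightarrow> complex ^ ('n \<times> 'n) ^ ('n \<times> 'n) \<Rightarrow> complex ^ (('n \<times> 'n) \<times> 'n) ^ (('n \<times> 'n) \<times> 'n)" where
  "cop_star_id N \<psi> \<beta> \<alpha> \<Gamma> A =
     (let \<beta>2 = (\<lambda>n. rtp_op N \<psi> \<beta> \<alpha> (mat 1) (\<beta> n)) in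
      THE B. B \<in> rtp_ops N \<psi> \<beta>2 \<alpha> \<and>
        (\<forall>\<eta>\<in>bounded_left_vectors N \<psi> \<alpha>.
           right_slice N \<psi> \<beta>2 \<alpha> \<eta> B = \<Gamma> (right_slice N \<psi> \<beta> \<alpha> \<eta> A)))"

definition id_star_cop ::
    "(complex ^ 'k ^ 'k) set \<Rightarrow> (complex ^ 'k ^ 'k \<Rightarrow> complex)
      \<Rightarrow> (complex ^ 'k ^ 'k \<Rightarrow> complex ^ 'n ^ 'n) \<Rightarrow> (complex ^ 'k ^ 'k \<Rightarrow> complex ^ 'n ^ 'n)
      \<Rightarrow> (complex ^ 'n ^ 'n \<Rightarrow> complex ^ ('n \<times> 'n) ^ ('n \<times> 'n))
      \<Rightarrow> complex ^ ('n \<times> 'n) ^ ('n \<times> 'n) \<Rightarrow> complex ^ ('n \<times> ('n \<times> 'n)) ^ ('n \<times> ('n \<times> 'n))" where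
  "id_star_cop N \<psi> \<beta> \<alpha> \<Gamma> A =
     (let \<alpha>2 = (\<lambda>n. rtp_op N \<psi> \<beta> \<alpha> (\<alpha> n) (mat 1)) in
      THE B. B \<in> rtp_ops N \<psi> \<beta> \<alpha>2 \<and>
        (\<forall>\<xi>\<in>bounded_right_vectors N \<psi> \<beta>.
           left_slice N \<psi> \<beta> \<alpha>2 \<xi> B = \<Gamma> (left_slice N \<psi> \<beta> \<alpha> \<xi> A)))"


section \<open>Adapted measured quantum groupoids\<close>

text \<open>
  The weight \<open>\<nu>\<close> on \<open>N\<close> is only used to form the relative tensor products (which do not depend on it
  up to canonical isomorphism).
\<close>

definition hopf_bimodule ::
    "(complex ^ 'k ^ 'k) set \<Rightarrow> (complex ^ 'n ^ 'n) set
      \<Rightarrow> (complex ^ 'k ^ 'k \<Rightarrow> complex ^ 'n ^ 'n) \<Rightarrow> (complex ^ 'k ^ 'k \<Rightarrow> complex ^ 'n ^ 'n)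
      \<Rightarrow> (complex ^ 'n ^ 'n \<Rightarrow> complex ^ ('n \<times> 'n) ^ ('n \<times> 'n))
      \<Rightarrow> (complex ^ 'k ^ 'k \<Rightarrow> complex) \<Rightarrow> bool" where
  "hopf_bimodule N M \<alpha> \<beta> \<Gamma> \<nu> \<longleftrightarrow>
     fd_vn_algebra N \<and> fd_vn_algebra M
   \<and> star_hom_on N \<alpha> \<and> inj_on \<alpha> N \<and> \<alpha> (mat 1) = mat 1 \<and> \<alpha> ` N \<subseteq> M
   \<and> star_antihom_on N \<beta> \<and> inj_on \<beta> N \<and> \<beta> (mat 1) = mat 1 \<and> \<beta> ` N \<subseteq> M
   \<and> (\<forall>n\<in>N. \<forall>m\<in>N. \<alpha> n ** \<beta> m = \<beta> m ** \<alpha> n)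
   \<and> star_hom_on M \<Gamma> \<and> \<Gamma> ` M \<subseteq> fiber_product N \<nu> \<beta> \<alpha> M M
   \<and> (\<forall>n\<in>N. \<forall>m\<in>N. \<Gamma> (\<alpha> n ** \<beta> m) = rtp_op N \<nu> \<beta> \<alpha> (\<alpha> n) (\<beta> m))
   \<and> (\<forall>x\<in>M. reassoc (cop_star_id N \<nu> \<beta> \<alpha> \<Gamma> (\<Gamma> x)) = id_star_cop N \<nu> \<beta> \<alpha> \<Gamma> (\<Gamma> x))"

definition left_invariant ::
    "(complex ^ 'k ^ 'k) set \<Rightarrow> (complex ^ 'n ^ 'n) set
      \<Rightarrow> (complex ^ 'k ^ 'k \<Rightarrow> complex ^ 'n ^ 'n) \<Rightarrow> (complex ^ 'k ^ 'k \<Rightarrow> complex ^ 'n ^ 'n)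
      \<Rightarrow> (complex ^ 'n ^ 'n \<Rightarrow> complex ^ ('n \<times> 'n) ^ ('n \<times> 'n))
      \<Rightarrow> (complex ^ 'k ^ 'k \<Rightarrow> complex) \<Rightarrow> (complex ^ 'n ^ 'n \<Rightarrow> complex ^ 'n ^ 'n) \<Rightarrow> bool" where
  "left_invariant N M \<alpha> \<beta> \<Gamma> \<nu> T \<longleftrightarrow>
     (\<forall>x\<in>op_weight_domain M (\<alpha> ` N) T.
        id_star_weight N \<nu> \<beta> \<alpha> T (\<Gamma> x) = rtp_op N \<nu> \<beta> \<alpha> (T x) (mat 1))"

definition right_invariant ::
    "(complex ^ 'k ^ 'k) set \<Rightarrow> (complex ^ 'n ^ 'n) set
      \<Rightarrow> (complex ^ 'k ^ 'k \<Rightarrow> complex ^ 'n ^ 'n) \<Rightarrow> (complex ^ 'k ^ 'k \<Rightarrow> complex ^ 'n ^ 'n)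
      \<Rightarrow> (complex ^ 'n ^ 'n \<Rightarrow> complex ^ ('n \<times> 'n) ^ ('n \<times> 'n))
      \<Rightarrow> (complex ^ 'k ^ 'k \<Rightarrow> complex) \<Rightarrow> (complex ^ 'n ^ 'n \<Rightarrow> complex ^ 'n ^ 'n) \<Rightarrow> bool" where
  "right_invariant N M \<alpha> \<beta> \<Gamma> \<nu> T \<longleftrightarrow>
     (\<forall>x\<in>op_weight_domain M (\<beta> ` N) T.
        weight_star_id N \<nu> \<beta> \<alpha> T (\<Gamma> x) = rtp_op N \<nu> \<beta> \<alpha> (mat 1) (T x))"

definition adapted_mqg ::
    "(complex ^ 'k ^ 'k) set \<Rightarrow> (complex ^ 'n ^ 'n) set
      \<Rightarrow> (complex ^ 'k ^ 'k \<Rightarrow> complex ^ 'n ^ 'n) \<Rightarrow> (complex ^ 'k ^ 'k \<Rightarrow> complex ^ 'n ^ 'n)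
      \<Rightarrow> (complex ^ 'n ^ 'n \<Rightarrow> complex ^ ('n \<times> 'n) ^ ('n \<times> 'n))
      \<Rightarrow> (complex ^ 'k ^ 'k \<Rightarrow> complex)
      \<Rightarrow> (complex ^ 'n ^ 'n \<Rightarrow> complex ^ 'n ^ 'n) \<Rightarrow> (complex ^ 'n ^ 'n \<Rightarrow> complex ^ 'n ^ 'n) \<Rightarrow> bool" where
  "adapted_mqg N M \<alpha> \<beta> \<Gamma> \<nu> T\<^sub>L T\<^sub>R \<longleftrightarrow>
     nsf_weight N \<nu> \<and> hopf_bimodule N M \<alpha> \<beta> \<Gamma> \<nu>
   \<and> nsf_op_valued_weight M (\<alpha> ` N) T\<^sub>L \<and> left_invariant N M \<alpha> \<beta> \<Gamma> \<nu> T\<^sub>L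
   \<and> nsf_op_valued_weight M (\<beta> ` N) T\<^sub>R \<and> right_invariant N M \<alpha> \<beta> \<Gamma> \<nu> T\<^sub>R
   \<and> (\<forall>t. \<forall>n\<in>N. op_weight_modular_aut M (\<alpha> ` N) T\<^sub>L t (\<beta> n) = \<beta> (modular_aut N \<nu> (- t) n))
   \<and> (\<forall>t. \<forall>n\<in>N. op_weight_modular_aut M (\<beta> ` N) T\<^sub>R t (\<alpha> n) = \<alpha> (modular_aut N \<nu> t n))"

end

theory Submission
  imports Defs "HOL-Computational_Algebra.Fundamental_Theorem_Algebra"
begin

text \<open>
  Write \<open>P = \<Gamma>(1)\<close>, a projection. Coassociativity together with the antipode identity gives
  \<open>(id \<otimes> \<Gamma>)(P) = (1 \<otimes> P)(P \<otimes> 1) = (P \<otimes> 1)(1 \<otimes> P)\<close>, whence \<open>N = \<epsilon>\<^sub>t(M)\<close> consists of the \<open>n\<close> with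
  \<open>\<Gamma>(n) = P(n \<otimes> 1)\<close> and commutes with \<open>\<kappa>(N)\<close>. Moreover \<open>(1 \<otimes> n)P = (\<kappa>(n) \<otimes> 1)P\<close>; since \<open>\<kappa>\<^sup>2 = id\<close> on \<open>N\<close>,
  also \<open>P(1 \<otimes> n) = P(\<kappa>(n) \<otimes> 1)\<close>, and applying \<open>id \<otimes> h\<close> to both shows that \<open>h\<close> is a trace on \<open>N\<close> and that
  \<open>(\<omega> \<otimes> id)(P)\<close> represents the form \<open>\<omega> \<circ> \<kappa>\<close> with respect to \<open>h\<close>. So \<open>P\<close> is exactly the Gram operator of
  the relative tensor product, which thereby becomes the range of \<open>P\<close>; the two iterated products are
  governed in the same way by \<open>(\<Gamma> \<otimes> id)(P)\<close> and \<open>(id \<otimes> \<Gamma>)(P)\<close>. Invariance of the two Haar expectations is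
  coassociativity again, and \<open>\<kappa>(N)\<close>, \<open>N\<close> lie in the centralizers of the weights \<open>\<phi> \<circ> T\<^sub>L\<close>, \<open>\<phi> \<circ> T\<^sub>R\<close>, so that
  all modular automorphisms in question are trivial there.
\<close>

section \<open>Matrices and tensor products\<close>

text \<open>Almost every notion in the conclusion (\<open>tensor_lift\<close>, square roots, Gram
  operator, slices, modular powers) is a definite description, so each has to be shown uniquely
  solvable before it can be computed. The structure maps are moreover constrained on M only;
  complex-linear extensions to all matrices remove that restriction from the calculations. The
  relative tensor product is computed by exhibiting a projection with the Gram property: a
  projection is its own square root and its own range projection, so no spectral data of N are
  needed. That P itself is the right operator, without scalar or density, comes from (id \<otimes>
  h)(P) = 1. The condition \<kappa>^2 = id on N makes \<kappa> compatible with adjoints there, which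
  gives the shift of n across P from the other side. Elements of N are slices of P by the
  functionals \<epsilon>(\<cdot> y). This turns identities for P into identities for N and is the
  reason why h is tracial on N. On M no trace property is assumed. There the modular operator is
  diagonalized, and left multiplication by a centralizing element is seen to commute with
  it.\<close>

lemma matrix_add_rdistrib_complex: "((A::complex^'b^'a) + B) ** C = A ** C + B ** C"
  by (simp add: matrix_matrix_mult_def vec_eq_iff sum.distrib distrib_right)

lemma smat_nth [simp]: "(c \<cdot>\<^sub>C A) $ i $ j = c * A $ i $ j"
  by (simp add: smat_def)

lemma cadj_nth [simp]: "cadj A $ i $ j = cnj (A $ j $ i)"
  by (simp add: cadj_def)

lemma tensor_mat_nth [simp]: "(A \<otimes>\<^sub>m B) $ p $ q = A $ fst p $ fst q * B $ snd p $ snd q"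
  by (simp add: tensor_mat_def)

lemma tensor_vec_nth [simp]: "(\<xi> \<otimes>\<^sub>v \<eta>) $ p = \<xi> $ fst p * \<eta> $ snd p"
  by (simp add: tensor_vec_def)

lemma smat_mult_left [simp]: "(c \<cdot>\<^sub>C A) ** B = c \<cdot>\<^sub>C (A ** B)"
  by (simp add: vec_eq_iff matrix_matrix_mult_def sum_distrib_left mult.assoc)

lemma smat_mult_right [simp]: "A ** (c \<cdot>\<^sub>C B) = c \<cdot>\<^sub>C (A ** B)"
  by (simp add: vec_eq_iff matrix_matrix_mult_def sum_distrib_left mult.left_commute)

lemma smat_mult_vec: "(c \<cdot>\<^sub>C A) *v \<xi> = c *s (A *v \<xi>)"
  by (simp add: vec_eq_iff matrix_vector_mult_def sum_distrib_left mult.assoc)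

lemma smat_add_right: "c \<cdot>\<^sub>C (A + B) = c \<cdot>\<^sub>C A + c \<cdot>\<^sub>C B"
  by (simp add: vec_eq_iff distrib_left)

lemma smat_add_left: "(c + d) \<cdot>\<^sub>C A = c \<cdot>\<^sub>C A + d \<cdot>\<^sub>C A"
  by (simp add: vec_eq_iff distrib_right)

lemma smat_smat [simp]: "c \<cdot>\<^sub>C d \<cdot>\<^sub>C A = (c * d) \<cdot>\<^sub>C A"
  by (simp add: vec_eq_iff)

lemma smat_one [simp]: "1 \<cdot>\<^sub>C A = A"
  by (simp add: vec_eq_iff)

lemma smat_zero_left [simp]: "0 \<cdot>\<^sub>C A = 0"
  by (simp add: vec_eq_iff)

lemma smat_zero_right [simp]: "c \<cdot>\<^sub>C 0 = 0"
  by (simp add: vec_eq_iff)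

lemma smat_minus_one: "(- 1) \<cdot>\<^sub>C A = - A"
  by (simp add: vec_eq_iff)

lemma smat_of_real: "complex_of_real r \<cdot>\<^sub>C A = r *\<^sub>R A"
  by (simp add: vec_eq_iff scaleR_conv_of_real[where 'a = complex])

lemma smat_sum_right: "c \<cdot>\<^sub>C (\<Sum>i\<in>I. A i) = (\<Sum>i\<in>I. c \<cdot>\<^sub>C A i)"
  by (induction I rule: infinite_finite_induct) (simp_all add: smat_add_right)

lemma matrix_mult_zero_left [simp]: "0 ** (A::complex^'a^'b) = 0"
  by (simp add: vec_eq_iff matrix_matrix_mult_def)

lemma matrix_mult_zero_right [simp]: "(A::complex^'a^'b) ** 0 = 0"
  by (simp add: vec_eq_iff matrix_matrix_mult_def)

lemma matrix_mult_minus_right: "(A::complex^'a^'b) ** (B - C) = A ** B - A ** C"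
  by (simp add: vec_eq_iff matrix_matrix_mult_def sum_subtractf right_diff_distrib)

lemma matrix_mult_minus_left: "((B::complex^'a^'b) - C) ** A = B ** A - C ** A"
  by (simp add: vec_eq_iff matrix_matrix_mult_def sum_subtractf left_diff_distrib)

lemma matrix_mult_sum_left: "(\<Sum>i\<in>I. A i) ** (B::complex^'a^'b) = (\<Sum>i\<in>I. A i ** B)"
  by (induction I rule: infinite_finite_induct) (simp_all add: matrix_add_rdistrib_complex)

lemma matrix_mult_sum_right: "(B::complex^'a^'b) ** (\<Sum>i\<in>I. A i) = (\<Sum>i\<in>I. B ** A i)"
  by (induction I rule: infinite_finite_induct) (simp_all add: matrix_add_ldistrib)

lemma matrix_vec_zero_left [simp]: "0 *v (\<xi>::complex^'a) = 0"
  by (simp add: vec_eq_iff matrix_vector_mult_def)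

lemma matrix_vec_sum_left: "(\<Sum>i\<in>I. A i) *v (\<xi>::complex^'a) = (\<Sum>i\<in>I. A i *v \<xi>)"
  by (induction I rule: infinite_finite_induct) (simp_all add: matrix_vector_mult_add_rdistrib)

lemma matrix_vec_sum_right: "(A::complex^'a^'b) *v (\<Sum>i\<in>I. \<xi> i) = (\<Sum>i\<in>I. A *v \<xi> i)"
  by (induction I rule: infinite_finite_induct) (simp_all add: matrix_vector_right_distrib)

lemma matrix_vec_scale: "(A::complex^'a^'b) *v (c *s \<xi>) = c *s (A *v \<xi>)"
  by (simp add: vec_eq_iff matrix_vector_mult_def sum_distrib_left mult.left_commute)

lemma cadj_add [simp]: "cadj (A + B) = cadj A + cadj B"
  by (simp add: vec_eq_iff)

lemma cadj_diff [simp]: "cadj (A - B) = cadj A - cadj B"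
  by (simp add: vec_eq_iff)

lemma cadj_zero [simp]: "cadj 0 = 0"
  by (simp add: vec_eq_iff)

lemma cadj_smat [simp]: "cadj (c \<cdot>\<^sub>C A) = cnj c \<cdot>\<^sub>C cadj A"
  by (simp add: vec_eq_iff)

lemma cadj_mult [simp]: "cadj (A ** B) = cadj B ** cadj A"
  by (simp add: vec_eq_iff matrix_matrix_mult_def mult.commute)

lemma cadj_cadj [simp]: "cadj (cadj A) = A"
  by (simp add: vec_eq_iff)

lemma cadj_one [simp]: "cadj (mat 1) = mat 1"
  by (simp add: vec_eq_iff mat_def)

lemma cadj_sum: "cadj (\<Sum>i\<in>I. A i) = (\<Sum>i\<in>I. cadj (A i))"
  by (induction I rule: infinite_finite_induct) simp_all

lemma tensor_add_left: "(A + B) \<otimes>\<^sub>m C = A \<otimes>\<^sub>m C + B \<otimes>\<^sub>m C"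
  by (simp add: vec_eq_iff distrib_right)

lemma tensor_add_right: "C \<otimes>\<^sub>m (A + B) = C \<otimes>\<^sub>m A + C \<otimes>\<^sub>m B"
  by (simp add: vec_eq_iff distrib_left)

lemma tensor_smat_left [simp]: "(c \<cdot>\<^sub>C A) \<otimes>\<^sub>m B = c \<cdot>\<^sub>C (A \<otimes>\<^sub>m B)"
  by (simp add: vec_eq_iff)

lemma tensor_smat_right [simp]: "A \<otimes>\<^sub>m (c \<cdot>\<^sub>C B) = c \<cdot>\<^sub>C (A \<otimes>\<^sub>m B)"
  by (simp add: vec_eq_iff)

lemma tensor_zero [simp]: "0 \<otimes>\<^sub>m A = 0" "A \<otimes>\<^sub>m 0 = 0"
  by (simp_all add: vec_eq_iff)

lemma tensor_sum_left: "(\<Sum>i\<in>I. A i) \<otimes>\<^sub>m B = (\<Sum>i\<in>I. A i \<otimes>\<^sub>m B)"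
  by (induction I rule: infinite_finite_induct) (simp_all add: tensor_add_left)

lemma tensor_sum_right: "B \<otimes>\<^sub>m (\<Sum>i\<in>I. A i) = (\<Sum>i\<in>I. B \<otimes>\<^sub>m A i)"
  by (induction I rule: infinite_finite_induct) (simp_all add: tensor_add_right)

lemma sum_UNIV_prod: "(\<Sum>p\<in>UNIV. f p) = (\<Sum>i\<in>UNIV. \<Sum>j\<in>UNIV. f (i, j))"
  unfolding UNIV_Times_UNIV[symmetric] sum.cartesian_product by simp

lemma tensor_mult [simp]: "(A \<otimes>\<^sub>m B) ** (C \<otimes>\<^sub>m D) = (A ** C) \<otimes>\<^sub>m (B ** D)"
  by (simp add: vec_eq_iff matrix_matrix_mult_def sum_UNIV_prod sum_product mult_ac)

lemma cadj_tensor [simp]: "cadj (A \<otimes>\<^sub>m B) = cadj A \<otimes>\<^sub>m cadj B"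
  by (simp add: vec_eq_iff)

lemma tensor_one [simp]: "mat 1 \<otimes>\<^sub>m mat 1 = mat 1"
  by (auto simp: vec_eq_iff mat_def)

lemma tensor_mult_vec [simp]: "(A \<otimes>\<^sub>m B) *v (\<xi> \<otimes>\<^sub>v \<eta>) = (A *v \<xi>) \<otimes>\<^sub>v (B *v \<eta>)"
  by (simp add: vec_eq_iff matrix_vector_mult_def sum_UNIV_prod sum_product mult_ac)

lemma tensor_vec_add_left: "(\<xi> + \<xi>') \<otimes>\<^sub>v \<eta> = \<xi> \<otimes>\<^sub>v \<eta> + \<xi>' \<otimes>\<^sub>v \<eta>"
  by (simp add: vec_eq_iff distrib_right)

lemma tensor_vec_add_right: "\<xi> \<otimes>\<^sub>v (\<eta> + \<eta>') = \<xi> \<otimes>\<^sub>v \<eta> + \<xi> \<otimes>\<^sub>v \<eta>'"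
  by (simp add: vec_eq_iff distrib_left)

lemma tensor_vec_scale_left: "(c *s \<xi>) \<otimes>\<^sub>v \<eta> = c *s (\<xi> \<otimes>\<^sub>v \<eta>)"
  by (simp add: vec_eq_iff)

lemma tensor_vec_scale_right: "\<xi> \<otimes>\<^sub>v (c *s \<eta>) = c *s (\<xi> \<otimes>\<^sub>v \<eta>)"
  by (simp add: vec_eq_iff mult_ac)

lemma cinner_add_left: "cinner (\<xi> + \<xi>') \<eta> = cinner \<xi> \<eta> + cinner \<xi>' \<eta>"
  by (simp add: cinner_def distrib_right sum.distrib)

lemma cinner_add_right: "cinner \<xi> (\<eta> + \<eta>') = cinner \<xi> \<eta> + cinner \<xi> \<eta>'"
  by (simp add: cinner_def distrib_left sum.distrib)

lemma cinner_diff_left: "cinner (\<xi> - \<xi>') \<eta> = cinner \<xi> \<eta> - cinner \<xi>' \<eta>"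
  by (simp add: cinner_def left_diff_distrib sum_subtractf)

lemma cinner_scale_left [simp]: "cinner (c *s \<xi>) \<eta> = c * cinner \<xi> \<eta>"
  by (simp add: cinner_def sum_distrib_left mult_ac)

lemma cinner_scale_right [simp]: "cinner \<xi> (c *s \<eta>) = cnj c * cinner \<xi> \<eta>"
  by (simp add: cinner_def sum_distrib_left mult_ac)

lemma cinner_zero [simp]: "cinner 0 \<eta> = 0" "cinner \<xi> 0 = 0"
  by (simp_all add: cinner_def)

lemma cinner_sum_left: "cinner (\<Sum>i\<in>I. \<xi> i) \<eta> = (\<Sum>i\<in>I. cinner (\<xi> i) \<eta>)"
  by (induction I rule: infinite_finite_induct) (simp_all add: cinner_add_left)

lemma cnj_cinner: "cnj (cinner \<xi> \<eta>) = cinner \<eta> \<xi>"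
  by (simp add: cinner_def mult.commute)

lemma cinner_self: "cinner \<xi> \<xi> = complex_of_real ((norm \<xi>)\<^sup>2)"
proof -
  have "(norm \<xi>)\<^sup>2 = (\<Sum>i\<in>UNIV. (cmod (\<xi> $ i))\<^sup>2)"
    by (simp add: norm_vec_def L2_set_def sum_nonneg)
  then show ?thesis
    by (simp add: cinner_def complex_norm_square [symmetric] del: of_real_power)
qed

lemma cinner_adj: "cinner (A *v \<xi>) \<eta> = cinner \<xi> (cadj A *v \<eta>)"
  unfolding cinner_def matrix_vector_mult_def
  by (simp add: sum_distrib_left sum_distrib_right mult_ac) (rule sum.swap)

lemma cinner_adj': "cinner \<xi> (A *v \<eta>) = cinner (cadj A *v \<xi>) \<eta>"
  by (simp add: cinner_adj)

lemma cinner_axis: "cinner \<xi> (axis i 1) = \<xi> $ i"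
proof -
  have "cinner \<xi> (axis i 1) = (\<Sum>j\<in>UNIV. if j = i then \<xi> $ j else 0)"
    unfolding cinner_def by (rule sum.cong) (auto simp: axis_def)
  then show ?thesis by simp
qed

lemma cinner_eqI: "(\<And>\<eta>. cinner \<xi> \<eta> = cinner \<xi>' \<eta>) \<Longrightarrow> \<xi> = \<xi>'"
  by (metis cinner_axis vec_eq_iff)

lemma matrix_cinner_eqI:
  assumes "\<And>\<xi> \<eta>. cinner (A *v \<xi>) \<eta> = cinner (B *v \<xi>) \<eta>"
  shows "A = B"
proof -
  have "A *v \<xi> = B *v \<xi>" for \<xi>
    by (rule cinner_eqI) (rule assms)
  then show ?thesis by (simp add: matrix_eq)
qed

lemma axis_pair: "axis (i, j) (1::complex) = axis i 1 \<otimes>\<^sub>v axis j 1"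
  by (auto simp: vec_eq_iff axis_def)

lemma matrix_axis_nth: "cinner (A *v axis j 1) (axis i 1) = A $ i $ j"
  unfolding cinner_axis by (simp add: matrix_vector_mult_def axis_def if_distrib cong: if_cong)

lemma matrix_tensor_eqI:
  fixes A B :: "complex ^ ('a::finite \<times> 'b::finite) ^ 'c"
  assumes "\<And>\<xi> \<eta>. A *v (\<xi> \<otimes>\<^sub>v \<eta>) = B *v (\<xi> \<otimes>\<^sub>v \<eta>)"
  shows "A = B"
proof -
  have "A $ p $ (i, j) = B $ p $ (i, j)" for p i j
    using assms[of "axis i 1" "axis j 1"] by (metis matrix_axis_nth axis_pair)
  then show ?thesis by (simp add: vec_eq_iff)
qed

lemma matrix_tensor_cinner_eqI:
  assumes "\<And>\<xi> \<eta> \<xi>' \<eta>'. cinner (A *v (\<xi> \<otimes>\<^sub>v \<eta>)) (\<xi>' \<otimes>\<^sub>v \<eta>') = cinner (B *v (\<xi> \<otimes>\<^sub>v \<eta>)) (\<xi>' \<otimes>\<^sub>v \<eta>')"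
  shows "A = B"
proof -
  have "A $ (k, l) $ (i, j) = B $ (k, l) $ (i, j)" for k l i j
    using assms[of "axis i 1" "axis j 1" "axis k 1" "axis l 1"] by (metis matrix_axis_nth axis_pair)
  then show ?thesis by (simp add: vec_eq_iff)
qed

text \<open>Complex scalars are essential: the diagonal at x + y kills the symmetric part of f, and
  the diagonal at ix + y the antisymmetric part.\<close>

lemma sesquilinear_polarization:
  fixes f :: "complex ^ 'a \<Rightarrow> complex ^ 'a \<Rightarrow> complex"
  assumes add1: "\<And>x y z. f (x + y) z = f x z + f y z" and add2: "\<And>x y z. f x (y + z) = f x y + f x z"
    and sc1: "\<And>c x y. f (c *s x) y = c * f x y" and sc2: "\<And>c x y. f x (c *s y) = cnj c * f x y"
    and diag: "\<And>x. f x x = 0"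
  shows "f x y = 0"
proof -
  have 1: "f x y + f y x = 0"
    using diag[of "x + y"] diag[of x] diag[of y] by (simp add: add1 add2 add.commute)
  have "f (\<i> *s x) y + f y (\<i> *s x) = 0"
    using diag[of "\<i> *s x + y"] diag[of "\<i> *s x"] diag[of y] by (simp add: add1 add2 add.commute)
  then have "\<i> * (f x y - f y x) = 0" by (simp add: sc1 sc2 algebra_simps)
  then have "f x y = f y x" by simp
  with 1 show ?thesis by simp
qed

text \<open>Polarization is applied twice, in \<xi> with \<eta> held fixed and then in \<eta>.
  Uniqueness of operators that are described by slices or by quadratic forms rests on this.\<close>

lemma matrix_tensor_diag_eqI:
  assumes "\<And>\<xi> \<eta>. cinner (A *v (\<xi> \<otimes>\<^sub>v \<eta>)) (\<xi> \<otimes>\<^sub>v \<eta>) = cinner (B *v (\<xi> \<otimes>\<^sub>v \<eta>)) (\<xi> \<otimes>\<^sub>v \<eta>)"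
  shows "A = B"
proof (rule matrix_tensor_cinner_eqI)
  fix \<xi> \<xi>' :: "complex^'a" and \<eta> \<eta>' :: "complex^'b"
  let ?f = "\<lambda>\<xi> \<eta> \<xi>' \<eta>'. cinner (A *v (\<xi> \<otimes>\<^sub>v \<eta>)) (\<xi>' \<otimes>\<^sub>v \<eta>') - cinner (B *v (\<xi> \<otimes>\<^sub>v \<eta>)) (\<xi>' \<otimes>\<^sub>v \<eta>')"
  note bl = tensor_vec_add_left tensor_vec_add_right matrix_vector_right_distrib cinner_add_left
    cinner_add_right tensor_vec_scale_left tensor_vec_scale_right matrix_vec_scale algebra_simps
  have 1: "?f \<xi> \<eta> \<xi>' \<eta> = 0" for \<xi> \<xi>' \<eta>
    by (rule sesquilinear_polarization[of "\<lambda>\<xi> \<xi>'. ?f \<xi> \<eta> \<xi>' \<eta>"]) (simp_all add: bl assms)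
  have "?f \<xi> \<eta> \<xi>' \<eta>' = 0"
    by (rule sesquilinear_polarization[of "\<lambda>\<eta> \<eta>'. ?f \<xi> \<eta> \<xi>' \<eta>'"]) (simp_all add: bl 1[simplified])
  then show "cinner (A *v (\<xi> \<otimes>\<^sub>v \<eta>)) (\<xi>' \<otimes>\<^sub>v \<eta>') = cinner (B *v (\<xi> \<otimes>\<^sub>v \<eta>)) (\<xi>' \<otimes>\<^sub>v \<eta>')"
    by simp
qed

lemma matrix_diag_eqI:
  assumes "\<And>\<xi>. cinner (A *v \<xi>) \<xi> = cinner (B *v \<xi>) \<xi>"
  shows "A = B"
proof (rule matrix_cinner_eqI)
  fix \<xi> \<eta>
  have "cinner (A *v \<xi>) \<eta> - cinner (B *v \<xi>) \<eta> = 0"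
    by (rule sesquilinear_polarization[of "\<lambda>\<xi> \<eta>. cinner (A *v \<xi>) \<eta> - cinner (B *v \<xi>) \<eta>"])
      (simp_all add: matrix_vector_right_distrib cinner_add_left cinner_add_right matrix_vec_scale algebra_simps assms)
  then show "cinner (A *v \<xi>) \<eta> = cinner (B *v \<xi>) \<eta>" by simp
qed

lemma psd_hermitian:
  assumes "psd A" shows "cadj A = A"
proof (rule matrix_diag_eqI)
  fix \<xi>
  have "cinner (A *v \<xi>) \<xi> \<in> \<real>\<^sub>\<ge>\<^sub>0" using assms by (simp add: psd_def)
  then have "cnj (cinner (A *v \<xi>) \<xi>) = cinner (A *v \<xi>) \<xi>"
    by (metis Reals_cnj_iff nonneg_Reals_subset_Reals subsetD)
  then show "cinner (cadj A *v \<xi>) \<xi> = cinner (A *v \<xi>) \<xi>"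
    by (simp add: cnj_cinner cinner_adj)
qed

lemma cinner_self_nonneg: "cinner \<xi> \<xi> \<in> \<real>\<^sub>\<ge>\<^sub>0"
  by (simp add: cinner_self)

lemma psd_adj_mult_self: "psd (cadj A ** A)"
  unfolding psd_def
  by (metis cadj_cadj cinner_adj cinner_self_nonneg matrix_vector_mul_assoc)

lemma psd_conj: "psd A \<Longrightarrow> psd (cadj B ** A ** B)"
  unfolding psd_def
  by (metis cadj_cadj cinner_adj matrix_vector_mul_assoc)

section \<open>Diagonalization of self-adjoint operators\<close>

text \<open>Serves both for matrices acting on vectors and for the modular operator on an algebra
  with its GNS form. In the second case the form and the operator are controlled only on the
  algebra, and complex scalars act through \<open>smat\<close> on a type that is merely a real
  vector space; hence the carrier V and the explicit scalar action.\<close>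

locale self_adjoint_op =
  fixes V :: "'v::euclidean_space set"
    and scl :: "complex \<Rightarrow> 'v \<Rightarrow> 'v"  (infixr "\<star>" 75)
    and ip :: "'v \<Rightarrow> 'v \<Rightarrow> complex"
    and T :: "'v \<Rightarrow> 'v"
  assumes zero_V: "0 \<in> V"
    and add_V: "\<And>x y. x \<in> V \<Longrightarrow> y \<in> V \<Longrightarrow> x + y \<in> V"
    and scl_V: "\<And>c x. x \<in> V \<Longrightarrow> c \<star> x \<in> V"
    and scl_of_real: "\<And>r x. complex_of_real r \<star> x = r *\<^sub>R x"
    and scl_add_left: "\<And>c d x. (c + d) \<star> x = c \<star> x + d \<star> x"
    and scl_add_right: "\<And>c x y. c \<star> (x + y) = c \<star> x + c \<star> y"
    and scl_scl: "\<And>c d x. c \<star> d \<star> x = (c * d) \<star> x"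
    and ip_add: "\<And>x y z. x \<in> V \<Longrightarrow> y \<in> V \<Longrightarrow> z \<in> V \<Longrightarrow> ip (x + y) z = ip x z + ip y z"
    and ip_scl: "\<And>c x y. x \<in> V \<Longrightarrow> y \<in> V \<Longrightarrow> ip (c \<star> x) y = c * ip x y"
    and ip_cnj: "\<And>x y. x \<in> V \<Longrightarrow> y \<in> V \<Longrightarrow> cnj (ip x y) = ip y x"
    and ip_definite: "\<And>x. x \<in> V \<Longrightarrow> ip x x = 0 \<Longrightarrow> x = 0"
    and T_V: "\<And>x. x \<in> V \<Longrightarrow> T x \<in> V"
    and T_add: "\<And>x y. x \<in> V \<Longrightarrow> y \<in> V \<Longrightarrow> T (x + y) = T x + T y"
    and T_scl: "\<And>c x. x \<in> V \<Longrightarrow> T (c \<star> x) = c \<star> T x"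
    and T_sa: "\<And>x y. x \<in> V \<Longrightarrow> y \<in> V \<Longrightarrow> ip (T x) y = ip x (T y)"
begin

lemma scl_0 [simp]: "0 \<star> x = 0"
  using scl_of_real[of 0 x] by simp

lemma scl_1 [simp]: "1 \<star> x = x"
  using scl_of_real[of 1 x] by simp

lemma scl_zero [simp]: "c \<star> 0 = 0"
  using scl_scl[of c 0 0] by simp

lemma scl_minus_1: "(- 1) \<star> x = - x"
  using scl_of_real[of "-1" x] by simp

lemma scl_minus: "(- c) \<star> x = - (c \<star> x)"
  using scl_scl[of "-1" c x] by (simp add: scl_minus_1)

lemma scl_minus_right: "c \<star> (- x) = - (c \<star> x)"
  using scl_scl[of c "-1" x] by (simp add: scl_minus_1 scl_minus)

lemma scl_diff_right: "c \<star> (x - y) = c \<star> x - c \<star> y"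
  using scl_add_right[of c x "- y"] by (simp add: scl_minus_right)

lemma scl_diff_left: "(c - d) \<star> x = c \<star> x - d \<star> x"
  using scl_add_left[of c "- d" x] by (simp add: scl_minus)

lemma minus_V: "x \<in> V \<Longrightarrow> - x \<in> V"
  using scl_V[of x "- 1"] by (simp add: scl_minus_1)

lemma diff_V: "x \<in> V \<Longrightarrow> y \<in> V \<Longrightarrow> x - y \<in> V"
  using add_V[of x "- y"] by (simp add: minus_V)

lemma sum_V: "(\<And>i. i \<in> I \<Longrightarrow> f i \<in> V) \<Longrightarrow> (\<Sum>i\<in>I. f i) \<in> V"
  by (induction I rule: infinite_finite_induct) (auto simp: zero_V add_V)

lemma T_0 [simp]: "T 0 = 0"
  using T_scl[OF zero_V, of 0] by simp

lemma T_diff: "x \<in> V \<Longrightarrow> y \<in> V \<Longrightarrow> T (x - y) = T x - T y"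
  using T_add[of x "- y"] T_scl[of y "- 1"] by (simp add: minus_V scl_minus_1)

lemma ip_zero_left [simp]: "x \<in> V \<Longrightarrow> ip 0 x = 0"
  using ip_scl[OF zero_V, of x 0] by simp

lemma ip_diff: "x \<in> V \<Longrightarrow> y \<in> V \<Longrightarrow> z \<in> V \<Longrightarrow> ip (x - y) z = ip x z - ip y z"
  using ip_add[of x "- y" z] ip_scl[of y z "- 1"] by (simp add: minus_V scl_minus_1)

lemma ip_sum_left: "(\<And>i. i \<in> I \<Longrightarrow> f i \<in> V) \<Longrightarrow> x \<in> V \<Longrightarrow> ip (\<Sum>i\<in>I. f i) x = (\<Sum>i\<in>I. ip (f i) x)"
  by (induction I rule: infinite_finite_induct) (auto simp: ip_add sum_V)

lemma ip_scl_right: "x \<in> V \<Longrightarrow> y \<in> V \<Longrightarrow> ip x (c \<star> y) = cnj c * ip x y"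
  by (metis complex_cnj_cnj complex_cnj_mult ip_cnj ip_scl scl_V)

lemma ip_add_right: "x \<in> V \<Longrightarrow> y \<in> V \<Longrightarrow> z \<in> V \<Longrightarrow> ip x (y + z) = ip x y + ip x z"
  using ip_cnj[of "y + z" x] ip_add[of y z x] by (simp add: add_V ip_cnj)

lemma ip_zero_right [simp]: "x \<in> V \<Longrightarrow> ip x 0 = 0"
  using ip_scl_right[OF _ zero_V, of x 0] by simp

lemma ip_sum_right: "(\<And>i. i \<in> I \<Longrightarrow> f i \<in> V) \<Longrightarrow> x \<in> V \<Longrightarrow> ip x (\<Sum>i\<in>I. f i) = (\<Sum>i\<in>I. ip x (f i))"
  using ip_cnj[of "\<Sum>i\<in>I. f i" x] ip_sum_left[of I f x] by (simp add: sum_V ip_cnj)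

definition papp :: "complex poly \<Rightarrow> 'v \<Rightarrow> 'v" where
  "papp p a = (\<Sum>i\<le>degree p. coeff p i \<star> (T ^^ i) a)"

lemma papp_bound: "degree p \<le> n \<Longrightarrow> papp p a = (\<Sum>i\<le>n. coeff p i \<star> (T ^^ i) a)"
  unfolding papp_def by (rule sum.mono_neutral_left) (auto simp: coeff_eq_0)

lemma Tpow_V: "a \<in> V \<Longrightarrow> (T ^^ i) a \<in> V"
  by (induction i) (auto simp: T_V)

lemma Tpow_lin:
  "a \<in> V \<Longrightarrow> b \<in> V \<Longrightarrow> (T ^^ i) (a - c \<star> b) = (T ^^ i) a - c \<star> (T ^^ i) b"
  by (induction i) (auto simp: T_diff T_scl scl_V Tpow_V)

lemma papp_linear_factor:
  assumes "a \<in> V"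
  shows "papp ([:- c, 1:] * q) a = papp q (T a - c \<star> a)"
proof -
  have "[:- c, 1:] * q = pCons 0 q - smult c q" by simp
  moreover have d: "degree (pCons 0 q - smult c q) \<le> Suc (degree q)"
    by (intro degree_diff_le) (auto intro: order_trans[OF degree_smult_le] degree_pCons_le)
  ultimately have "papp ([:- c, 1:] * q) a
      = (\<Sum>i\<le>Suc (degree q). (coeff (pCons 0 q) i - c * coeff q i) \<star> (T ^^ i) a)"
    by (simp add: papp_bound)
  also have "\<dots> = (\<Sum>i\<le>Suc (degree q). coeff (pCons 0 q) i \<star> (T ^^ i) a)
      - (\<Sum>i\<le>Suc (degree q). (c * coeff q i) \<star> (T ^^ i) a)"
    by (simp only: sum_subtractf scl_diff_left)
  also have "(\<Sum>i\<le>Suc (degree q). coeff (pCons 0 q) i \<star> (T ^^ i) a)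
      = (\<Sum>i\<le>degree q. coeff q i \<star> (T ^^ i) (T a))"
    by (subst sum.atMost_Suc_shift) (simp add: funpow_swap1)
  also have "(\<Sum>i\<le>Suc (degree q). (c * coeff q i) \<star> (T ^^ i) a)
      = (\<Sum>i\<le>degree q. coeff q i \<star> c \<star> (T ^^ i) a)"
    by (simp add: coeff_eq_0 scl_scl mult.commute)
  also have "(\<Sum>i\<le>degree q. coeff q i \<star> (T ^^ i) (T a)) - (\<Sum>i\<le>degree q. coeff q i \<star> c \<star> (T ^^ i) a)
      = papp q (T a - c \<star> a)"
    using assms by (simp add: papp_def Tpow_lin T_V sum_subtractf scl_diff_right)
  finally show ?thesis .
qed

text \<open>The \<open>DIM('v) + 1\<close> vectors T^i a with i \<le> \<open>DIM('v)\<close> are too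
  many to be independent over the reals. Dependence speaks of sets, so a coincidence T^i a = T^j a
  is treated separately and gives the relation with coefficients 1 and -1.\<close>

lemma annihilating_poly:
  assumes a: "a \<in> V"
  shows "\<exists>p. p \<noteq> 0 \<and> papp p a = 0"
proof -
  define f where "f i = (T ^^ i) a" for i
  let ?D = "DIM('v)"
  have "\<exists>u :: nat \<Rightarrow> real. (\<exists>i\<le>?D. u i \<noteq> 0) \<and> (\<Sum>i\<le>?D. u i *\<^sub>R f i) = 0"
  proof (cases "inj_on f {..?D}")
    case False
    then obtain i j where ij: "i \<le> ?D" "j \<le> ?D" "i \<noteq> j" "f i = f j"
      by (auto simp: inj_on_def)
    define u :: "nat \<Rightarrow> real" where "u k = (if k = i then 1 else 0) - (if k = j then 1 else 0)" for k
    have "u k *\<^sub>R f k = (if k = i then f k else 0) - (if k = j then f k else 0)" for k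
      by (simp add: u_def)
    then have "(\<Sum>k\<le>?D. u k *\<^sub>R f k) = f i - f j"
      using ij by (simp add: sum_subtractf)
    moreover have "u i \<noteq> 0" using ij by (simp add: u_def)
    ultimately show ?thesis using ij by auto
  next
    case True
    then have "card (f ` {..?D}) = Suc ?D" by (simp add: card_image)
    then have "dependent (f ` {..?D})" by (intro dependent_biggerset) auto
    then obtain u where u: "\<exists>v\<in>f ` {..?D}. u v \<noteq> 0" "(\<Sum>v\<in>f ` {..?D}. u v *\<^sub>R v) = 0"
      using dependent_finite[of "f ` {..?D}"] by auto
    then have "(\<Sum>i\<le>?D. u (f i) *\<^sub>R f i) = 0"
      by (simp add: sum.reindex[OF True])
    with u(1) show ?thesis by (intro exI[of _ "u \<circ> f"]) auto
  qed
  then obtain u :: "nat \<Rightarrow> real" and i where u: "i \<le> ?D" "u i \<noteq> 0" "(\<Sum>i\<le>?D. u i *\<^sub>R f i) = 0"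
    by blast
  define p where "p = (\<Sum>i\<le>?D. monom (complex_of_real (u i)) i)"
  have c: "coeff p k = (if k \<le> ?D then complex_of_real (u k) else 0)" for k
    by (simp add: p_def coeff_sum)
  have "degree p \<le> ?D" by (rule degree_le) (simp add: c)
  then have "papp p a = 0"
    using u(3) by (simp add: papp_bound c scl_of_real f_def)
  moreover have "p \<noteq> 0" using c[of i] u by auto
  ultimately show ?thesis by blast
qed

inductive_set eig_sums :: "'v set" where
  zero: "0 \<in> eig_sums"
| add: "v \<in> V \<Longrightarrow> T v = complex_of_real r \<star> v \<Longrightarrow> a \<in> eig_sums \<Longrightarrow> v + a \<in> eig_sums"

lemma eig_sums_V: "a \<in> eig_sums \<Longrightarrow> a \<in> V"
  by (induction rule: eig_sums.induct) (auto simp: zero_V add_V)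

text \<open>On an eigenvector with eigenvalue r \<noteq> \<mu> the operator T - \<mu> is inverted by
  the factor 1 / (r - \<mu>); the summands with r = \<mu> are collected in w. As all r are real, a
  nonreal \<mu> leaves no remainder, which the last disjunct records.\<close>

lemma eig_sums_resolvent:
  assumes "b \<in> eig_sums"
  shows "\<exists>c\<in>eig_sums. \<exists>w\<in>V. b = T c - \<mu> \<star> c + w \<and> T w = \<mu> \<star> w \<and> (w = 0 \<or> \<mu> \<in> \<real>)"
  using assms
proof (induction rule: eig_sums.induct)
  case zero
  show ?case by (intro bexI[of _ 0]) (auto intro: eig_sums.zero zero_V)
next
  case (add v r a)
  then obtain c w where cw: "c \<in> eig_sums" "w \<in> V" "a = T c - \<mu> \<star> c + w" "T w = \<mu> \<star> w" "w = 0 \<or> \<mu> \<in> \<real>"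
    by blast
  show ?case
  proof (cases "\<mu> = complex_of_real r")
    case True
    then show ?thesis using cw add.hyps
      by (intro bexI[of _ c] bexI[of _ "v + w"]) (auto simp: T_add scl_add_right add_V)
  next
    case False
    define u where "u = (1 / (complex_of_real r - \<mu>)) \<star> v"
    have u: "u \<in> V" "T u = complex_of_real r \<star> u"
      using add.hyps by (auto simp: u_def T_scl scl_V scl_scl mult.commute)
    have "T u - \<mu> \<star> u = (complex_of_real r - \<mu>) \<star> u"
      using scl_add_left[of "complex_of_real r" "- \<mu>" u] by (simp add: u scl_minus)
    also have "\<dots> = v" using False by (simp add: u_def scl_scl)
    finally have "T (u + c) - \<mu> \<star> (u + c) = v + (T c - \<mu> \<star> c)"
      using u(1) cw(1) by (simp add: T_add eig_sums_V scl_add_right algebra_simps)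
    then have "v + a = T (u + c) - \<mu> \<star> (u + c) + w" using cw(3) by simp
    with cw eig_sums.add[OF u cw(1)] show ?thesis by blast
  qed
qed

text \<open>There are no Jordan blocks: after subtracting c, the vector w = (T - \<mu>) d lies in
  the kernel of T - \<mu>, and for real \<mu> self-adjointness gives ip w w = ip d ((T - \<mu>) w) =
  0. So T d = \<mu> d, and \<mu> is real unless d = 0.\<close>

lemma eig_sums_step:
  assumes a: "a \<in> V" and b: "T a - \<mu> \<star> a \<in> eig_sums"
  shows "a \<in> eig_sums"
proof -
  obtain c w where cw: "c \<in> eig_sums" "w \<in> V" "T a - \<mu> \<star> a = T c - \<mu> \<star> c + w"
    "T w = \<mu> \<star> w" "w = 0 \<or> \<mu> \<in> \<real>"
    using eig_sums_resolvent[OF b] by blast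
  define d where "d = a - c"
  have d: "d \<in> V" using a cw eig_sums_V by (simp add: d_def diff_V)
  have w: "w = T d - \<mu> \<star> d"
    using cw a eig_sums_V by (simp add: d_def T_diff scl_diff_right algebra_simps)
  have "w = 0"
  proof (cases "\<mu> \<in> \<real>")
    case True
    have "ip w w = ip (T d) w - \<mu> * ip d w"
      using d cw(2) by (subst w) (simp add: ip_diff T_V scl_V ip_scl)
    also have "ip (T d) w = ip d (\<mu> \<star> w)" using d cw by (simp add: T_sa)
    also have "\<dots> = \<mu> * ip d w" using d cw True by (simp add: ip_scl_right Reals_cnj_iff)
    finally show ?thesis using ip_definite[OF cw(2)] by simp
  qed (use cw in auto)
  then have Td: "T d = \<mu> \<star> d" using w by simp
  show ?thesis
  proof (cases "d = 0")
    case True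
    then show ?thesis using cw by (simp add: d_def)
  next
    case False
    have "\<mu> * ip d d = cnj \<mu> * ip d d"
      using T_sa[OF d d] d by (simp add: Td ip_scl ip_scl_right)
    then have "cnj \<mu> = \<mu>" using False ip_definite[OF d] by auto
    then obtain r where "\<mu> = complex_of_real r" by (metis Reals_cases Reals_cnj_iff)
    then have "d + c \<in> eig_sums" using eig_sums.add[OF d _ cw(1)] Td by blast
    then show ?thesis by (simp add: d_def)
  qed
qed

text \<open>Induction on the degree of the annihilating polynomial: a root \<mu> exists by the
  fundamental theorem of algebra, and the cofactor annihilates (T - \<mu>) a. The vector therefore
  has to vary in the induction.\<close>

lemma eig_sums_of_papp: "a \<in> V \<Longrightarrow> p \<noteq> 0 \<Longrightarrow> papp p a = 0 \<Longrightarrow> a \<in> eig_sums"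
proof (induction "degree p" arbitrary: p a)
  case 0
  then obtain c where "p = [:c:]" by (metis degree_eq_zeroE)
  with 0 have c: "c \<noteq> 0" "c \<star> a = 0" by (auto simp: papp_def)
  have "a = (1 / c) \<star> c \<star> a" using c(1) by (simp add: scl_scl del: scl_zero)
  then show ?case using c eig_sums.zero by simp
next
  case (Suc n)
  have "\<not> constant (poly p)"
    using Suc.hyps(2) by (simp add: constant_degree)
  then obtain \<mu> where "poly p \<mu> = 0" using fundamental_theorem_of_algebra by blast
  then obtain q where q: "p = [:- \<mu>, 1:] * q" by (auto simp: poly_eq_0_iff_dvd)
  with Suc.prems have "q \<noteq> 0" by auto
  then have "degree p = Suc (degree q)" unfolding q by (subst degree_mult_eq) auto
  then have "n = degree q" using Suc.hyps(2) by simp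
  moreover have "papp q (T a - \<mu> \<star> a) = 0"
    using Suc.prems papp_linear_factor[of a \<mu> q] q by simp
  ultimately have "T a - \<mu> \<star> a \<in> eig_sums"
    using Suc.hyps(1)[of q "T a - \<mu> \<star> a"] \<open>q \<noteq> 0\<close> Suc.prems by (simp add: T_V scl_V diff_V)
  then show ?case using eig_sums_step Suc.prems by blast
qed

lemma eig_sums_all: "a \<in> V \<Longrightarrow> a \<in> eig_sums"
  using annihilating_poly eig_sums_of_papp by blast

definition eigen_dec :: "nat \<Rightarrow> (nat \<Rightarrow> real) \<Rightarrow> (nat \<Rightarrow> 'v) \<Rightarrow> bool" where
  "eigen_dec k r v \<longleftrightarrow> (\<forall>i<k. v i \<in> V \<and> T (v i) = complex_of_real (r i) \<star> v i)"

text \<open>Q is any property that nonzero eigenvectors force on their eigenvalues, such as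
  positivity. The zero vector satisfies the eigenvalue equation for every r, so zero summands are
  discarded to keep Q valid.\<close>

lemma eigen_decomposition:
  assumes "a \<in> V" and pos: "\<And>r v. v \<in> V \<Longrightarrow> v \<noteq> 0 \<Longrightarrow> T v = complex_of_real r \<star> v \<Longrightarrow> Q r"
  shows "\<exists>k r v. eigen_dec k r v \<and> (\<forall>i<k. Q (r i)) \<and> a = (\<Sum>i<k. v i)"
  using eig_sums_all[OF assms(1)]
proof (induction rule: eig_sums.induct)
  case zero
  show ?case by (intro exI[of _ 0]) (simp add: eigen_dec_def)
next
  case (add v s a)
  then obtain k r u where IH: "eigen_dec k r u" "\<forall>i<k. Q (r i)" "a = (\<Sum>i<k. u i)" by blast
  show ?case
  proof (cases "v = 0")
    case True
    then show ?thesis using IH by auto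
  next
    case False
    with add.hyps have "Q s" using pos by blast
    then have "eigen_dec (Suc k) (r(k := s)) (u(k := v)) \<and> (\<forall>i<Suc k. Q ((r(k := s)) i))
        \<and> v + a = (\<Sum>i<Suc k. (u(k := v)) i)"
      using IH add.hyps by (auto simp: eigen_dec_def less_Suc_eq add.commute)
    then show ?thesis by blast
  qed
qed

lemma eigen_orthogonal:
  assumes "v \<in> V" "T v = complex_of_real r \<star> v" "w \<in> V" "T w = complex_of_real s \<star> w" "r \<noteq> s"
  shows "ip v w = 0"
  using T_sa[of v w] assms by (simp add: ip_scl ip_scl_right)

lemma eigen_calculus_ip:
  assumes d: "eigen_dec k r v" and w: "w \<in> V" "T w = complex_of_real s \<star> w"
  shows "ip (\<Sum>i<k. f (r i) \<star> v i) w = f s * ip (\<Sum>i<k. v i) w"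
proof -
  have "f (r i) * ip (v i) w = f s * ip (v i) w" if "i < k" for i
    using eigen_orthogonal[of "v i" "r i" w s] d w that by (cases "r i = s") (auto simp: eigen_dec_def)
  moreover have "v i \<in> V" if "i < k" for i using d that by (simp add: eigen_dec_def)
  ultimately show ?thesis
    using w by (subst (1 2) ip_sum_left) (auto simp: scl_V ip_scl sum_distrib_left intro!: sum.cong)
qed

text \<open>Against an eigenvector with eigenvalue s, each sum has inner product f s times that of
  the common vector, and eigenvectors span V. This makes the functional calculus well defined, hence
  also \<open>modular_power\<close>.\<close>

lemma eigen_calculus_unique:
  assumes d: "eigen_dec k r v" and d': "eigen_dec k' r' v'" and eq: "(\<Sum>i<k. v i) = (\<Sum>i<k'. v' i)"
  shows "(\<Sum>i<k. f (r i) \<star> v i) = (\<Sum>i<k'. f (r' i) \<star> v' i)"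
proof -
  let ?x = "\<Sum>i<k. f (r i) \<star> v i" and ?y = "\<Sum>i<k'. f (r' i) \<star> v' i"
  have V: "?x \<in> V" "?y \<in> V" using d d' by (auto simp: eigen_dec_def intro!: sum_V scl_V)
  have "ip (?x - ?y) w = 0" if "w \<in> eig_sums" for w
    using that
  proof (induction rule: eig_sums.induct)
    case (add w s a)
    have "ip (?x - ?y) w = 0"
      using eigen_calculus_ip[OF d add(1,2)] eigen_calculus_ip[OF d' add(1,2)] V add(1) by (simp add: ip_diff eq)
    moreover have "ip (?x - ?y) (w + a) = ip (?x - ?y) w + ip (?x - ?y) a"
      using V add(1,3) by (simp add: ip_add_right eig_sums_V diff_V)
    ultimately show ?case using add by simp
  qed (use V in \<open>simp add: diff_V\<close>)
  then have "ip (?x - ?y) (?x - ?y) = 0"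
    using V by (simp add: eig_sums_all diff_V)
  then show ?thesis using ip_definite V diff_V by fastforce
qed

end

section \<open>Finite-dimensional von Neumann algebras\<close>

lemma fd_vn_algebraD:
  assumes "fd_vn_algebra M"
  shows fd_one: "mat 1 \<in> M"
    and fd_add: "\<And>x y. x \<in> M \<Longrightarrow> y \<in> M \<Longrightarrow> x + y \<in> M"
    and fd_mult: "\<And>x y. x \<in> M \<Longrightarrow> y \<in> M \<Longrightarrow> x ** y \<in> M"
    and fd_cadj: "\<And>x. x \<in> M \<Longrightarrow> cadj x \<in> M"
    and fd_smat: "\<And>c x. x \<in> M \<Longrightarrow> c \<cdot>\<^sub>C x \<in> M"
  using assms by (auto simp: fd_vn_algebra_def)

lemma fd_zero: "fd_vn_algebra M \<Longrightarrow> 0 \<in> M"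
  using fd_smat[OF _ fd_one, of M 0] by simp

lemma fd_diff: "fd_vn_algebra M \<Longrightarrow> x \<in> M \<Longrightarrow> y \<in> M \<Longrightarrow> x - y \<in> M"
  using fd_add[of M x "- 1 \<cdot>\<^sub>C y"] fd_smat[of M y "-1"] by (simp add: smat_minus_one)

lemma fd_sum: "fd_vn_algebra M \<Longrightarrow> (\<And>i. i \<in> I \<Longrightarrow> f i \<in> M) \<Longrightarrow> (\<Sum>i\<in>I. f i) \<in> M"
  by (induction I rule: infinite_finite_induct) (auto simp: fd_zero fd_add)

lemma fd_subspace: "fd_vn_algebra M \<Longrightarrow> subspace M"
  unfolding subspace_def by (metis fd_zero fd_add fd_smat smat_of_real)

section \<open>Linear extension from the algebra to all matrices, and a Riesz lemma\<close>

lemma linear_form_onD: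
  assumes "linear_form_on A f"
  shows lf_add: "\<And>x y. x \<in> A \<Longrightarrow> y \<in> A \<Longrightarrow> f (x + y) = f x + f y"
    and lf_smat: "\<And>c x. x \<in> A \<Longrightarrow> f (c \<cdot>\<^sub>C x) = c * f x"
  using assms by (auto simp: linear_form_on_def)

lemma linear_map_onD:
  assumes "linear_map_on A f"
  shows lm_add: "\<And>x y. x \<in> A \<Longrightarrow> y \<in> A \<Longrightarrow> f (x + y) = f x + f y"
    and lm_smat: "\<And>c x. x \<in> A \<Longrightarrow> f (c \<cdot>\<^sub>C x) = c \<cdot>\<^sub>C f x"
  using assms by (auto simp: linear_map_on_def)

lemma real_linear_extension:
  fixes V :: "'v::euclidean_space set" and f :: "'v \<Rightarrow> 'w::real_vector"
  assumes V: "subspace V"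
    and add: "\<And>x y. x \<in> V \<Longrightarrow> y \<in> V \<Longrightarrow> f (x + y) = f x + f y"
    and scale: "\<And>c x. x \<in> V \<Longrightarrow> f (c *\<^sub>R x) = c *\<^sub>R f x"
  shows "\<exists>F. linear F \<and> (\<forall>x\<in>V. F x = f x)"
proof -
  obtain B where B: "B \<subseteq> V" "independent B" "span B = V"
    using basis_exists[of V] V by (metis span_minimal subset_antisym)
  then have fin: "finite B" using finiteI_independent by blast
  obtain F where F: "linear F" "\<forall>x\<in>B. F x = f x"
    using linear_independent_extend[OF B(2), of f] by blast
  have f0: "f 0 = 0" using scale[OF subspace_0[OF V], of 0] by simp
  have "x \<in> V \<and> F x = f x" if "x \<in> span B" for x
    using that
  proof (induction rule: span_induct_alt)
    case base
    then show ?case using F f0 subspace_0[OF V] by (simp add: linear_0)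
  next
    case (step c x y)
    moreover have "x \<in> V" using step(1) B(1) by auto

    ultimately show ?case
      using F V by (simp add: linear_add linear_cmul add scale subspace_scale subspace_add)
  qed
  with F B show ?thesis by auto
qed

text \<open>A real-linear extension G comes from a basis. Averaging it to (G x - i G (i x)) / 2
  makes it complex-linear and changes nothing on M, where f is complex-linear already.\<close>

lemma linear_map_on_extend:
  fixes f :: "complex ^ 'a ^ 'a \<Rightarrow> complex ^ 'b ^ 'b"
  assumes M: "fd_vn_algebra M" and f: "linear_map_on M f"
  shows "\<exists>F. linear_map_on UNIV F \<and> (\<forall>x\<in>M. F x = f x)"
proof -
  obtain G where G: "linear G" "\<forall>x\<in>M. G x = f x"
    using real_linear_extension[OF fd_subspace[OF M], of f] f
    by (auto simp: linear_map_on_def smat_of_real[symmetric])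
  define F where "F x = (1 / 2) \<cdot>\<^sub>C (G x - \<i> \<cdot>\<^sub>C G (\<i> \<cdot>\<^sub>C x))" for x
  have add: "F (x + y) = F x + F y" for x y
    using G(1) by (simp add: F_def smat_add_right linear_add vec_eq_iff algebra_simps)
  have rl: "F (complex_of_real r \<cdot>\<^sub>C x) = complex_of_real r \<cdot>\<^sub>C F x" for r x
  proof -
    have "G (\<i> \<cdot>\<^sub>C complex_of_real r \<cdot>\<^sub>C x) = complex_of_real r \<cdot>\<^sub>C G (\<i> \<cdot>\<^sub>C x)"
      using linear_cmul[OF G(1), of r "\<i> \<cdot>\<^sub>C x"] by (simp add: smat_of_real[symmetric] mult.commute)
    moreover have "G (complex_of_real r \<cdot>\<^sub>C x) = complex_of_real r \<cdot>\<^sub>C G x"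
      using linear_cmul[OF G(1), of r x] by (simp add: smat_of_real[symmetric])
    ultimately show ?thesis by (simp add: F_def vec_eq_iff algebra_simps)
  qed
  have im: "F (\<i> \<cdot>\<^sub>C x) = \<i> \<cdot>\<^sub>C F x" for x
  proof -
    have "G (\<i> \<cdot>\<^sub>C \<i> \<cdot>\<^sub>C x) = - G x"
      using linear_neg[OF G(1), of x] by (simp add: smat_minus_one)
    then show ?thesis by (simp add: F_def vec_eq_iff algebra_simps)
  qed
  have "F (c \<cdot>\<^sub>C x) = c \<cdot>\<^sub>C F x" for c x
  proof -
    have "c \<cdot>\<^sub>C x = complex_of_real (Re c) \<cdot>\<^sub>C x + complex_of_real (Im c) \<cdot>\<^sub>C \<i> \<cdot>\<^sub>C x"
      by (simp add: smat_add_left[symmetric] mult.commute[of _ \<i>] flip: complex_eq)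
    then have "F (c \<cdot>\<^sub>C x) = complex_of_real (Re c) \<cdot>\<^sub>C F x + complex_of_real (Im c) \<cdot>\<^sub>C \<i> \<cdot>\<^sub>C F x"
      by (simp only: add rl im)
    then show ?thesis by (simp add: smat_add_left[symmetric] mult.commute[of _ \<i>] flip: complex_eq)
  qed
  moreover have "F x = f x" if "x \<in> M" for x
    using G(2) that M f by (simp add: F_def fd_smat lm_smat[OF f] vec_eq_iff)
  ultimately show ?thesis using add by (auto simp: linear_map_on_def)
qed

text \<open>A form is treated as a map into the 1 by 1 matrices.\<close>

lemma linear_form_on_extend:
  assumes M: "fd_vn_algebra M" and f: "linear_form_on M f"
  shows "\<exists>F. linear_form_on UNIV F \<and> (\<forall>x\<in>M. F x = f x)"
proof -
  have "linear_map_on M (\<lambda>x. f x \<cdot>\<^sub>C (mat 1 :: complex ^ 1 ^ 1))"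
    using f by (simp add: linear_map_on_def linear_form_on_def smat_add_left)
  then obtain F where F: "linear_map_on UNIV F" "\<forall>x\<in>M. F x = f x \<cdot>\<^sub>C (mat 1 :: complex ^ 1 ^ 1)"
    using linear_map_on_extend[OF M] by blast
  have "linear_form_on UNIV (\<lambda>x. F x $ 1 $ 1)"
    using F(1) by (simp add: linear_map_on_def linear_form_on_def)
  moreover have "\<forall>x\<in>M. F x $ 1 $ 1 = f x" using F(2) by (simp add: mat_def)
  ultimately show ?thesis by blast
qed

text \<open>B is not assumed symmetric, only definite on V. With a basis S of V, the map F sends c
  to the vector with coordinates B c e; definiteness makes it injective on V, equality of dimensions
  makes it onto V, and a preimage of the vector with coordinates g e represents g.\<close>

lemma real_riesz:
  fixes V :: "'v::euclidean_space set" and B :: "'v \<Rightarrow> 'v \<Rightarrow> real"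
  assumes V: "subspace V" and B1: "\<And>y. linear (\<lambda>x. B x y)" and B2: "\<And>x. linear (B x)"
    and pos: "\<And>x. x \<in> V \<Longrightarrow> B x x = 0 \<Longrightarrow> x = 0" and g: "linear g"
  shows "\<exists>c\<in>V. \<forall>b\<in>V. B c b = g b"
proof -
  obtain S where S: "S \<subseteq> V" "independent S" "span S = V"
    using basis_exists[of V] V by (metis span_minimal subset_antisym)
  then have fin: "finite S" using finiteI_independent by blast
  have zero: "\<forall>e\<in>S. u e = 0" if "(\<Sum>e\<in>S. u e *\<^sub>R e) = 0" for u
    using that S(2) dependent_finite[OF fin] by auto
  define F where "F c = (\<Sum>e\<in>S. B c e *\<^sub>R e)" for c
  have F: "linear F"
    by (rule linearI)
      (simp_all add: F_def linear_add[OF B1] linear_cmul[OF B1] scaleR_left_distrib sum.distrib scaleR_sum_right)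
  have FV: "F c \<in> V" for c
    using S(1) by (auto simp: F_def intro!: subspace_sum[OF V] subspace_scale[OF V])
  have F0: "d = 0" if "d \<in> V" "F d = 0" for d
  proof -
    have "B d e = 0" if "e \<in> S" for e using zero[of "B d"] \<open>F d = 0\<close> that by (simp add: F_def)
    then have "B d d = 0"
      using linear_eq_0_on_span[OF B2, of S d d] S(3) that by blast
    then show ?thesis using pos that by blast
  qed
  have "inj_on F V"
  proof (rule inj_onI)
    fix x y assume "x \<in> V" "y \<in> V" "F x = F y"
    then show "x = y" using F0[of "x - y"] V F by (simp add: linear_diff subspace_diff)
  qed
  then have "inj_on F (span V)" using V by (metis span_eq_iff)
  then have "dim (F ` V) = dim V" by (rule dim_image_eq[OF F])
  then have "F ` V = V"
    using FV V F by (intro subspace_dim_equal) (auto simp: linear_subspace_image)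
  moreover have "(\<Sum>e\<in>S. g e *\<^sub>R e) \<in> V"
    using S(1) by (auto intro!: subspace_sum[OF V] subspace_scale[OF V])
  ultimately obtain c where c: "c \<in> V" "F c = (\<Sum>e\<in>S. g e *\<^sub>R e)" by (metis imageE)
  then have "(\<Sum>e\<in>S. (B c e - g e) *\<^sub>R e) = 0"
    by (simp add: F_def scaleR_left_diff_distrib sum_subtractf)
  then have "\<forall>e\<in>S. B c e - g e = 0" by (rule zero)
  then have "B c b = g b" if "b \<in> span S" for b
    using linear_eq_on_span[OF B2 g, of S c b] that by auto
  then show ?thesis using c S by auto
qed


section \<open>Square roots of positive matrices\<close>

lemma self_adjoint_op_matrix:
  assumes "cadj A = A"
  shows "self_adjoint_op UNIV (*s) cinner ((*v) A)"
proof
  show "complex_of_real r *s x = r *\<^sub>R x" for r and x :: "complex ^ 'a"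
    by (simp add: vec_eq_iff scaleR_conv_of_real[where 'a = complex])
  show "cinner x x = 0 \<Longrightarrow> x = 0" for x :: "complex ^ 'a"
    by (simp add: cinner_self)
qed (use assms in \<open>simp_all add: cinner_add_left cnj_cinner matrix_vector_right_distrib
    matrix_vec_scale cinner_adj vector_add_ldistrib vector_sadd_rdistrib vector_smult_assoc\<close>)

lemma psd_eigenvalue_nonneg:
  assumes "psd A" "A *v v = complex_of_real r *s v" "v \<noteq> 0"
  shows "0 \<le> r"
proof -
  have "complex_of_real r * complex_of_real ((norm v)\<^sup>2) \<in> \<real>\<^sub>\<ge>\<^sub>0"
    using assms(1,2) cinner_self[of v] unfolding psd_def by (metis cinner_scale_left)
  then have "complex_of_real (r * (norm v)\<^sup>2) \<in> \<real>\<^sub>\<ge>\<^sub>0" by simp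
  then have "0 \<le> r * (norm v)\<^sup>2" unfolding nonneg_Reals_of_real_iff .
  then show ?thesis using assms(3) by (simp add: zero_le_mult_iff)
qed

lemma psd_eigen_decomposition:
  assumes "psd A"
  shows "\<exists>k (r :: nat \<Rightarrow> real) v. (\<forall>i<k. 0 \<le> r i \<and> A *v v i = complex_of_real (r i) *s v i) \<and> \<xi> = (\<Sum>i<k. v i)"
proof -
  interpret self_adjoint_op UNIV "(*s)" cinner "(*v) A"
    by (rule self_adjoint_op_matrix[OF psd_hermitian[OF assms]])
  show ?thesis
    using eigen_decomposition[of \<xi> "\<lambda>r. 0 \<le> r"] psd_eigenvalue_nonneg[OF assms]
    by (simp add: eigen_dec_def) metis
qed

text \<open>Z is the Lagrange product of the factors (A - r) / (s - r) over r in R; being a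
  polynomial in A, it stays in M.\<close>

lemma eigenspace_separation:
  fixes A :: "complex ^ 'a ^ 'a"
  assumes M: "fd_vn_algebra M" and A: "A \<in> M" and R: "finite R" "s \<notin> R"
  shows "\<exists>Z\<in>M. (\<forall>r\<in>R. \<forall>v. A *v v = complex_of_real r *s v \<longrightarrow> Z *v v = 0)
    \<and> (\<forall>v. A *v v = complex_of_real s *s v \<longrightarrow> Z *v v = v)"
  using R
proof (induction R rule: finite_induct)
  case empty
  then show ?case using fd_one[OF M] by (auto intro!: bexI[of _ "mat 1"])
next
  case (insert r R)
  then obtain Z where Z: "Z \<in> M" "\<And>q v. q \<in> R \<Longrightarrow> A *v v = complex_of_real q *s v \<Longrightarrow> Z *v v = 0"
    "\<And>v. A *v v = complex_of_real s *s v \<Longrightarrow> Z *v v = v" by auto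
  define c where "c = 1 / complex_of_real (s - r)"
  define W where "W = Z ** (c \<cdot>\<^sub>C (A - complex_of_real r \<cdot>\<^sub>C mat 1))"
  have W: "W *v v = Z *v ((c * complex_of_real (q - r)) *s v)" if "A *v v = complex_of_real q *s v" for q v
    using that by (simp add: W_def matrix_vector_mul_assoc[symmetric] smat_mult_vec
        matrix_vector_mult_diff_rdistrib del: smat_mult_right)
      (simp add: vec_eq_iff algebra_simps matrix_vec_scale)
  have "W \<in> M" using M A Z by (auto simp: W_def intro!: fd_mult fd_smat fd_diff fd_one)
  moreover have "W *v v = 0" if "q \<in> insert r R" "A *v v = complex_of_real q *s v" for q v
    using that Z(2)[of q v] W[of v q] by (auto simp: matrix_vec_scale)
  moreover have "W *v v = v" if "A *v v = complex_of_real s *s v" for v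
    using that Z(3)[of v] W[of v s] insert.prems by (auto simp: matrix_vec_scale c_def)
  ultimately show ?case by blast
qed

lemma eigenvalue_interpolation:
  fixes A :: "complex ^ 'a ^ 'a" and f :: "real \<Rightarrow> complex"
  assumes M: "fd_vn_algebra M" and A: "A \<in> M" and R: "finite R"
  shows "\<exists>Q\<in>M. \<forall>r\<in>R. \<forall>v. A *v v = complex_of_real r *s v \<longrightarrow> Q *v v = f r *s v"
  using R
proof (induction R rule: finite_induct)
  case empty
  then show ?case using fd_one[OF M] by auto
next
  case (insert s R)
  then obtain Q where Q: "Q \<in> M" "\<And>r v. r \<in> R \<Longrightarrow> A *v v = complex_of_real r *s v \<Longrightarrow> Q *v v = f r *s v"
    by auto
  obtain Z where Z: "Z \<in> M" "\<And>r v. r \<in> R \<Longrightarrow> A *v v = complex_of_real r *s v \<Longrightarrow> Z *v v = 0"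
    "\<And>v. A *v v = complex_of_real s *s v \<Longrightarrow> Z *v v = v"
    using eigenspace_separation[OF M A insert.hyps] by auto
  \<comment> \<open>Z is the identity on the eigenspace for s and kills those for R, so W takes the
    new value f s and keeps the old ones.\<close>
  define W where "W = Q ** (mat 1 - Z) + f s \<cdot>\<^sub>C Z"
  have "W \<in> M" using M Q Z by (auto simp: W_def intro!: fd_add fd_mult fd_smat fd_diff fd_one)
  moreover have "W *v v = f r *s v" if "r \<in> insert s R" "A *v v = complex_of_real r *s v" for r v
    using that Q(2)[of r v] Z(2)[of r v] Z(3)[of v]
    by (cases "r = s") (auto simp: W_def matrix_vector_mult_add_rdistrib matrix_vector_mul_assoc[symmetric]
        matrix_vector_mult_diff_rdistrib smat_mult_vec)
  ultimately show ?case by blast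
qed

text \<open>The root is found inside M. A positive x in M is then s s with s self-adjoint in M,
  which is how \<Gamma>, multiplicative on M only, is seen to preserve positivity.\<close>

lemma psd_sqrt_exists:
  fixes A :: "complex ^ 'a ^ 'a"
  assumes M: "fd_vn_algebra M" and A: "A \<in> M" "psd A"
  shows "\<exists>S\<in>M. psd S \<and> S ** S = A"
proof -
  have "\<forall>p. \<exists>k (r :: nat \<Rightarrow> real) v. (\<forall>i<k. 0 \<le> r i \<and> A *v v i = complex_of_real (r i) *s v i)
      \<and> axis p 1 = (\<Sum>i<k. v i)"
    using psd_eigen_decomposition[OF A(2)] by blast
  then obtain k and r :: "'a \<Rightarrow> nat \<Rightarrow> real" and v
    where dec: "\<And>p i. i < k p \<Longrightarrow> 0 \<le> r p i \<and> A *v v p i = complex_of_real (r p i) *s v p i"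
    and ax: "\<And>p. axis p 1 = (\<Sum>i<k p. v p i)"
    by metis
  define f where "f = (\<lambda>r. complex_of_real (root 4 r))"
  obtain Q where Q: "Q \<in> M"
    "\<And>s v. s \<in> (\<Union>p. r p ` {..<k p}) \<Longrightarrow> A *v v = complex_of_real s *s v \<Longrightarrow> Q *v v = f s *s v"
    using eigenvalue_interpolation[OF M A(1), of "\<Union>p. r p ` {..<k p}" f] by auto
  have Qv: "Q *v v p i = f (r p i) *s v p i" if "i < k p" for p i
    by (rule Q(2)) (use that dec in auto)
  interpret self_adjoint_op UNIV "(*s)" cinner "(*v) A"
    by (rule self_adjoint_op_matrix[OF psd_hermitian[OF A(2)]])
  have orth: "f (r p i) * cinner (v p i) (v q j) = f (r q j) * cinner (v p i) (v q j)"
    if "i < k p" "j < k q" for p i q j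
    using eigen_orthogonal[of "v p i" "r p i" "v q j" "r q j"] dec that by (cases "r p i = r q j") auto
  have "Q = cadj Q"
  proof -
    have "Q $ q $ p = cadj Q $ q $ p" for p q
    proof -
      have "cinner (Q *v axis p 1) (axis q 1) = (\<Sum>i<k p. \<Sum>j<k q. f (r p i) * cinner (v p i) (v q j))"
        unfolding ax
        by (simp add: matrix_vec_sum_right ip_sum_left ip_sum_right Qv sum_distrib_left) (rule sum.swap)
      also have "\<dots> = (\<Sum>i<k p. \<Sum>j<k q. cnj (f (r q j)) * cinner (v p i) (v q j))"
        by (intro sum.cong refl) (use orth in \<open>simp add: f_def\<close>)
      also have "\<dots> = cinner (axis p 1) (Q *v axis q 1)"
        unfolding ax
        by (simp add: matrix_vec_sum_right ip_sum_left ip_sum_right Qv sum_distrib_left) (rule sum.swap)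
      also have "\<dots> = cinner (cadj Q *v axis p 1) (axis q 1)" by (simp add: cinner_adj)
      finally show ?thesis by (simp add: matrix_axis_nth)
    qed
    then show ?thesis unfolding vec_eq_iff by blast
  qed
  then have "psd (Q ** Q)" using psd_adj_mult_self[of Q] by simp
  moreover have "(Q ** Q) ** (Q ** Q) = A"
  proof -
    have f4: "f s * (f s * (f s * f s)) = complex_of_real s" if "0 \<le> s" for s
    proof -
      have "root 4 s ^ 4 = s" using that by simp
      then show ?thesis by (simp add: f_def power4_eq_xxxx mult.assoc flip: of_real_mult)
    qed
    have "((Q ** Q) ** (Q ** Q)) *v axis p 1 = A *v axis p 1" for p
      unfolding ax using dec Qv
      by (simp add: matrix_vec_sum_right matrix_vector_mul_assoc[symmetric] matrix_vec_scale f4 mult.assoc)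
    then show ?thesis
      by (metis matrix_axis_nth vec_eq_iff)
  qed
  ultimately show ?thesis using Q(1) M fd_mult by blast
qed

text \<open>If A v = r v, then u = (S - sqrt r) v satisfies S u = - sqrt r u, so positivity of S
  leaves only u = 0 or r = 0; for r = 0 the squared norm of S v is the pairing of v with S S v = 0.
  Hence S is determined on every eigenvector of A, and these span.\<close>

lemma psd_sqrt_unique:
  assumes "psd S" "S ** S = A" "psd S'" "S' ** S' = A"
  shows "S = S'"
proof -
  have A: "psd A" using psd_adj_mult_self[of S] psd_hermitian[OF assms(1)] assms(2) by simp
  have eig: "S *v v = complex_of_real (sqrt r) *s v"
    if S: "psd S" "S ** S = A" and v: "0 \<le> r" "A *v v = complex_of_real r *s v" for S v r
  proof -
    have SS: "S *v (S *v v) = complex_of_real r *s v"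
      using S v by (simp add: matrix_vector_mul_assoc)
    define u where "u = S *v v - complex_of_real (sqrt r) *s v"
    have "complex_of_real (sqrt r) * complex_of_real (sqrt r) = complex_of_real r"
      using v(1) by (simp flip: of_real_mult)
    then have "S *v u = complex_of_real (- sqrt r) *s u"
      by (simp add: u_def matrix_vector_mult_diff_distrib SS matrix_vec_scale)
    then have "u = 0 \<or> r = 0" using psd_eigenvalue_nonneg[OF S(1), of u "- sqrt r"] v(1) by auto
    moreover have "u = 0" if "r = 0"
    proof -
      have "cinner (S *v v) (S *v v) = cinner v (S *v (S *v v))"
        using psd_hermitian[OF S(1)] by (simp add: cinner_adj)
      then have "S *v v = 0" using that SS by (simp add: cinner_self)
      then show ?thesis using that by (simp add: u_def)
    qed
    ultimately show ?thesis by (auto simp: u_def)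
  qed
  have "S *v \<xi> = S' *v \<xi>" for \<xi>
  proof -
    obtain k and r :: "nat \<Rightarrow> real" and v
      where d: "\<forall>i<k. 0 \<le> r i \<and> A *v v i = complex_of_real (r i) *s v i" and \<xi>: "\<xi> = (\<Sum>i<k. v i)"
      using psd_eigen_decomposition[OF A, of \<xi>] by blast
    have "S *v v i = S' *v v i" if "i < k" for i
      using eig[OF assms(1,2), of "r i" "v i"] eig[OF assms(3,4), of "r i" "v i"] d that by simp
    then show ?thesis
      by (simp add: \<xi> matrix_vec_sum_right)
  qed
  then show ?thesis by (simp add: matrix_eq)
qed

lemma fd_vn_algebra_UNIV: "fd_vn_algebra UNIV"
  by (simp add: fd_vn_algebra_def)

lemma psd_sqrt_eqI: "psd S \<Longrightarrow> S ** S = A \<Longrightarrow> psd_sqrt A = S"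
  unfolding psd_sqrt_def by (rule the_equality) (auto intro: psd_sqrt_unique)

lemma psd_sqrt_spec:
  assumes "psd A" shows "psd (psd_sqrt A)" "psd_sqrt A ** psd_sqrt A = A"
proof -
  obtain S where "psd S" "S ** S = A"
    using psd_sqrt_exists[OF fd_vn_algebra_UNIV UNIV_I assms] by blast
  then show "psd (psd_sqrt A)" "psd_sqrt A ** psd_sqrt A = A"
    using psd_sqrt_eqI[of S A] by simp_all
qed

lemma norm_psd_sqrt:
  assumes "psd A"
  shows "complex_of_real ((norm (psd_sqrt A *v \<xi>))\<^sup>2) = cinner (A *v \<xi>) \<xi>"
  using psd_sqrt_spec[OF assms] psd_hermitian[of "psd_sqrt A"]
  by (metis cinner_adj cinner_self matrix_vector_mul_assoc cnj_cinner)

lemma psd_factor: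
  assumes "fd_vn_algebra M" "x \<in> M" "psd x"
  obtains s where "s \<in> M" "cadj s = s" "s ** s = x"
  using psd_sqrt_exists[OF assms] psd_hermitian by blast

section \<open>Tomita--Takesaki theory in finite dimension\<close>

locale weighted_algebra =
  fixes M :: "(complex ^ 'a ^ 'a) set" and \<psi> :: "complex ^ 'a ^ 'a \<Rightarrow> complex"
  assumes fd: "fd_vn_algebra M" and nsf: "nsf_weight M \<psi>"
begin

lemmas one_M = fd_one[OF fd] and zero_M = fd_zero[OF fd] and add_M = fd_add[OF fd] and mult_M = fd_mult[OF fd]
  and cadj_M = fd_cadj[OF fd] and smat_M = fd_smat[OF fd] and diff_M = fd_diff[OF fd]
lemmas closed_M = one_M zero_M add_M mult_M cadj_M smat_M diff_M

lemma lin: "linear_form_on M \<psi>"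
  using nsf by (simp add: nsf_weight_def positive_form_on_def)

lemmas \<psi>_add = lf_add[OF lin] and \<psi>_smat = lf_smat[OF lin]

lemma \<psi>_diff: "x \<in> M \<Longrightarrow> y \<in> M \<Longrightarrow> \<psi> (x - y) = \<psi> x - \<psi> y"
  using \<psi>_add[of x "- 1 \<cdot>\<^sub>C y"] \<psi>_smat[of y "-1"] smat_M[of y "-1"] by (simp add: smat_minus_one)

lemma \<psi>_zero [simp]: "\<psi> 0 = 0"
  using \<psi>_smat[OF one_M, of 0] by simp

lemma \<psi>_nonneg: "x \<in> M \<Longrightarrow> psd x \<Longrightarrow> \<psi> x \<in> \<real>\<^sub>\<ge>\<^sub>0"
  using nsf by (simp add: nsf_weight_def positive_form_on_def)

lemma \<psi>_faithful: "x \<in> M \<Longrightarrow> \<psi> (cadj x ** x) = 0 \<Longrightarrow> x = 0"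
proof -
  assume x: "x \<in> M" "\<psi> (cadj x ** x) = 0"
  then have "cadj x ** x = 0"
    using nsf psd_adj_mult_self[of x] mult_M[OF cadj_M] by (auto simp: nsf_weight_def faithful_form_on_def)
  have "x *v \<xi> = 0" for \<xi>
  proof -
    have "cinner (x *v \<xi>) (x *v \<xi>) = cinner ((cadj x ** x) *v \<xi>) \<xi>"
      by (simp add: matrix_vector_mul_assoc[symmetric] cinner_adj)
    then show ?thesis using \<open>cadj x ** x = 0\<close> by (simp add: cinner_self)
  qed
  then show "x = 0" by (simp add: matrix_eq)
qed

lemma \<psi>_square: "x \<in> M \<Longrightarrow> \<psi> (cadj x ** x) = complex_of_real (Re (\<psi> (cadj x ** x))) \<and> 0 \<le> Re (\<psi> (cadj x ** x))"
proof -
  assume "x \<in> M"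
  then have "\<psi> (cadj x ** x) \<in> \<real>\<^sub>\<ge>\<^sub>0" by (simp add: \<psi>_nonneg psd_adj_mult_self closed_M)
  then show ?thesis by (auto elim: nonneg_Reals_cases)
qed

lemma \<psi>_square_pos: "x \<in> M \<Longrightarrow> x \<noteq> 0 \<Longrightarrow> 0 < Re (\<psi> (cadj x ** x))"
  using \<psi>_square[of x] \<psi>_faithful[of x] by (metis of_real_0 order_le_less)

text \<open>Since \<psi> is real at \<open>cadj z ** z\<close> for z = 1 + y, the imaginary parts of
  its values at y and at \<open>cadj y\<close> cancel. Replacing x by i x settles the real
  parts.\<close>

lemma \<psi>_cadj: "x \<in> M \<Longrightarrow> \<psi> (cadj x) = cnj (\<psi> x)"
proof -
  assume x: "x \<in> M"
  have real: "Im (\<psi> (cadj y ** y)) = 0" if "y \<in> M" for y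
    using \<psi>_square[OF that] by (metis Im_complex_of_real)
  have 1: "Im (\<psi> (cadj y)) = - Im (\<psi> y)" if y: "y \<in> M" for y
  proof -
    have "cadj (mat 1 + y) ** (mat 1 + y) = (mat 1 + cadj y ** y) + (y + cadj y)"
      by (simp add: matrix_add_ldistrib matrix_add_rdistrib_complex algebra_simps)
    then have "Im (\<psi> ((mat 1 + cadj y ** y) + (y + cadj y))) = 0"
      using real[of "mat 1 + y"] y closed_M by simp
    moreover have "\<psi> ((mat 1 + cadj y ** y) + (y + cadj y)) = \<psi> (mat 1) + \<psi> (cadj y ** y) + (\<psi> y + \<psi> (cadj y))"
      using y by (simp add: \<psi>_add closed_M)
    ultimately show ?thesis using real[OF y] real[OF one_M] by simp
  qed
  have "Im (\<psi> (cadj (\<i> \<cdot>\<^sub>C x))) = - Im (\<psi> (\<i> \<cdot>\<^sub>C x))" using 1 x smat_M by blast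
  then have "Re (\<psi> (cadj x)) = Re (\<psi> x)" using x by (simp add: \<psi>_smat closed_M)
  then show ?thesis using 1[OF x] by (simp add: complex_eq_iff)
qed

text \<open>The real Riesz lemma is applied to the real part of \<psi> (\<open>cadj c ** b\<close>),
  for which \<psi> and f are first extended to all matrices; replacing b by i b recovers the
  imaginary part. The representing element is the adjoint of the c so found.\<close>

lemma form_representation:
  assumes f: "linear_form_on M f"
  shows "\<exists>c\<in>M. \<forall>b\<in>M. f b = \<psi> (c ** b)"
proof -
  obtain F where F: "linear_form_on UNIV F" "\<forall>x\<in>M. F x = f x"
    using linear_form_on_extend[OF fd f] by blast
  obtain \<Psi> where P: "linear_form_on UNIV \<Psi>" "\<forall>x\<in>M. \<Psi> x = \<psi> x"
    using linear_form_on_extend[OF fd lin] by blast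
  note PF = lf_add[OF P(1)] lf_smat[OF P(1)] lf_add[OF F(1)] lf_smat[OF F(1)]
  have "\<exists>c\<in>M. \<forall>b\<in>M. Re (\<Psi> (cadj c ** b)) = Re (F b)"
  proof (rule real_riesz[OF fd_subspace[OF fd]])
    show "linear (\<lambda>x. Re (\<Psi> (cadj x ** y)))" for y
      by (rule linearI) (simp_all add: PF matrix_add_rdistrib_complex smat_of_real[symmetric])
    show "linear (\<lambda>y. Re (\<Psi> (cadj x ** y)))" for x
      by (rule linearI) (simp_all add: PF matrix_add_ldistrib smat_of_real[symmetric])
    show "linear (\<lambda>x. Re (F x))"
      by (rule linearI) (simp_all add: PF smat_of_real[symmetric])
    show "x = 0" if "x \<in> M" "Re (\<Psi> (cadj x ** x)) = 0" for x
      using that \<psi>_square_pos[of x] P(2) by (cases "x = 0") (auto simp: closed_M)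
  qed
  then obtain c where c: "c \<in> M" "\<And>b. b \<in> M \<Longrightarrow> Re (\<psi> (cadj c ** b)) = Re (f b)"
    using P(2) F(2) by (auto simp: closed_M)
  have "f b = \<psi> (cadj c ** b)" if b: "b \<in> M" for b
  proof -
    have "Im (\<psi> (cadj c ** b)) = Im (f b)"
      using c(2)[of "\<i> \<cdot>\<^sub>C b"] b c(1) by (simp add: \<psi>_smat lf_smat[OF f] closed_M)
    then show ?thesis using c(2)[OF b] by (simp add: complex_eq_iff)
  qed
  then show ?thesis using cadj_M[OF c(1)] by blast
qed

lemma form_ext:
  assumes "c \<in> M" "d \<in> M" "\<And>b. b \<in> M \<Longrightarrow> \<psi> (b ** c) = \<psi> (b ** d)"
  shows "c = d"
proof -
  have "\<psi> (cadj (c - d) ** (c - d)) = 0"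
    using assms by (simp add: matrix_mult_minus_right \<psi>_diff closed_M del: cadj_diff)
  then show ?thesis using \<psi>_faithful[of "c - d"] assms diff_M by simp
qed

text \<open>Replacing b by its adjoint turns (\<Delta> a | b) = (S b | S a) into \<psi> (b
  \<Delta>(a)) = \<psi> (a b). This form contains no adjoints and is the one used for all
  computations with \<Delta>.\<close>

lemma modular_op_eqI:
  assumes "a \<in> M" "c \<in> M" "\<And>b. b \<in> M \<Longrightarrow> \<psi> (b ** c) = \<psi> (a ** b)"
  shows "modular_op M \<psi> a = c"
  unfolding modular_op_def gns_inner_def
proof (rule the_equality)
  show "c \<in> M \<and> (\<forall>b\<in>M. \<psi> (cadj b ** c) = \<psi> (cadj (cadj a) ** cadj b))"
    using assms closed_M by simp
  fix d assume d: "d \<in> M \<and> (\<forall>b\<in>M. \<psi> (cadj b ** d) = \<psi> (cadj (cadj a) ** cadj b))"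
  have "\<psi> (b ** d) = \<psi> (b ** c)" if b: "b \<in> M" for b
    using bspec[OF conjunct2[OF d], of "cadj b"] assms(3)[OF b] b closed_M by simp
  then show "d = c" using form_ext d assms by blast
qed

lemma modular_op_spec:
  assumes a: "a \<in> M"
  shows modular_op_M: "modular_op M \<psi> a \<in> M"
    and modular_op: "\<And>b. b \<in> M \<Longrightarrow> \<psi> (b ** modular_op M \<psi> a) = \<psi> (a ** b)"
proof -
  have "linear_form_on M (\<lambda>b. \<psi> (b ** cadj a))"
    using a by (simp add: linear_form_on_def matrix_add_rdistrib_complex \<psi>_add \<psi>_smat closed_M)
  then obtain c where c: "c \<in> M" "\<And>b. b \<in> M \<Longrightarrow> \<psi> (b ** cadj a) = \<psi> (c ** b)"
    using form_representation by blast
  have "\<psi> (b ** cadj c) = \<psi> (a ** b)" if b: "b \<in> M" for b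
    using arg_cong[OF c(2)[of "cadj b"], of cnj] a b c(1)
    by (simp add: \<psi>_cadj[symmetric] closed_M)
  then have "modular_op M \<psi> a = cadj c \<and> (\<forall>b\<in>M. \<psi> (b ** cadj c) = \<psi> (a ** b))"
    using modular_op_eqI[OF a, of "cadj c"] cadj_M[OF c(1)] by simp
  then show "modular_op M \<psi> a \<in> M" "\<And>b. b \<in> M \<Longrightarrow> \<psi> (b ** modular_op M \<psi> a) = \<psi> (a ** b)"
    using cadj_M[OF c(1)] by simp_all
qed

text \<open>Self-adjointness of \<Delta>: the pairings of \<Delta>(x) with y and of x with
  \<Delta>(y) both equal \<psi> (\<open>x ** cadj y\<close>).\<close>

sublocale modular: self_adjoint_op M "(\<cdot>\<^sub>C)" "gns_inner \<psi>" "modular_op M \<psi>"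
proof
  fix x y assume xy: "x \<in> M" "y \<in> M"
  show "modular_op M \<psi> (x + y) = modular_op M \<psi> x + modular_op M \<psi> y"
    using xy by (intro modular_op_eqI)
      (simp_all add: modular_op modular_op_M matrix_add_ldistrib matrix_add_rdistrib_complex \<psi>_add closed_M)
  show "gns_inner \<psi> (modular_op M \<psi> x) y = gns_inner \<psi> x (modular_op M \<psi> y)"
  proof -
    have "\<psi> (cadj (modular_op M \<psi> y) ** x) = cnj (\<psi> (cadj x ** modular_op M \<psi> y))"
      using xy by (subst \<psi>_cadj[symmetric]) (simp_all add: modular_op_M closed_M)
    also have "\<dots> = cnj (\<psi> (y ** cadj x))" using xy by (simp add: modular_op closed_M)
    also have "\<dots> = \<psi> (x ** cadj y)" using xy by (subst \<psi>_cadj[symmetric]) (simp_all add: closed_M)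
    finally show ?thesis using xy by (simp add: gns_inner_def modular_op closed_M)
  qed
  show "cnj (gns_inner \<psi> x y) = gns_inner \<psi> y x"
    using xy by (simp add: gns_inner_def closed_M flip: \<psi>_cadj)
next
  fix x c assume x: "x \<in> M"
  show "modular_op M \<psi> (c \<cdot>\<^sub>C x) = c \<cdot>\<^sub>C modular_op M \<psi> x"
    using x by (intro modular_op_eqI) (simp_all add: modular_op modular_op_M \<psi>_smat closed_M)
qed (auto simp: closed_M gns_inner_def matrix_add_ldistrib \<psi>_add \<psi>_smat \<psi>_faithful smat_of_real
    smat_add_left smat_add_right modular_op_M)

text \<open>At b = \<open>cadj v\<close> the relation for \<Delta> reads \<psi>
  (\<open>v ** cadj v\<close>) = r \<psi> (\<open>cadj v ** v\<close>), and both values are positive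
  for v \<noteq> 0.\<close>

lemma modular_eigenvalue_pos:
  assumes "v \<in> M" "v \<noteq> 0" "modular_op M \<psi> v = complex_of_real r \<cdot>\<^sub>C v"
  shows "0 < r"
proof -
  have "\<psi> (v ** cadj v) = complex_of_real r * \<psi> (cadj v ** v)"
    using modular_op[of v "cadj v"] assms by (simp add: \<psi>_smat closed_M)
  then have "complex_of_real (Re (\<psi> (cadj (cadj v) ** cadj v))) = complex_of_real (r * Re (\<psi> (cadj v ** v)))"
    using \<psi>_square[of v] \<psi>_square[of "cadj v"] assms(1) cadj_M by (metis cadj_cadj of_real_mult)
  then have "Re (\<psi> (cadj (cadj v) ** cadj v)) = r * Re (\<psi> (cadj v ** v))"
    using of_real_eq_iff by blast
  moreover have "0 < Re (\<psi> (cadj (cadj v) ** cadj v))"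
    using \<psi>_square_pos[of "cadj v"] assms cadj_M by (metis cadj_cadj cadj_zero)
  moreover have "0 < Re (\<psi> (cadj v ** v))" using \<psi>_square_pos assms by blast
  ultimately show ?thesis by (simp add: zero_less_mult_iff)
qed

lemma modular_power_eq:
  assumes d: "modular.eigen_dec k r v" "\<forall>i<k. 0 < r i"
  shows "modular_power M \<psi> z (\<Sum>i<k. v i) = (\<Sum>i<k. (complex_of_real (r i) powr z) \<cdot>\<^sub>C v i)"
  unfolding modular_power_def
proof (rule the_equality)
  show "\<exists>(k' :: nat) (r' :: nat \<Rightarrow> real) v'. (\<forall>i<k'. 0 < r' i \<and> v' i \<in> M \<and> modular_op M \<psi> (v' i) = complex_of_real (r' i) \<cdot>\<^sub>C v' i)
      \<and> (\<Sum>i<k. v i) = (\<Sum>i<k'. v' i)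
      \<and> (\<Sum>i<k. (complex_of_real (r i) powr z) \<cdot>\<^sub>C v i) = (\<Sum>i<k'. (complex_of_real (r' i) powr z) \<cdot>\<^sub>C v' i)"
    using d unfolding modular.eigen_dec_def by blast
next
  fix c assume "\<exists>(k' :: nat) (r' :: nat \<Rightarrow> real) v'. (\<forall>i<k'. 0 < r' i \<and> v' i \<in> M \<and> modular_op M \<psi> (v' i) = complex_of_real (r' i) \<cdot>\<^sub>C v' i)
      \<and> (\<Sum>i<k. v i) = (\<Sum>i<k'. v' i) \<and> c = (\<Sum>i<k'. (complex_of_real (r' i) powr z) \<cdot>\<^sub>C v' i)"
  then obtain k' r' v' where "modular.eigen_dec k' r' v'" "(\<Sum>i<k. v i) = (\<Sum>i<k'. v' i)"
      and c: "c = (\<Sum>i<k'. (complex_of_real (r' i) powr z) \<cdot>\<^sub>C v' i)"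
    unfolding modular.eigen_dec_def by blast
  then show "c = (\<Sum>i<k. (complex_of_real (r i) powr z) \<cdot>\<^sub>C v i)"
    using modular.eigen_calculus_unique[OF d(1), of k' r' v' "\<lambda>r. complex_of_real r powr z"] by simp
qed

text \<open>Left multiplication by a centralizing element commutes with \<Delta>, hence respects its
  eigenspaces, so the factors r^(it) and r^(-it) cancel. The hypothesis concerns the single element
  x; \<psi> need not be a trace.\<close>

lemma modular_aut_centralizer:
  assumes x: "x \<in> M" and central: "\<And>a. a \<in> M \<Longrightarrow> \<psi> (x ** a) = \<psi> (a ** x)"
  shows "modular_aut M \<psi> t x = x"
  unfolding modular_aut_def
proof (rule the_equality)
  let ?z = "\<i> * complex_of_real t"
  have commute: "modular_op M \<psi> (x ** v) = x ** modular_op M \<psi> v" if v: "v \<in> M" for v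
  proof (rule modular_op_eqI)
    fix b assume b: "b \<in> M"
    have "\<psi> (b ** (x ** modular_op M \<psi> v)) = \<psi> (v ** (b ** x))"
      using modular_op[OF v, of "b ** x"] b x closed_M by (simp add: matrix_mul_assoc)
    also have "\<dots> = \<psi> (x ** v ** b)"
      using central[of "v ** b"] v b closed_M by (simp add: matrix_mul_assoc)
    finally show "\<psi> (b ** (x ** modular_op M \<psi> v)) = \<psi> (x ** v ** b)" .
  qed (use x v in \<open>auto simp: closed_M modular_op_M\<close>)
  have main: "x ** a = modular_power M \<psi> ?z (x ** modular_power M \<psi> (- \<i> * complex_of_real t) a)"
    if a: "a \<in> M" for a
  proof -
    obtain k r v where d: "modular.eigen_dec k r v" "\<forall>i<k. 0 < r i" "a = (\<Sum>i<k. v i)"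
      using modular.eigen_decomposition[OF a, of "\<lambda>r. 0 < r"] modular_eigenvalue_pos by blast
    define w where "w i = x ** ((complex_of_real (r i) powr (- ?z)) \<cdot>\<^sub>C v i)" for i
    have "modular.eigen_dec k r w"
      using d(1) x commute
      by (simp add: modular.eigen_dec_def w_def closed_M modular.T_scl mult.commute)
    then have "modular_power M \<psi> ?z (\<Sum>i<k. w i) = (\<Sum>i<k. (complex_of_real (r i) powr ?z) \<cdot>\<^sub>C w i)"
      using d(2) by (rule modular_power_eq)
    also have "\<dots> = (\<Sum>i<k. x ** v i)"
    proof (rule sum.cong)
      fix i assume "i \<in> {..<k}"
      then have "complex_of_real (r i) \<noteq> 0" using d(2) by auto
      then have "complex_of_real (r i) powr ?z * complex_of_real (r i) powr (- ?z) = 1"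
        using powr_add[of "complex_of_real (r i)" ?z "- ?z"] by simp
      then show "(complex_of_real (r i) powr ?z) \<cdot>\<^sub>C w i = x ** v i" by (simp add: w_def)
    qed simp
    finally show ?thesis
      using modular_power_eq[OF d(1,2), of "- ?z"] by (simp add: d(3) w_def matrix_mult_sum_right)
  qed
  show "x \<in> M \<and> (\<forall>a\<in>M. x ** a = modular_power M \<psi> ?z (x ** modular_power M \<psi> (- \<i> * complex_of_real t) a))"
    using x main by blast
  fix y assume "y \<in> M \<and> (\<forall>a\<in>M. y ** a = modular_power M \<psi> ?z (x ** modular_power M \<psi> (- \<i> * complex_of_real t) a))"
  \<comment> \<open>A solution is determined by its action on the unit.\<close>
  then have "y ** mat 1 = x ** mat 1" using main one_M by metis
  then show "y = x" by simp
qed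

end

section \<open>Tracial weights: trivial modular data, and domination of all linear forms\<close>

locale traced_algebra = weighted_algebra +
  assumes trace: "\<And>x y. x \<in> M \<Longrightarrow> y \<in> M \<Longrightarrow> \<psi> (x ** y) = \<psi> (y ** x)"
begin

text \<open>For a trace \<Delta> is the identity, so a is its own decomposition, with the single
  eigenvalue 1.\<close>

lemma modular_conj_eq:
  assumes a: "a \<in> M" shows "modular_conj M \<psi> a = cadj a"
proof -
  have "modular_op M \<psi> a = a" using a trace by (intro modular_op_eqI) auto
  then have "modular.eigen_dec 1 (\<lambda>_. 1) (\<lambda>_. a)" using a by (simp add: modular.eigen_dec_def)
  then have "modular_power M \<psi> (- 1 / 2) a = a"
    using modular_power_eq[of 1 "\<lambda>_. 1" "\<lambda>_. a" "- 1 / 2"] by simp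
  then show ?thesis by (simp add: modular_conj_def)
qed

lemma modular_aut_eq: "a \<in> M \<Longrightarrow> modular_aut M \<psi> t a = a"
  by (intro modular_aut_centralizer trace) auto

text \<open>Traciality gives f (\<open>cadj y ** y\<close>) = \<psi>
  (\<open>y ** q ** cadj y\<close>), whose real part involves only the self-adjoint part n of the
  density q. As n is bounded above by its operator norm C, the estimate follows from positivity of
  \<psi> and a second use of the trace.\<close>

lemma form_dominated:
  assumes f: "linear_form_on M f"
  shows "\<exists>C. \<forall>y\<in>M. Re (f (cadj y ** y)) \<le> C * Re (\<psi> (cadj y ** y))"
proof -
  obtain q where q: "q \<in> M" "\<And>b. b \<in> M \<Longrightarrow> f b = \<psi> (q ** b)"
    using form_representation[OF f] by blast
  define n where "n = (1 / 2) \<cdot>\<^sub>C (q + cadj q)"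
  have n: "n \<in> M" "cadj n = n" using q closed_M by (simp_all add: n_def add.commute)
  define C where "C = onorm ((*v) n)"
  have bl: "bounded_linear ((*v) n)" by (rule matrix_vector_mul_bounded_linear)
  have psd: "psd (complex_of_real C \<cdot>\<^sub>C mat 1 - n)"
    unfolding psd_def
  proof
    fix \<xi>
    have "cnj (cinner (n *v \<xi>) \<xi>) = cinner (n *v \<xi>) \<xi>" by (simp add: cnj_cinner cinner_adj n)
    then obtain s where s: "cinner (n *v \<xi>) \<xi> = complex_of_real s" by (metis Reals_cases Reals_cnj_iff)
    have "s \<le> cmod (cinner (n *v \<xi>) \<xi>)" by (simp add: s)
    also have "\<dots> \<le> norm (n *v \<xi>) * norm \<xi>"
    proof -
      have "cmod (cinner (n *v \<xi>) \<xi>) \<le> (\<Sum>i\<in>UNIV. \<bar>cmod ((n *v \<xi>) $ i)\<bar> * \<bar>cmod (\<xi> $ i)\<bar>)"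
        unfolding cinner_def by (rule order_trans[OF norm_sum]) (simp add: norm_mult)
      also have "\<dots> \<le> norm (n *v \<xi>) * norm \<xi>" unfolding norm_vec_def by (rule L2_set_mult_ineq)
      finally show ?thesis .
    qed
    also have "\<dots> \<le> C * norm \<xi> * norm \<xi>"
      unfolding C_def by (intro mult_right_mono onorm[OF bl]) simp
    finally have "0 \<le> C * (norm \<xi>)\<^sup>2 - s" by (simp add: power2_eq_square)
    moreover have "cinner ((complex_of_real C \<cdot>\<^sub>C mat 1 - n) *v \<xi>) \<xi> = complex_of_real (C * (norm \<xi>)\<^sup>2 - s)"
      by (simp add: matrix_vector_mult_diff_rdistrib cinner_diff_left smat_mult_vec cinner_self s)
    ultimately show "cinner ((complex_of_real C \<cdot>\<^sub>C mat 1 - n) *v \<xi>) \<xi> \<in> \<real>\<^sub>\<ge>\<^sub>0"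
      by (simp only: nonneg_Reals_of_real_iff)
  qed
  have "Re (f (cadj y ** y)) \<le> C * Re (\<psi> (cadj y ** y))" if y: "y \<in> M" for y
  proof -
    have "f (cadj y ** y) = \<psi> (y ** q ** cadj y)"
      using trace[of "q ** cadj y" y] q y by (simp add: closed_M matrix_mul_assoc)
    moreover have "\<psi> (y ** cadj q ** cadj y) = cnj (\<psi> (y ** q ** cadj y))"
      using q y by (subst \<psi>_cadj[symmetric]) (simp_all add: closed_M matrix_mul_assoc)
    moreover have "\<psi> (y ** n ** cadj y) = (\<psi> (y ** q ** cadj y) + \<psi> (y ** cadj q ** cadj y)) / 2"
      using q y by (simp add: n_def \<psi>_smat \<psi>_add closed_M matrix_add_ldistrib matrix_add_rdistrib_complex)
    ultimately have "\<psi> (y ** n ** cadj y) = (f (cadj y ** y) + cnj (f (cadj y ** y))) / 2" by simp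
    then have 1: "Re (\<psi> (y ** n ** cadj y)) = Re (f (cadj y ** y))" unfolding complex_add_cnj by simp
    have "psd (cadj (cadj y) ** (complex_of_real C \<cdot>\<^sub>C mat 1 - n) ** cadj y)" by (rule psd_conj[OF psd])
    then have "psd (complex_of_real C \<cdot>\<^sub>C (y ** cadj y) - y ** n ** cadj y)"
      by (simp add: matrix_mult_minus_left matrix_mult_minus_right)
    then have "\<psi> (complex_of_real C \<cdot>\<^sub>C (y ** cadj y) - y ** n ** cadj y) \<in> \<real>\<^sub>\<ge>\<^sub>0"
      using y n closed_M by (intro \<psi>_nonneg) auto
    then have "0 \<le> Re (\<psi> (complex_of_real C \<cdot>\<^sub>C (y ** cadj y) - y ** n ** cadj y))"
      by (auto elim: nonneg_Reals_cases)
    then show ?thesis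
      using 1 y n trace[of y "cadj y"] by (simp add: \<psi>_diff \<psi>_smat closed_M)
  qed
  then show ?thesis by blast
qed

lemma gns_norm_dominates:
  assumes g: "\<And>y. y \<in> M \<Longrightarrow> complex_of_real ((norm (g y))\<^sup>2) = f (cadj y ** y)" and f: "linear_form_on M f"
  shows "\<exists>C. \<forall>y\<in>M. norm (g y) \<le> C * gns_norm \<psi> y"
proof -
  obtain C where C: "\<And>y. y \<in> M \<Longrightarrow> Re (f (cadj y ** y)) \<le> C * Re (\<psi> (cadj y ** y))"
    using form_dominated[OF f] by blast
  have "norm (g y) \<le> sqrt C * gns_norm \<psi> y" if y: "y \<in> M" for y
  proof -
    have "(norm (g y))\<^sup>2 \<le> C * Re (\<psi> (cadj y ** y))"
      using C[OF y] g[OF y] by (metis Re_complex_of_real)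
    then have "norm (g y) \<le> sqrt (C * Re (\<psi> (cadj y ** y)))" by (rule real_le_rsqrt)
    then show ?thesis by (simp add: gns_norm_def gns_inner_def real_sqrt_mult)
  qed
  then show ?thesis by blast
qed

end

section \<open>Relative tensor products over a traced algebra\<close>

text \<open>G is a candidate for the Gram operator. By \<open>gram\<close>, the element n that
  represents m \<mapsto> (\<beta>(m) \<xi> | \<xi>') through the trace is also the one whose image
  under \<alpha> is the block of G at \<xi>, \<xi>'. Requiring a projection makes G at once the Gram
  operator, its square root and the range projection. The spaces of \<beta> and \<alpha> may differ,
  so that iterated relative tensor products are covered.\<close>

locale rel_tensor = traced_algebra N \<psi>
  for N :: "(complex ^ 'k ^ 'k) set" and \<psi> +
  fixes \<beta> :: "complex ^ 'k ^ 'k \<Rightarrow> complex ^ 'a ^ 'a" and \<alpha> :: "complex ^ 'k ^ 'k \<Rightarrow> complex ^ 'b ^ 'b"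
    and G :: "complex ^ ('a \<times> 'b) ^ ('a \<times> 'b)"
  assumes \<beta>: "star_antihom_on N \<beta>" and \<alpha>: "star_hom_on N \<alpha>"
    and G_idem: "G ** G = G" and G_sa: "cadj G = G"
    and gram: "\<And>\<xi> \<xi>'. \<exists>n\<in>N. (\<forall>m\<in>N. \<psi> (n ** m) = cinner (\<beta> m *v \<xi>) \<xi>')
      \<and> (\<forall>\<eta> \<eta>'. cinner (G *v (\<xi> \<otimes>\<^sub>v \<eta>)) (\<xi>' \<otimes>\<^sub>v \<eta>') = cinner (\<alpha> n *v \<eta>) \<eta>')"
begin

lemma \<beta>_mult: "x \<in> N \<Longrightarrow> y \<in> N \<Longrightarrow> \<beta> (x ** y) = \<beta> y ** \<beta> x"
  and \<beta>_cadj: "x \<in> N \<Longrightarrow> \<beta> (cadj x) = cadj (\<beta> x)"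
  and \<beta>_lin: "linear_map_on N \<beta>"
  using \<beta> by (auto simp: star_antihom_on_def)

lemma \<alpha>_mult: "x \<in> N \<Longrightarrow> y \<in> N \<Longrightarrow> \<alpha> (x ** y) = \<alpha> x ** \<alpha> y"
  and \<alpha>_cadj: "x \<in> N \<Longrightarrow> \<alpha> (cadj x) = cadj (\<alpha> x)"
  and \<alpha>_lin: "linear_map_on N \<alpha>"
  using \<alpha> by (auto simp: star_hom_on_def)

lemma GG_vec [simp]: "G *v (G *v \<xi>) = G *v \<xi>"
  by (simp add: matrix_vector_mul_assoc G_idem)

text \<open>Domination is applied to m \<mapsto> (\<beta>(m) \<xi> | \<xi>): as \<beta> reverses
  products, its value at \<open>cadj y ** y\<close> is the squared norm of
  \<beta>(\<open>cadj y\<close>) \<xi>. The boundedness condition thus disappears from all later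
  descriptions.\<close>

lemma bounded_right: "bounded_right_vectors N \<psi> \<beta> = UNIV"
proof -
  have "\<exists>C. \<forall>y\<in>N. norm (\<beta> (cadj y) *v \<xi>) \<le> C * gns_norm \<psi> y" for \<xi>
  proof (rule gns_norm_dominates)
    show "linear_form_on N (\<lambda>m. cinner (\<beta> m *v \<xi>) \<xi>)"
      using \<beta>_lin by (simp add: linear_form_on_def linear_map_on_def matrix_vector_mult_add_rdistrib
          cinner_add_left smat_mult_vec)
    fix y assume y: "y \<in> N"
    have "cinner (\<beta> (cadj y) *v \<xi>) (\<beta> (cadj y) *v \<xi>) = cinner (\<beta> y *v (\<beta> (cadj y) *v \<xi>)) \<xi>"
      using \<beta>_cadj[OF y] by (simp add: cinner_adj)
    then show "complex_of_real ((norm (\<beta> (cadj y) *v \<xi>))\<^sup>2) = cinner (\<beta> (cadj y ** y) *v \<xi>) \<xi>"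
      using y by (simp add: cinner_self[symmetric] \<beta>_mult cadj_M matrix_vector_mul_assoc del: of_real_power)
  qed
  then show ?thesis by (auto simp: bounded_right_vectors_def)
qed

lemma bounded_left: "bounded_left_vectors N \<psi> \<alpha> = UNIV"
proof -
  have "\<exists>C. \<forall>y\<in>N. norm (\<alpha> y *v \<eta>) \<le> C * gns_norm \<psi> y" for \<eta>
  proof (rule gns_norm_dominates)
    show "linear_form_on N (\<lambda>m. cinner (\<alpha> m *v \<eta>) \<eta>)"
      using \<alpha>_lin by (simp add: linear_form_on_def linear_map_on_def matrix_vector_mult_add_rdistrib
          cinner_add_left smat_mult_vec)
    fix y assume y: "y \<in> N"
    have "cinner (\<alpha> y *v \<eta>) (\<alpha> y *v \<eta>) = cinner (\<alpha> (cadj y) *v (\<alpha> y *v \<eta>)) \<eta>"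
      using \<alpha>_cadj[OF y] by (simp add: cinner_adj)
    then show "complex_of_real ((norm (\<alpha> y *v \<eta>))\<^sup>2) = cinner (\<alpha> (cadj y ** y) *v \<eta>) \<eta>"
      using y by (simp add: cinner_self[symmetric] \<alpha>_mult cadj_M matrix_vector_mul_assoc del: of_real_power)
  qed
  then show ?thesis by (auto simp: bounded_left_vectors_def)
qed

text \<open>J is the adjoint here, so a = J y says that y is the adjoint of a.\<close>

lemma R_op_eq: "a \<in> N \<Longrightarrow> R_op N \<psi> \<beta> \<xi> a = \<beta> a *v \<xi>"
  unfolding R_op_def
proof (rule the_equality)
  assume a: "a \<in> N"
  then show "\<exists>y\<in>N. a = modular_conj N \<psi> y \<and> \<beta> a *v \<xi> = \<beta> (cadj y) *v \<xi>"
    by (intro bexI[of _ "cadj a"]) (simp_all add: modular_conj_eq cadj_M)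
qed (auto simp: modular_conj_eq)

text \<open>Traciality rewrites \<psi> (\<open>cadj b ** n ** a\<close>) as \<psi>
  (\<open>n ** (a ** cadj b)\<close>), and \<beta>, reversing products, turns this into the pairing
  of \<beta>(a) \<xi> with \<beta>(b) \<xi>'. Conversely, b = 1 already determines the
  element.\<close>

lemma N_inner_eq:
  assumes n: "n \<in> N" and nm: "\<And>m. m \<in> N \<Longrightarrow> \<psi> (n ** m) = cinner (\<beta> m *v \<xi>) \<xi>'"
  shows "N_inner N \<psi> \<beta> \<xi> \<xi>' = n"
  unfolding N_inner_def
proof (rule the_equality)
  have "gns_inner \<psi> (n ** a) b = cinner (R_op N \<psi> \<beta> \<xi> a) (R_op N \<psi> \<beta> \<xi>' b)"
    if ab: "a \<in> N" "b \<in> N" for a b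
  proof -
    have "gns_inner \<psi> (n ** a) b = \<psi> (n ** (a ** cadj b))"
      using trace[of "cadj b" "n ** a"] ab n by (simp add: gns_inner_def closed_M matrix_mul_assoc)
    also have "\<dots> = cinner (\<beta> (a ** cadj b) *v \<xi>) \<xi>'"
      using ab by (simp add: nm closed_M)
    also have "\<dots> = cinner (\<beta> a *v \<xi>) (\<beta> b *v \<xi>')"
      using ab by (simp add: \<beta>_mult \<beta>_cadj closed_M matrix_vector_mul_assoc[symmetric] cinner_adj'[of _ "\<beta> b"])
    finally show ?thesis using ab by (simp add: R_op_eq)
  qed
  then show "n \<in> N \<and> (\<forall>a\<in>N. \<forall>b\<in>N. gns_inner \<psi> (n ** a) b = cinner (R_op N \<psi> \<beta> \<xi> a) (R_op N \<psi> \<beta> \<xi>' b))"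
    using n by blast
  fix k assume k: "k \<in> N \<and> (\<forall>a\<in>N. \<forall>b\<in>N. gns_inner \<psi> (k ** a) b = cinner (R_op N \<psi> \<beta> \<xi> a) (R_op N \<psi> \<beta> \<xi>' b))"
  have "\<psi> (a ** k) = \<psi> (a ** n)" if a: "a \<in> N" for a
  proof -
    have "gns_inner \<psi> (k ** a) (mat 1) = gns_inner \<psi> (n ** a) (mat 1)"
      using k a one_M \<open>\<And>b a. a \<in> N \<Longrightarrow> b \<in> N \<Longrightarrow> gns_inner \<psi> (n ** a) b = _\<close> by metis
    then show ?thesis using a k n trace[of a k] trace[of a n] by (simp add: gns_inner_def)
  qed
  then show "k = n" using form_ext k n by blast
qed

lemma rtp_gram_eq: "rtp_gram N \<psi> \<beta> \<alpha> = G"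
proof -
  have G: "cinner (G *v (\<xi> \<otimes>\<^sub>v \<eta>)) (\<xi>' \<otimes>\<^sub>v \<eta>') = cinner (\<alpha> (N_inner N \<psi> \<beta> \<xi> \<xi>') *v \<eta>) \<eta>'" for \<xi> \<xi>' \<eta> \<eta>'
    using gram[of \<xi> \<xi>'] N_inner_eq by metis
  show ?thesis
    unfolding rtp_gram_def bounded_right
    by (rule the_equality) (auto simp: G intro: matrix_tensor_cinner_eqI)
qed

lemma rtp_embed_eq: "rtp_embed N \<psi> \<beta> \<alpha> = G"
  unfolding rtp_embed_def rtp_gram_eq
  using psd_adj_mult_self[of G] by (intro psd_sqrt_eqI) (simp_all add: G_sa G_idem)

lemma rtp_vec_eq: "rtp_vec N \<psi> \<beta> \<alpha> \<xi> \<eta> = G *v (\<xi> \<otimes>\<^sub>v \<eta>)"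
  by (simp add: rtp_vec_def rtp_embed_eq)

lemma rtp_proj_eq: "rtp_proj N \<psi> \<beta> \<alpha> = G"
  unfolding rtp_proj_def rtp_embed_eq
proof (rule the_equality)
  fix p assume p: "p ** p = p \<and> cadj p = p \<and> range ((*v) p) = range ((*v) G)"
  have "p *v (G *v \<xi>) = G *v \<xi>" for \<xi>
  proof -
    obtain \<zeta> where "G *v \<xi> = p *v \<zeta>" using p by (metis rangeE rangeI)
    then show ?thesis using p by (simp add: matrix_vector_mul_assoc)
  qed
  then have "p ** G = G" by (simp add: matrix_eq matrix_vector_mul_assoc[symmetric])
  then have "G ** p = G" using p G_sa by (metis cadj_mult)
  have "G *v (p *v \<xi>) = p *v \<xi>" for \<xi>
  proof -
    obtain \<zeta> where "p *v \<xi> = G *v \<zeta>" using p by (metis rangeE rangeI)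
    then show ?thesis by simp
  qed
  then have "G ** p = p" by (simp add: matrix_eq matrix_vector_mul_assoc[symmetric])
  then show "p = G" using \<open>G ** p = G\<close> by simp
qed (simp add: G_idem G_sa)

lemma rtp_ops_iff: "A \<in> rtp_ops N \<psi> \<beta> \<alpha> \<longleftrightarrow> G ** A ** G = A"
  by (simp add: rtp_ops_def rtp_proj_eq)

lemma rtp_opsD: "A \<in> rtp_ops N \<psi> \<beta> \<alpha> \<Longrightarrow> G ** A = A \<and> A ** G = A"
  unfolding rtp_ops_iff by (metis G_idem matrix_mul_assoc)

text \<open>An operator commuting with G preserves the range of G; its restriction to that range,
  extended by 0, is its product with G.\<close>

lemma rtp_op_eq:
  assumes c: "G ** (x \<otimes>\<^sub>m y) = (x \<otimes>\<^sub>m y) ** G"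
  shows "rtp_op N \<psi> \<beta> \<alpha> x y = (x \<otimes>\<^sub>m y) ** G"
  unfolding rtp_op_def rtp_vec_eq
proof (rule the_equality)
  have "(x \<otimes>\<^sub>m y) ** G \<in> rtp_ops N \<psi> \<beta> \<alpha>"
    unfolding rtp_ops_iff by (metis c G_idem matrix_mul_assoc)
  moreover have "((x \<otimes>\<^sub>m y) ** G) *v (G *v (\<xi> \<otimes>\<^sub>v \<eta>)) = G *v ((x *v \<xi>) \<otimes>\<^sub>v (y *v \<eta>))" for \<xi> \<eta>
    by (metis c GG_vec matrix_vector_mul_assoc tensor_mult_vec)
  ultimately show "(x \<otimes>\<^sub>m y) ** G \<in> rtp_ops N \<psi> \<beta> \<alpha> \<and>
      (\<forall>\<xi> \<eta>. ((x \<otimes>\<^sub>m y) ** G) *v (G *v (\<xi> \<otimes>\<^sub>v \<eta>)) = G *v ((x *v \<xi>) \<otimes>\<^sub>v (y *v \<eta>)))" by blast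
  fix A assume A: "A \<in> rtp_ops N \<psi> \<beta> \<alpha> \<and> (\<forall>\<xi> \<eta>. A *v (G *v (\<xi> \<otimes>\<^sub>v \<eta>)) = G *v ((x *v \<xi>) \<otimes>\<^sub>v (y *v \<eta>)))"
  have "A *v (\<xi> \<otimes>\<^sub>v \<eta>) = ((x \<otimes>\<^sub>m y) ** G) *v (\<xi> \<otimes>\<^sub>v \<eta>)" for \<xi> \<eta>
    using A rtp_opsD[of A] c by (metis matrix_vector_mul_assoc tensor_mult_vec)
  then show "A = (x \<otimes>\<^sub>m y) ** G" by (rule matrix_tensor_eqI)
qed

lemma rtp_lambda_vec: "rtp_lambda N \<psi> \<beta> \<alpha> \<xi> *v \<eta> = G *v (\<xi> \<otimes>\<^sub>v \<eta>)"
  unfolding rtp_lambda_def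
  by (subst matrix_works)
    (auto simp: rtp_vec_eq Vector_Spaces.linear_iff tensor_vec_add_right tensor_vec_scale_right
      matrix_vector_right_distrib matrix_vec_scale vec.vector_space_axioms)

lemma rtp_rho_vec: "rtp_rho N \<psi> \<beta> \<alpha> \<eta> *v \<xi> = G *v (\<xi> \<otimes>\<^sub>v \<eta>)"
  unfolding rtp_rho_def
  by (subst matrix_works)
    (auto simp: rtp_vec_eq Vector_Spaces.linear_iff tensor_vec_add_left tensor_vec_scale_left
      matrix_vector_right_distrib matrix_vec_scale vec.vector_space_axioms)

text \<open>An operator living under G absorbs the embedding, so relative slices can be computed as
  slices on the ordinary tensor product.\<close>

lemma rtp_ops_cinner:
  assumes "A \<in> rtp_ops N \<psi> \<beta> \<alpha>"
  shows "cinner (A *v (G *v \<zeta>)) (G *v \<zeta>') = cinner (A *v \<zeta>) \<zeta>'"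
proof -
  have "cinner (A *v (G *v \<zeta>)) (G *v \<zeta>') = cinner ((G ** A ** G) *v \<zeta>) \<zeta>'"
    by (simp add: cinner_adj' G_sa matrix_vector_mul_assoc matrix_mul_assoc)
  then show ?thesis using assms by (simp add: rtp_ops_iff)
qed

lemma cinner_left_slice:
  assumes "A \<in> rtp_ops N \<psi> \<beta> \<alpha>"
  shows "cinner (left_slice N \<psi> \<beta> \<alpha> \<xi> A *v \<eta>) \<eta>' = cinner (A *v (\<xi> \<otimes>\<^sub>v \<eta>)) (\<xi> \<otimes>\<^sub>v \<eta>')"
proof -
  have "cinner (left_slice N \<psi> \<beta> \<alpha> \<xi> A *v \<eta>) \<eta>' = cinner (A *v (G *v (\<xi> \<otimes>\<^sub>v \<eta>))) (rtp_lambda N \<psi> \<beta> \<alpha> \<xi> *v \<eta>')"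
    unfolding left_slice_def matrix_vector_mul_assoc[symmetric] rtp_lambda_vec
    by (subst cinner_adj) (simp add: rtp_lambda_vec rtp_rho_vec)
  then show ?thesis by (simp only: rtp_ops_cinner[OF assms] rtp_lambda_vec)
qed

lemma cinner_right_slice:
  assumes "A \<in> rtp_ops N \<psi> \<beta> \<alpha>"
  shows "cinner (right_slice N \<psi> \<beta> \<alpha> \<eta> A *v \<xi>) \<xi>' = cinner (A *v (\<xi> \<otimes>\<^sub>v \<eta>)) (\<xi>' \<otimes>\<^sub>v \<eta>)"
proof -
  have "cinner (right_slice N \<psi> \<beta> \<alpha> \<eta> A *v \<xi>) \<xi>' = cinner (A *v (G *v (\<xi> \<otimes>\<^sub>v \<eta>))) (rtp_rho N \<psi> \<beta> \<alpha> \<eta> *v \<xi>')"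
    unfolding right_slice_def matrix_vector_mul_assoc[symmetric] rtp_rho_vec
    by (subst cinner_adj) (simp add: rtp_lambda_vec rtp_rho_vec)
  then show ?thesis by (simp only: rtp_ops_cinner[OF assms] rtp_rho_vec)
qed

lemma rtp_ops_eqI:
  assumes "A \<in> rtp_ops N \<psi> \<beta> \<alpha>" "B \<in> rtp_ops N \<psi> \<beta> \<alpha>"
    and "\<And>\<xi> \<eta>. cinner (A *v (\<xi> \<otimes>\<^sub>v \<eta>)) (\<xi> \<otimes>\<^sub>v \<eta>) = cinner (B *v (\<xi> \<otimes>\<^sub>v \<eta>)) (\<xi> \<otimes>\<^sub>v \<eta>)"
  shows "A = B"
  using assms(3) by (rule matrix_tensor_diag_eqI)

lemma norm_sqrt_rtp_vec:
  assumes "psd B" "B \<in> rtp_ops N \<psi> \<beta> \<alpha>"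
  shows "complex_of_real ((norm (psd_sqrt B *v rtp_vec N \<psi> \<beta> \<alpha> \<xi> \<eta>))\<^sup>2) = cinner (B *v (\<xi> \<otimes>\<^sub>v \<eta>)) (\<xi> \<otimes>\<^sub>v \<eta>)"
  using norm_psd_sqrt[OF assms(1)] rtp_ops_cinner[OF assms(2)] by (simp only: rtp_vec_eq)

text \<open>Both squared norms are values of quadratic forms, so the square roots drop out, and the
  defining condition on D becomes agreement with the form of B on all \<xi> \<otimes> \<eta>.
  Polarization then gives D = B.\<close>

lemma id_star_weight_eq:
  assumes B: "psd B" "B \<in> rtp_ops N \<psi> \<beta> \<alpha>"
    and T: "\<And>\<xi>. psd (T (left_slice N \<psi> \<beta> \<alpha> \<xi> A))"
    and BT: "\<And>\<xi> \<eta>. cinner (B *v (\<xi> \<otimes>\<^sub>v \<eta>)) (\<xi> \<otimes>\<^sub>v \<eta>) = cinner (T (left_slice N \<psi> \<beta> \<alpha> \<xi> A) *v \<eta>) \<eta>"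
  shows "id_star_weight N \<psi> \<beta> \<alpha> T A = B"
  unfolding id_star_weight_def bounded_right
proof (rule the_equality)
  have eq: "(norm (psd_sqrt D *v rtp_vec N \<psi> \<beta> \<alpha> \<xi> \<eta>))\<^sup>2
        = (norm (psd_sqrt (T (left_slice N \<psi> \<beta> \<alpha> \<xi> A)) *v \<eta>))\<^sup>2
      \<longleftrightarrow> cinner (D *v (\<xi> \<otimes>\<^sub>v \<eta>)) (\<xi> \<otimes>\<^sub>v \<eta>) = cinner (B *v (\<xi> \<otimes>\<^sub>v \<eta>)) (\<xi> \<otimes>\<^sub>v \<eta>)"
    if "psd D" "D \<in> rtp_ops N \<psi> \<beta> \<alpha>" for D \<xi> \<eta>
    using norm_sqrt_rtp_vec[OF that, of \<xi> \<eta>] norm_psd_sqrt[OF T, of \<xi> \<eta>] BT[of \<xi> \<eta>]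
    by (metis of_real_eq_iff)
  show "psd B \<and> B \<in> rtp_ops N \<psi> \<beta> \<alpha> \<and> (\<forall>\<xi>\<in>UNIV. \<forall>\<eta>. (norm (psd_sqrt B *v rtp_vec N \<psi> \<beta> \<alpha> \<xi> \<eta>))\<^sup>2
        = (norm (psd_sqrt (T (left_slice N \<psi> \<beta> \<alpha> \<xi> A)) *v \<eta>))\<^sup>2)"
    using B eq[OF B] by simp
  fix D assume "psd D \<and> D \<in> rtp_ops N \<psi> \<beta> \<alpha> \<and> (\<forall>\<xi>\<in>UNIV. \<forall>\<eta>. (norm (psd_sqrt D *v rtp_vec N \<psi> \<beta> \<alpha> \<xi> \<eta>))\<^sup>2
        = (norm (psd_sqrt (T (left_slice N \<psi> \<beta> \<alpha> \<xi> A)) *v \<eta>))\<^sup>2)"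
  then show "D = B" using eq B by (intro rtp_ops_eqI) auto
qed

lemma weight_star_id_eq:
  assumes B: "psd B" "B \<in> rtp_ops N \<psi> \<beta> \<alpha>"
    and T: "\<And>\<eta>. psd (T (right_slice N \<psi> \<beta> \<alpha> \<eta> A))"
    and BT: "\<And>\<xi> \<eta>. cinner (B *v (\<xi> \<otimes>\<^sub>v \<eta>)) (\<xi> \<otimes>\<^sub>v \<eta>) = cinner (T (right_slice N \<psi> \<beta> \<alpha> \<eta> A) *v \<xi>) \<xi>"
  shows "weight_star_id N \<psi> \<beta> \<alpha> T A = B"
  unfolding weight_star_id_def bounded_left
proof (rule the_equality)
  have eq: "(norm (psd_sqrt D *v rtp_vec N \<psi> \<beta> \<alpha> \<xi> \<eta>))\<^sup>2
        = (norm (psd_sqrt (T (right_slice N \<psi> \<beta> \<alpha> \<eta> A)) *v \<xi>))\<^sup>2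
      \<longleftrightarrow> cinner (D *v (\<xi> \<otimes>\<^sub>v \<eta>)) (\<xi> \<otimes>\<^sub>v \<eta>) = cinner (B *v (\<xi> \<otimes>\<^sub>v \<eta>)) (\<xi> \<otimes>\<^sub>v \<eta>)"
    if "psd D" "D \<in> rtp_ops N \<psi> \<beta> \<alpha>" for D \<xi> \<eta>
    using norm_sqrt_rtp_vec[OF that, of \<xi> \<eta>] norm_psd_sqrt[OF T, of \<eta> \<xi>] BT[of \<xi> \<eta>]
    by (metis of_real_eq_iff)
  show "psd B \<and> B \<in> rtp_ops N \<psi> \<beta> \<alpha> \<and> (\<forall>\<eta>\<in>UNIV. \<forall>\<xi>. (norm (psd_sqrt B *v rtp_vec N \<psi> \<beta> \<alpha> \<xi> \<eta>))\<^sup>2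
        = (norm (psd_sqrt (T (right_slice N \<psi> \<beta> \<alpha> \<eta> A)) *v \<xi>))\<^sup>2)"
    using B eq[OF B] by simp
  fix D assume "psd D \<and> D \<in> rtp_ops N \<psi> \<beta> \<alpha> \<and> (\<forall>\<eta>\<in>UNIV. \<forall>\<xi>. (norm (psd_sqrt D *v rtp_vec N \<psi> \<beta> \<alpha> \<xi> \<eta>))\<^sup>2
        = (norm (psd_sqrt (T (right_slice N \<psi> \<beta> \<alpha> \<eta> A)) *v \<xi>))\<^sup>2)"
  then show "D = B" using eq B by (intro rtp_ops_eqI) auto
qed

lemma rtp_ops_right_slice_eqI:
  assumes "A \<in> rtp_ops N \<psi> \<beta> \<alpha>" "B \<in> rtp_ops N \<psi> \<beta> \<alpha>"
    and "\<And>\<eta>. right_slice N \<psi> \<beta> \<alpha> \<eta> A = right_slice N \<psi> \<beta> \<alpha> \<eta> B"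
  shows "A = B"
  using assms(3) by (intro rtp_ops_eqI[OF assms(1,2)]) (metis cinner_right_slice assms(1,2))

lemma rtp_ops_left_slice_eqI:
  assumes "A \<in> rtp_ops N \<psi> \<beta> \<alpha>" "B \<in> rtp_ops N \<psi> \<beta> \<alpha>"
    and "\<And>\<xi>. left_slice N \<psi> \<beta> \<alpha> \<xi> A = left_slice N \<psi> \<beta> \<alpha> \<xi> B"
  shows "A = B"
  using assms(3) by (intro rtp_ops_eqI[OF assms(1,2)]) (metis cinner_left_slice assms(1,2))

end

section \<open>Linear maps on tensor products\<close>

definition bilin :: "(complex ^ 'a ^ 'a \<Rightarrow> complex ^ 'b ^ 'b \<Rightarrow> complex ^ 'c ^ 'd) \<Rightarrow> bool" where
  "bilin b \<longleftrightarrow> (\<forall>x y z. b (x + y) z = b x z + b y z) \<and> (\<forall>x y z. b x (y + z) = b x y + b x z)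
     \<and> (\<forall>c x y. b (c \<cdot>\<^sub>C x) y = c \<cdot>\<^sub>C b x y) \<and> (\<forall>c x y. b x (c \<cdot>\<^sub>C y) = c \<cdot>\<^sub>C b x y)"

definition matrix_unit :: "'a \<Rightarrow> 'a \<Rightarrow> complex ^ 'a ^ 'a" where
  "matrix_unit i j = (\<chi> r s. if r = i \<and> s = j then 1 else 0)"

text \<open>A total variant of \<^const>\<open>tensor_lift\<close>: it is linear in the tensor without side conditions, but needs \<open>b\<close>
  to be defined and bilinear on all matrices. The structure maps are therefore replaced by linear
  extensions.\<close>

definition blift :: "(complex ^ 'a ^ 'a \<Rightarrow> complex ^ 'b ^ 'b \<Rightarrow> complex ^ 'c ^ 'd)
    \<Rightarrow> complex ^ ('a \<times> 'b) ^ ('a \<times> 'b) \<Rightarrow> complex ^ 'c ^ 'd" where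
  "blift b t = (\<Sum>i\<in>UNIV. \<Sum>j\<in>UNIV. \<Sum>k\<in>UNIV. \<Sum>l\<in>UNIV.
     t $ (i, k) $ (j, l) \<cdot>\<^sub>C b (matrix_unit i j) (matrix_unit k l))"

lemma matrix_unit_expansion: "A = (\<Sum>i\<in>UNIV. \<Sum>j\<in>UNIV. A $ i $ j \<cdot>\<^sub>C matrix_unit i j)"
proof -
  have "(\<Sum>i\<in>UNIV. \<Sum>j\<in>UNIV. A $ i $ j * matrix_unit i j $ r $ s) = A $ r $ s" for r s
  proof -
    have "(\<Sum>i\<in>UNIV. \<Sum>j\<in>UNIV. A $ i $ j * matrix_unit i j $ r $ s)
        = (\<Sum>i\<in>UNIV. \<Sum>j\<in>UNIV. if j = s then if i = r then A $ r $ s else 0 else 0)"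
      by (intro sum.cong refl) (auto simp: matrix_unit_def)
    then show ?thesis by simp
  qed
  then show ?thesis by (simp add: vec_eq_iff)
qed

lemma bilin_sum_left: "bilin b \<Longrightarrow> b (\<Sum>i\<in>I. x i) y = (\<Sum>i\<in>I. b (x i) y)"
proof -
  assume b: "bilin b"
  have "b (0 \<cdot>\<^sub>C 0) y = 0 \<cdot>\<^sub>C b 0 y" using b unfolding bilin_def by blast
  then have "b 0 y = 0" by simp
  then show ?thesis by (induction I rule: infinite_finite_induct) (use b in \<open>simp_all add: bilin_def\<close>)
qed

lemma bilin_sum_right: "bilin b \<Longrightarrow> b y (\<Sum>i\<in>I. x i) = (\<Sum>i\<in>I. b y (x i))"
proof -
  assume b: "bilin b"
  have "b y (0 \<cdot>\<^sub>C 0) = 0 \<cdot>\<^sub>C b y 0" using b unfolding bilin_def by blast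
  then have "b y 0 = 0" by simp
  then show ?thesis by (induction I rule: infinite_finite_induct) (use b in \<open>simp_all add: bilin_def\<close>)
qed

lemma blift_tensor: "bilin b \<Longrightarrow> blift b (A \<otimes>\<^sub>m B) = b A B"
proof -
  assume b: "bilin b"
  have sm: "b (c \<cdot>\<^sub>C x) y = c \<cdot>\<^sub>C b x y" "b x (c \<cdot>\<^sub>C y) = c \<cdot>\<^sub>C b x y" for c x y
    using b by (simp_all add: bilin_def)
  have "b A B = (\<Sum>i\<in>UNIV. \<Sum>j\<in>UNIV. A $ i $ j \<cdot>\<^sub>C b (matrix_unit i j) B)"
    by (simp only: bilin_sum_left[OF b, symmetric] sm(1)[symmetric] matrix_unit_expansion[symmetric])
  moreover have "b C B = (\<Sum>k\<in>UNIV. \<Sum>l\<in>UNIV. B $ k $ l \<cdot>\<^sub>C b C (matrix_unit k l))" for C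
    by (simp only: bilin_sum_right[OF b, symmetric] sm(2)[symmetric] matrix_unit_expansion[symmetric])
  ultimately have "b A B = (\<Sum>i\<in>UNIV. \<Sum>j\<in>UNIV. A $ i $ j \<cdot>\<^sub>C
      (\<Sum>k\<in>UNIV. \<Sum>l\<in>UNIV. B $ k $ l \<cdot>\<^sub>C b (matrix_unit i j) (matrix_unit k l)))"
    by simp
  then show ?thesis by (simp add: blift_def smat_sum_right)
qed

lemma blift_add [simp]: "blift b (s + t) = blift b s + blift b t"
  by (simp add: blift_def smat_add_left sum.distrib)

lemma blift_smat [simp]: "blift b (c \<cdot>\<^sub>C t) = c \<cdot>\<^sub>C blift b t"
  by (simp add: blift_def smat_sum_right)

lemma blift_zero [simp]: "blift b 0 = 0"
  by (simp add: blift_def)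

lemma blift_sum: "blift b (\<Sum>i\<in>I. t i) = (\<Sum>i\<in>I. blift b (t i))"
  by (induction I rule: infinite_finite_induct) simp_all

text \<open>Every decomposition of t with legs in A and B produces the value of the linear map
  \<open>blift b'\<close> at t, so the description of \<open>tensor_lift\<close> has exactly one
  solution.\<close>

lemma tensor_lift_eq_blift:
  assumes t: "t \<in> alg_tensor A B" and b: "\<And>x y. x \<in> A \<Longrightarrow> y \<in> B \<Longrightarrow> b x y = b' x y" and b': "bilin b'"
  shows "tensor_lift A B b t = blift b' t"
proof -
  have *: "(\<Sum>i<k. b (x i) (y i)) = blift b' (\<Sum>i<k. x i \<otimes>\<^sub>m y i)" if "\<forall>i<k. x i \<in> A \<and> y i \<in> B"
    for k :: nat and x y
    using that b by (simp add: blift_sum blift_tensor[OF b'])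
  show ?thesis
    unfolding tensor_lift_def
  proof (rule the_equality)
    obtain k :: nat and x y where xy: "\<forall>i<k. x i \<in> A \<and> y i \<in> B" "t = (\<Sum>i<k. x i \<otimes>\<^sub>m y i)"
      using t unfolding alg_tensor_def by auto
    then show "\<exists>(k::nat) x y. (\<forall>i<k. x i \<in> A \<and> y i \<in> B) \<and> t = (\<Sum>i<k. x i \<otimes>\<^sub>m y i) \<and> blift b' t = (\<Sum>i<k. b (x i) (y i))"
      by (intro exI[of _ k] exI[of _ x] exI[of _ y]) (simp add: *[OF xy(1)])
  qed (use * in auto)
qed

lemma alg_tensor_add:
  assumes "s \<in> alg_tensor A B" "t \<in> alg_tensor A B" shows "s + t \<in> alg_tensor A B"
proof -
  obtain k :: nat and x y where s: "\<forall>i<k. x i \<in> A \<and> y i \<in> B" "s = (\<Sum>i<k. x i \<otimes>\<^sub>m y i)"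
    using assms(1) unfolding alg_tensor_def by auto
  obtain l :: nat and u v where t: "\<forall>i<l. u i \<in> A \<and> v i \<in> B" "t = (\<Sum>i<l. u i \<otimes>\<^sub>m v i)"
    using assms(2) unfolding alg_tensor_def by auto
  define f where "f i = (if i < k then x i else u (i - k))" for i
  define g where "g i = (if i < k then y i else v (i - k))" for i
  have "(\<Sum>i<k + l. f i \<otimes>\<^sub>m g i) = (\<Sum>i<k. f i \<otimes>\<^sub>m g i) + (\<Sum>i<l. f (k + i) \<otimes>\<^sub>m g (k + i))"
    by (induction l) (simp_all add: add.assoc)
  also have "\<dots> = s + t" by (simp add: f_def g_def s t)
  finally have "s + t = (\<Sum>i<k + l. f i \<otimes>\<^sub>m g i)" by simp
  moreover have "\<forall>i<k + l. f i \<in> A \<and> g i \<in> B" using s t by (auto simp: f_def g_def)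
  ultimately show ?thesis unfolding alg_tensor_def by blast
qed

lemma alg_tensor_elem: "x \<in> A \<Longrightarrow> y \<in> B \<Longrightarrow> x \<otimes>\<^sub>m y \<in> alg_tensor A B"
  unfolding alg_tensor_def by (intro CollectI exI[of _ 1] exI[of _ "\<lambda>_. x"] exI[of _ "\<lambda>_. y"]) auto

lemma alg_tensor_zero: "0 \<in> alg_tensor A B"
  unfolding alg_tensor_def by (intro CollectI exI[of _ 0]) auto

lemma alg_tensor_sum: "(\<And>i. i \<in> I \<Longrightarrow> f i \<in> alg_tensor A B) \<Longrightarrow> (\<Sum>i\<in>I. f i) \<in> alg_tensor A B"
  by (induction I rule: infinite_finite_induct) (auto simp: alg_tensor_zero alg_tensor_add)

lemma alg_tensor_decomp:
  assumes "t \<in> alg_tensor A B"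
  obtains k :: nat and x y where "\<And>i. i < k \<Longrightarrow> x i \<in> A" "\<And>i. i < k \<Longrightarrow> y i \<in> B" "t = (\<Sum>i<k. x i \<otimes>\<^sub>m y i)"
  using assms unfolding alg_tensor_def by blast

lemma alg_tensor_UNIV: "t \<in> alg_tensor UNIV UNIV"
proof -
  have "t = blift (\<otimes>\<^sub>m) t"
  proof -
    have "blift (\<otimes>\<^sub>m) t $ (p, q) $ (r, s) = t $ (p, q) $ (r, s)" for p q r s
    proof -
      have "blift (\<otimes>\<^sub>m) t $ (p, q) $ (r, s) = (\<Sum>i\<in>UNIV. \<Sum>j\<in>UNIV. \<Sum>k\<in>UNIV. \<Sum>l\<in>UNIV.
          if l = s then if k = q then if j = r then if i = p then t $ (p, q) $ (r, s) else 0 else 0 else 0 else 0)"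
        unfolding blift_def sum_component by (intro sum.cong refl) (auto simp: matrix_unit_def)
      then show ?thesis by simp
    qed
    then show ?thesis by (simp add: vec_eq_iff)
  qed
  also have "\<dots> \<in> alg_tensor UNIV UNIV"
    unfolding blift_def
    by (intro alg_tensor_sum) (simp add: alg_tensor_elem flip: tensor_smat_left)
  finally show ?thesis .
qed

text \<open>An identity between linear maps in t may be checked on sums of elementary tensors; the
  rules for slices and for h in one leg are obtained this way.\<close>

lemma tensor_decomp:
  obtains k :: nat and x y where "t = (\<Sum>i<k. x i \<otimes>\<^sub>m y i)"
  using alg_tensor_UNIV[of t] by (elim alg_tensor_decomp)

text \<open>The slice of an ordinary tensor by the functional A \<mapsto> (A \<xi> | \<xi>') in the
  first leg. Two vectors are allowed because the Gram condition is sesquilinear; for \<xi> = \<xi>'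
  it coincides with the relative slice on operators under the range projection.\<close>

definition left_functional :: "complex ^ 'a \<Rightarrow> complex ^ 'a \<Rightarrow> complex ^ ('a \<times> 'b) ^ ('a \<times> 'b) \<Rightarrow> complex ^ 'b ^ 'b" where
  "left_functional \<xi> \<xi>' = blift (\<lambda>A B. cinner (A *v \<xi>) \<xi>' \<cdot>\<^sub>C B)"

definition right_functional :: "complex ^ 'b \<Rightarrow> complex ^ 'b \<Rightarrow> complex ^ ('a \<times> 'b) ^ ('a \<times> 'b) \<Rightarrow> complex ^ 'a ^ 'a" where
  "right_functional \<eta> \<eta>' = blift (\<lambda>A B. cinner (B *v \<eta>) \<eta>' \<cdot>\<^sub>C A)"

lemma left_functional_sum:
  fixes x :: "'i \<Rightarrow> complex ^ 'a ^ 'a" and y :: "'i \<Rightarrow> complex ^ 'b ^ 'b"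
  shows "left_functional \<xi> \<xi>' (\<Sum>i\<in>I. x i \<otimes>\<^sub>m y i) = (\<Sum>i\<in>I. cinner (x i *v \<xi>) \<xi>' \<cdot>\<^sub>C y i)"
proof -
  have "bilin (\<lambda>A (B :: complex ^ 'b ^ 'b). cinner (A *v \<xi>) \<xi>' \<cdot>\<^sub>C B)"
    by (simp add: bilin_def matrix_vector_mult_add_rdistrib cinner_add_left smat_add_left smat_add_right
        smat_mult_vec mult_ac)
  from blift_tensor[OF this] show ?thesis by (simp add: left_functional_def blift_sum)
qed

lemma right_functional_sum:
  fixes x :: "'i \<Rightarrow> complex ^ 'a ^ 'a" and y :: "'i \<Rightarrow> complex ^ 'b ^ 'b"
  shows "right_functional \<eta> \<eta>' (\<Sum>i\<in>I. x i \<otimes>\<^sub>m y i) = (\<Sum>i\<in>I. cinner (y i *v \<eta>) \<eta>' \<cdot>\<^sub>C x i)"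
proof -
  have "bilin (\<lambda>(A :: complex ^ 'a ^ 'a) B. cinner (B *v \<eta>) \<eta>' \<cdot>\<^sub>C A)"
    by (simp add: bilin_def matrix_vector_mult_add_rdistrib cinner_add_left smat_add_left smat_add_right
        smat_mult_vec mult_ac)
  from blift_tensor[OF this] show ?thesis by (simp add: right_functional_def blift_sum)
qed

lemma cinner_tensor_vec: "cinner (\<xi> \<otimes>\<^sub>v \<eta>) (\<xi>' \<otimes>\<^sub>v \<eta>') = cinner \<xi> \<xi>' * cinner \<eta> \<eta>'"
  by (simp add: cinner_def sum_UNIV_prod sum_product mult_ac)

lemma cinner_left_functional:
  "cinner (left_functional \<xi> \<xi>' t *v \<eta>) \<eta>' = cinner (t *v (\<xi> \<otimes>\<^sub>v \<eta>)) (\<xi>' \<otimes>\<^sub>v \<eta>')"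
proof -
  obtain k :: nat and x y where "t = (\<Sum>i<k. x i \<otimes>\<^sub>m y i)" by (rule tensor_decomp)
  then show ?thesis
    by (simp add: left_functional_sum matrix_vec_sum_left cinner_sum_left smat_mult_vec cinner_tensor_vec)
qed

lemma cinner_right_functional:
  "cinner (right_functional \<eta> \<eta>' t *v \<xi>) \<xi>' = cinner (t *v (\<xi> \<otimes>\<^sub>v \<eta>)) (\<xi>' \<otimes>\<^sub>v \<eta>')"
proof -
  obtain k :: nat and x y where "t = (\<Sum>i<k. x i \<otimes>\<^sub>m y i)" by (rule tensor_decomp)
  then show ?thesis
    by (simp add: right_functional_sum matrix_vec_sum_left cinner_sum_left smat_mult_vec cinner_tensor_vec mult.commute)
qed

lemma left_functional_in: "fd_vn_algebra B \<Longrightarrow> t \<in> alg_tensor A B \<Longrightarrow> left_functional \<xi> \<xi>' t \<in> B"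
  by (erule alg_tensor_decomp) (auto simp: left_functional_sum intro!: fd_sum fd_smat)

lemma right_functional_in: "fd_vn_algebra A \<Longrightarrow> t \<in> alg_tensor A B \<Longrightarrow> right_functional \<eta> \<eta>' t \<in> A"
  by (erule alg_tensor_decomp) (auto simp: right_functional_sum intro!: fd_sum fd_smat)

lemma reassoc_tensor [simp]: "reassoc ((A \<otimes>\<^sub>m B) \<otimes>\<^sub>m C) = A \<otimes>\<^sub>m (B \<otimes>\<^sub>m C)"
  by (simp add: reassoc_def vec_eq_iff)

lemma reassoc_sum: "reassoc (\<Sum>i\<in>I. A i) = (\<Sum>i\<in>I. reassoc (A i))"
  by (simp add: reassoc_def vec_eq_iff)

lemma cadj_reassoc: "cadj (reassoc A) = reassoc (cadj A)"
  by (simp add: reassoc_def vec_eq_iff)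


section \<open>Weak Hopf C*-algebras\<close>

locale weak_hopf =
  fixes M :: "(complex ^ 'n ^ 'n) set" and \<Gamma> :: "complex ^ 'n ^ 'n \<Rightarrow> complex ^ ('n \<times> 'n) ^ ('n \<times> 'n)"
    and \<kappa> :: "complex ^ 'n ^ 'n \<Rightarrow> complex ^ 'n ^ 'n" and \<epsilon> :: "complex ^ 'n ^ 'n \<Rightarrow> complex"
  assumes fd: "fd_vn_algebra M"
    and \<Gamma>_lin: "linear_map_on UNIV \<Gamma>" and \<kappa>_lin: "linear_map_on UNIV \<kappa>" and \<epsilon>_lin: "linear_form_on UNIV \<epsilon>"
    and \<Gamma>_in: "\<And>x. x \<in> M \<Longrightarrow> \<Gamma> x \<in> alg_tensor M M"
    and \<Gamma>_mult: "\<And>x y. x \<in> M \<Longrightarrow> y \<in> M \<Longrightarrow> \<Gamma> (x ** y) = \<Gamma> x ** \<Gamma> y"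
    and \<Gamma>_cadj: "\<And>x. x \<in> M \<Longrightarrow> \<Gamma> (cadj x) = cadj (\<Gamma> x)"
    and coassoc: "\<And>x. x \<in> M \<Longrightarrow> reassoc (blift (\<lambda>a b. \<Gamma> a \<otimes>\<^sub>m b) (\<Gamma> x)) = blift (\<lambda>a b. a \<otimes>\<^sub>m \<Gamma> b) (\<Gamma> x)"
    and counit1: "\<And>x. x \<in> M \<Longrightarrow> blift (\<lambda>a b. \<epsilon> a \<cdot>\<^sub>C b) (\<Gamma> x) = x"
    and counit2: "\<And>x. x \<in> M \<Longrightarrow> blift (\<lambda>a b. \<epsilon> b \<cdot>\<^sub>C a) (\<Gamma> x) = x"
    and \<kappa>_M: "\<And>x. x \<in> M \<Longrightarrow> \<kappa> x \<in> M"
    and \<kappa>_mult: "\<And>x y. x \<in> M \<Longrightarrow> y \<in> M \<Longrightarrow> \<kappa> (x ** y) = \<kappa> y ** \<kappa> x"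
    and \<Gamma>_\<kappa>: "\<And>x. x \<in> M \<Longrightarrow> \<Gamma> (\<kappa> x) = blift (\<lambda>a b. \<kappa> b \<otimes>\<^sub>m \<kappa> a) (\<Gamma> x)"
    and \<kappa>_star: "\<And>x. x \<in> M \<Longrightarrow> \<kappa> (cadj (\<kappa> (cadj x))) = x"
    and antipode: "\<And>x. x \<in> M \<Longrightarrow> blift (\<lambda>a b. blift (\<lambda>a b. \<kappa> a ** b) (\<Gamma> a) \<otimes>\<^sub>m b) (\<Gamma> x) = (mat 1 \<otimes>\<^sub>m x) ** \<Gamma> (mat 1)"
begin

lemmas one_M = fd_one[OF fd] and zero_M = fd_zero[OF fd] and add_M = fd_add[OF fd] and mult_M = fd_mult[OF fd]
  and cadj_M = fd_cadj[OF fd] and smat_M = fd_smat[OF fd] and diff_M = fd_diff[OF fd] and sum_M = fd_sum[OF fd]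
lemmas closed_M = one_M zero_M add_M mult_M cadj_M smat_M diff_M \<kappa>_M

lemma \<Gamma>_add: "\<Gamma> (x + y) = \<Gamma> x + \<Gamma> y" and \<Gamma>_smat: "\<Gamma> (c \<cdot>\<^sub>C x) = c \<cdot>\<^sub>C \<Gamma> x"
  using \<Gamma>_lin by (simp_all add: linear_map_on_def)

lemma \<kappa>_add: "\<kappa> (x + y) = \<kappa> x + \<kappa> y" and \<kappa>_smat: "\<kappa> (c \<cdot>\<^sub>C x) = c \<cdot>\<^sub>C \<kappa> x"
  using \<kappa>_lin by (simp_all add: linear_map_on_def)

lemma \<epsilon>_add: "\<epsilon> (x + y) = \<epsilon> x + \<epsilon> y" and \<epsilon>_smat: "\<epsilon> (c \<cdot>\<^sub>C x) = c * \<epsilon> x"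
  using \<epsilon>_lin by (simp_all add: linear_form_on_def)

lemma \<Gamma>_sum: "\<Gamma> (\<Sum>i\<in>I. f i) = (\<Sum>i\<in>I. \<Gamma> (f i))"
  using \<Gamma>_smat[of 0] by (induction I rule: infinite_finite_induct) (simp_all add: \<Gamma>_add)

lemma \<kappa>_sum: "\<kappa> (\<Sum>i\<in>I. f i) = (\<Sum>i\<in>I. \<kappa> (f i))"
  using \<kappa>_smat[of 0] by (induction I rule: infinite_finite_induct) (simp_all add: \<kappa>_add)

definition es :: "complex ^ 'n ^ 'n \<Rightarrow> complex ^ 'n ^ 'n" where
  "es x = blift (\<lambda>a b. \<kappa> a ** b) (\<Gamma> x)"

definition et :: "complex ^ 'n ^ 'n \<Rightarrow> complex ^ 'n ^ 'n" where
  "et x = blift (\<lambda>a b. a ** \<kappa> b) (\<Gamma> x)"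

abbreviation P :: "complex ^ ('n \<times> 'n) ^ ('n \<times> 'n)" where
  "P \<equiv> \<Gamma> (mat 1)"

lemma es_add: "es (x + y) = es x + es y" and es_smat: "es (c \<cdot>\<^sub>C x) = c \<cdot>\<^sub>C es x"
  by (simp_all add: es_def \<Gamma>_add \<Gamma>_smat)

lemma et_add: "et (x + y) = et x + et y" and et_smat: "et (c \<cdot>\<^sub>C x) = c \<cdot>\<^sub>C et x"
  by (simp_all add: et_def \<Gamma>_add \<Gamma>_smat)

lemma es_sum: "es (\<Sum>i\<in>I. f i) = (\<Sum>i\<in>I. es (f i))"
  by (simp add: es_def \<Gamma>_sum blift_sum)

lemma et_sum: "et (\<Sum>i\<in>I. f i) = (\<Sum>i\<in>I. et (f i))"
  by (simp add: et_def \<Gamma>_sum blift_sum)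

lemmas linear_simps = \<Gamma>_add \<Gamma>_smat \<kappa>_add \<kappa>_smat \<epsilon>_add \<epsilon>_smat es_add es_smat et_add et_smat
  matrix_add_ldistrib matrix_add_rdistrib_complex tensor_add_left tensor_add_right smat_add_left smat_add_right

lemma blift_tensors:
  "blift (\<lambda>a b. \<kappa> a ** b) (A \<otimes>\<^sub>m B) = \<kappa> A ** B"
  "blift (\<lambda>a b. a ** \<kappa> b) (A \<otimes>\<^sub>m B) = A ** \<kappa> B"
  "blift (\<lambda>a b. \<Gamma> a \<otimes>\<^sub>m b) (A \<otimes>\<^sub>m C) = \<Gamma> A \<otimes>\<^sub>m C"
  "blift (\<lambda>a b. a \<otimes>\<^sub>m \<Gamma> b) (C \<otimes>\<^sub>m B) = C \<otimes>\<^sub>m \<Gamma> B"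
  "blift (\<lambda>a b. \<epsilon> a \<cdot>\<^sub>C b) (A \<otimes>\<^sub>m C) = \<epsilon> A \<cdot>\<^sub>C C"
  "blift (\<lambda>a b. \<epsilon> b \<cdot>\<^sub>C a) (C \<otimes>\<^sub>m B) = \<epsilon> B \<cdot>\<^sub>C C"
  "blift (\<lambda>a b. \<epsilon> (a ** y) \<cdot>\<^sub>C b) (A \<otimes>\<^sub>m C) = \<epsilon> (A ** y) \<cdot>\<^sub>C C"
  "blift (\<lambda>a b. \<epsilon> (y ** b) \<cdot>\<^sub>C a) (C \<otimes>\<^sub>m B) = \<epsilon> (y ** B) \<cdot>\<^sub>C C"
  "blift (\<lambda>a b. \<kappa> b \<otimes>\<^sub>m \<kappa> a) (A \<otimes>\<^sub>m B) = \<kappa> B \<otimes>\<^sub>m \<kappa> A"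
  "blift (\<lambda>a b. es a \<otimes>\<^sub>m b) (A \<otimes>\<^sub>m C) = es A \<otimes>\<^sub>m C"
  "blift (\<lambda>a b. a \<otimes>\<^sub>m et b) (C \<otimes>\<^sub>m B) = C \<otimes>\<^sub>m et B"
  "blift (\<lambda>a b. a \<otimes>\<^sub>m blift (\<lambda>a b. a \<otimes>\<^sub>m et b) b) (C \<otimes>\<^sub>m t) = C \<otimes>\<^sub>m blift (\<lambda>a b. a \<otimes>\<^sub>m et b) t"
  by (subst blift_tensor; simp add: bilin_def linear_simps mult_ac)+

lemmas sum_simps = blift_sum blift_tensors \<Gamma>_sum \<kappa>_sum es_sum et_sum matrix_mult_sum_left matrix_mult_sum_right
  tensor_sum_left tensor_sum_right smat_sum_right

lemma \<Gamma>_decomp: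
  assumes "x \<in> M"
  obtains k :: nat and a b where "\<And>i. i < k \<Longrightarrow> a i \<in> M" "\<And>i. i < k \<Longrightarrow> b i \<in> M" "\<Gamma> x = (\<Sum>i<k. a i \<otimes>\<^sub>m b i)"
  using \<Gamma>_in[OF assms] that by (rule alg_tensor_decomp)

lemma P_idem: "P ** P = P"
  using \<Gamma>_mult[OF one_M one_M] by simp

lemma P_sa: "cadj P = P"
  using \<Gamma>_cadj[OF one_M] by simp

lemma \<Gamma>_P: "x \<in> M \<Longrightarrow> \<Gamma> x ** P = \<Gamma> x" and P_\<Gamma>: "x \<in> M \<Longrightarrow> P ** \<Gamma> x = \<Gamma> x"
  using \<Gamma>_mult[of x "mat 1"] \<Gamma>_mult[of "mat 1" x] one_M by simp_all

text \<open>Since \<kappa> composed with the adjoint is an involution, the adjoint of \<kappa>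
  (\<open>cadj y\<close>) is a preimage of y.\<close>

lemma \<kappa>_surj:
  assumes "y \<in> M" obtains x where "x \<in> M" "\<kappa> x = y"
  using \<kappa>_star[OF assms] cadj_M[OF \<kappa>_M[OF cadj_M[OF assms]]] by blast

lemma \<kappa>_inj:
  assumes "x \<in> M" "y \<in> M" "\<kappa> x = \<kappa> y" shows "x = y"
  using \<kappa>_star[of "cadj x"] \<kappa>_star[of "cadj y"] assms by (metis cadj_M cadj_cadj)

lemma \<kappa>_one: "\<kappa> (mat 1) = mat 1"
proof -
  obtain x where x: "x \<in> M" "\<kappa> x = mat 1" using \<kappa>_surj[OF one_M] .
  have "\<kappa> (mat 1 ** x) = \<kappa> x ** \<kappa> (mat 1)" using x one_M by (intro \<kappa>_mult)
  then show ?thesis by (simp add: x)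
qed

lemma et_M: assumes "x \<in> M" shows "et x \<in> M"
  using assms by (rule \<Gamma>_decomp) (auto simp: et_def sum_simps intro!: sum_M mult_M \<kappa>_M)

text \<open>\<Gamma> after \<kappa> flips the legs and \<kappa> reverses products; together these
  exchange the two counital maps.\<close>

lemma et_\<kappa>: assumes "a \<in> M" shows "et (\<kappa> a) = \<kappa> (es a)"
  using assms by (rule \<Gamma>_decomp) (simp add: et_def es_def \<Gamma>_\<kappa>[OF assms] sum_simps \<kappa>_mult closed_M)

lemma es_\<kappa>: assumes "a \<in> M" shows "es (\<kappa> a) = \<kappa> (et a)"
  using assms by (rule \<Gamma>_decomp) (simp add: et_def es_def \<Gamma>_\<kappa>[OF assms] sum_simps \<kappa>_mult closed_M)

lemma es_\<Gamma>: "x \<in> M \<Longrightarrow> blift (\<lambda>a b. es a \<otimes>\<^sub>m b) (\<Gamma> x) = (mat 1 \<otimes>\<^sub>m x) ** P"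
  using antipode by (simp add: es_def)

text \<open>The image of the previous identity under \<open>\<kappa> \<otimes> \<kappa>\<close> followed by the flip.\<close>

lemma et_\<Gamma>:
  assumes y: "y \<in> M"
  shows "blift (\<lambda>a b. a \<otimes>\<^sub>m et b) (\<Gamma> y) = P ** (y \<otimes>\<^sub>m mat 1)"
proof -
  obtain x where x: "x \<in> M" "\<kappa> x = y" using \<kappa>_surj[OF y] .
  obtain k :: nat and a b where ab: "\<And>i. i < k \<Longrightarrow> a i \<in> M" "\<And>i. i < k \<Longrightarrow> b i \<in> M"
    "\<Gamma> x = (\<Sum>i<k. a i \<otimes>\<^sub>m b i)" using \<Gamma>_decomp[OF x(1)] by blast
  obtain l :: nat and p q where pq: "\<And>i. i < l \<Longrightarrow> p i \<in> M" "\<And>i. i < l \<Longrightarrow> q i \<in> M"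
    "P = (\<Sum>i<l. p i \<otimes>\<^sub>m q i)" using \<Gamma>_decomp[OF one_M] by blast
  have "blift (\<lambda>a b. a \<otimes>\<^sub>m et b) (\<Gamma> (\<kappa> x)) = (\<Sum>i<k. \<kappa> (b i) \<otimes>\<^sub>m \<kappa> (es (a i)))"
    by (simp add: \<Gamma>_\<kappa>[OF x(1)] ab sum_simps et_\<kappa>)
  also have "\<dots> = blift (\<lambda>a b. \<kappa> b \<otimes>\<^sub>m \<kappa> a) (blift (\<lambda>a b. es a \<otimes>\<^sub>m b) (\<Gamma> x))"
    by (simp add: ab sum_simps)
  also have "\<dots> = blift (\<lambda>a b. \<kappa> b \<otimes>\<^sub>m \<kappa> a) (\<Sum>i<l. p i \<otimes>\<^sub>m (x ** q i))"
    by (simp add: es_\<Gamma> x pq sum_simps)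
  also have "\<dots> = (\<Sum>i<l. \<kappa> (q i) \<otimes>\<^sub>m \<kappa> (p i)) ** (y \<otimes>\<^sub>m mat 1)"
    using pq x by (simp add: sum_simps \<kappa>_mult)
  also have "(\<Sum>i<l. \<kappa> (q i) \<otimes>\<^sub>m \<kappa> (p i)) = P"
    using \<Gamma>_\<kappa>[OF one_M] by (simp add: \<kappa>_one pq(3) sum_simps)
  finally show ?thesis by (simp add: x)
qed

lemma P_et: "blift (\<lambda>a b. a \<otimes>\<^sub>m et b) P = P"
  using et_\<Gamma>[OF one_M] by simp

lemma P_es: "blift (\<lambda>a b. es a \<otimes>\<^sub>m b) P = P"
  using es_\<Gamma>[OF one_M] by simp

text \<open>Apply id \<otimes> \<epsilon> to (\<epsilon>_s \<otimes> id) \<Gamma>(x) = (1 \<otimes>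
  x) P; the counit collapses the left side to \<epsilon>_s(x). Elements of \<epsilon>_s(M) are thus
  slices of P with values in its first leg.\<close>

lemma es_formula:
  assumes x: "x \<in> M" shows "es x = blift (\<lambda>a b. \<epsilon> (x ** b) \<cdot>\<^sub>C a) P"
proof -
  obtain k :: nat and a b where ab: "\<And>i. i < k \<Longrightarrow> a i \<in> M" "\<And>i. i < k \<Longrightarrow> b i \<in> M"
    "\<Gamma> x = (\<Sum>i<k. a i \<otimes>\<^sub>m b i)" using \<Gamma>_decomp[OF x(1)] by blast
  have "es x = es (\<Sum>i<k. \<epsilon> (b i) \<cdot>\<^sub>C a i)" using counit2[OF x] by (simp add: ab sum_simps)
  also have "\<dots> = blift (\<lambda>a b. \<epsilon> b \<cdot>\<^sub>C a) (blift (\<lambda>a b. es a \<otimes>\<^sub>m b) (\<Gamma> x))"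
    by (simp add: ab sum_simps es_smat)
  also have "\<dots> = blift (\<lambda>a b. \<epsilon> b \<cdot>\<^sub>C a) ((mat 1 \<otimes>\<^sub>m x) ** P)" by (simp add: es_\<Gamma>[OF x])
  also have "\<dots> = blift (\<lambda>a b. \<epsilon> (x ** b) \<cdot>\<^sub>C a) P"
    by (rule \<Gamma>_decomp[OF one_M]) (simp add: sum_simps)
  finally show ?thesis .
qed

text \<open>The mirror image: \<epsilon>_t(x) is what remains in the second leg of P after slicing
  by \<epsilon>(\<cdot> x).\<close>

lemma et_formula:
  assumes x: "x \<in> M" shows "et x = blift (\<lambda>a b. \<epsilon> (a ** x) \<cdot>\<^sub>C b) P"
proof -
  obtain k :: nat and a b where ab: "\<And>i. i < k \<Longrightarrow> a i \<in> M" "\<And>i. i < k \<Longrightarrow> b i \<in> M"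
    "\<Gamma> x = (\<Sum>i<k. a i \<otimes>\<^sub>m b i)" using \<Gamma>_decomp[OF x(1)] by blast
  have "et x = et (\<Sum>i<k. \<epsilon> (a i) \<cdot>\<^sub>C b i)" using counit1[OF x] by (simp add: ab sum_simps)
  also have "\<dots> = blift (\<lambda>a b. \<epsilon> a \<cdot>\<^sub>C b) (blift (\<lambda>a b. a \<otimes>\<^sub>m et b) (\<Gamma> x))"
    by (simp add: ab sum_simps et_smat)
  also have "\<dots> = blift (\<lambda>a b. \<epsilon> a \<cdot>\<^sub>C b) (P ** (x \<otimes>\<^sub>m mat 1))" by (simp add: et_\<Gamma>[OF x])
  also have "\<dots> = blift (\<lambda>a b. \<epsilon> (a ** x) \<cdot>\<^sub>C b) P"
    by (rule \<Gamma>_decomp[OF one_M]) (simp add: sum_simps)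
  finally show ?thesis .
qed

text \<open>Apply \<open>id \<otimes> id \<otimes> \<epsilon>\<^sub>t\<close> to both sides of coassociativity at the unit; the adjoint identity shows
  that the two copies of \<open>\<Gamma>(1)\<close> commute.\<close>

lemma id_\<Gamma>_P: "blift (\<lambda>a b. a \<otimes>\<^sub>m \<Gamma> b) P = (mat 1 \<otimes>\<^sub>m P) ** reassoc (P \<otimes>\<^sub>m mat 1)"
  and id_\<Gamma>_P': "blift (\<lambda>a b. a \<otimes>\<^sub>m \<Gamma> b) P = reassoc (P \<otimes>\<^sub>m mat 1) ** (mat 1 \<otimes>\<^sub>m P)"
proof -
  let ?J = "blift (\<lambda>a b. a \<otimes>\<^sub>m blift (\<lambda>a b. a \<otimes>\<^sub>m et b) b)"
  obtain l :: nat and p q where pq: "\<And>i. i < l \<Longrightarrow> p i \<in> M" "\<And>i. i < l \<Longrightarrow> q i \<in> M"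
    "P = (\<Sum>i<l. p i \<otimes>\<^sub>m q i)" using \<Gamma>_decomp[OF one_M] by blast
  have J: "?J (reassoc (t \<otimes>\<^sub>m c)) = reassoc (t \<otimes>\<^sub>m et c)" for t :: "complex ^ ('n \<times> 'n) ^ ('n \<times> 'n)" and c
    by (rule tensor_decomp[of t]) (simp add: sum_simps reassoc_sum)
  have "blift (\<lambda>a b. a \<otimes>\<^sub>m \<Gamma> b) P = reassoc (blift (\<lambda>a b. \<Gamma> a \<otimes>\<^sub>m b) (blift (\<lambda>a b. a \<otimes>\<^sub>m et b) P))"
    by (simp add: P_et coassoc[OF one_M])
  also have "\<dots> = ?J (reassoc (blift (\<lambda>a b. \<Gamma> a \<otimes>\<^sub>m b) P))"
    by (simp add: pq(3) sum_simps reassoc_sum J)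
  also have "\<dots> = ?J (blift (\<lambda>a b. a \<otimes>\<^sub>m \<Gamma> b) P)" by (simp add: coassoc[OF one_M])
  also have "\<dots> = ?J (\<Sum>i<l. p i \<otimes>\<^sub>m \<Gamma> (q i))"
    by (simp add: pq(3) sum_simps)
  also have "\<dots> = (\<Sum>i<l. p i \<otimes>\<^sub>m (P ** (q i \<otimes>\<^sub>m mat 1)))"
    by (simp add: blift_sum blift_tensors et_\<Gamma> pq(2))
  also have "\<dots> = (mat 1 \<otimes>\<^sub>m P) ** (\<Sum>i<l. p i \<otimes>\<^sub>m (q i \<otimes>\<^sub>m mat 1))"
    by (simp add: matrix_mult_sum_right)
  also have "(\<Sum>i<l. p i \<otimes>\<^sub>m (q i \<otimes>\<^sub>m mat 1)) = reassoc (P \<otimes>\<^sub>m mat 1)"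
    by (simp add: pq(3) tensor_sum_left reassoc_sum)
  finally show 1: "blift (\<lambda>a b. a \<otimes>\<^sub>m \<Gamma> b) P = (mat 1 \<otimes>\<^sub>m P) ** reassoc (P \<otimes>\<^sub>m mat 1)" .
  have "cadj (blift (\<lambda>a b. a \<otimes>\<^sub>m \<Gamma> b) P) = blift (\<lambda>a b. a \<otimes>\<^sub>m \<Gamma> b) (cadj P)"
    by (simp only: pq(3)) (simp add: cadj_sum sum_simps \<Gamma>_cadj pq(2))
  then show "blift (\<lambda>a b. a \<otimes>\<^sub>m \<Gamma> b) P = reassoc (P \<otimes>\<^sub>m mat 1) ** (mat 1 \<otimes>\<^sub>m P)"
    using arg_cong[OF 1, of cadj] by (simp add: P_sa cadj_reassoc)
qed

end

section \<open>The range subalgebra N, its image under \<kappa>, and their position relative to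
  P\<close>

context weak_hopf
begin

definition N :: "(complex ^ 'n ^ 'n) set" where "N = et ` M"

lemma N_M: "n \<in> N \<Longrightarrow> n \<in> M"
  by (auto simp: N_def et_M)

text \<open>Slice the first leg of both product formulas for (id \<otimes> \<Gamma>)(P) by
  \<epsilon>(\<cdot> y). The factor 1 \<otimes> P passes through the slice, and P \<otimes> 1
  becomes \<epsilon>_t(y) \<otimes> 1.\<close>

lemma \<Gamma>_et:
  assumes y: "y \<in> M"
  shows "\<Gamma> (et y) = P ** (et y \<otimes>\<^sub>m mat 1)" and "\<Gamma> (et y) = (et y \<otimes>\<^sub>m mat 1) ** P"
proof -
  let ?S = "blift (\<lambda>a (b :: complex ^ ('n \<times> 'n) ^ ('n \<times> 'n)). \<epsilon> (a ** y) \<cdot>\<^sub>C b)"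
  obtain l :: nat and p q where pq: "\<And>i. i < l \<Longrightarrow> p i \<in> M" "\<And>i. i < l \<Longrightarrow> q i \<in> M"
    "P = (\<Sum>i<l. p i \<otimes>\<^sub>m q i)" using \<Gamma>_decomp[OF one_M] by blast
  have et: "et y = (\<Sum>i<l. \<epsilon> (p i ** y) \<cdot>\<^sub>C q i)"
    by (simp add: et_formula[OF y] pq(3) sum_simps)
  have S: "\<Gamma> (et y) = ?S (blift (\<lambda>a b. a \<otimes>\<^sub>m \<Gamma> b) P)"
    by (simp add: et pq(3) sum_simps \<Gamma>_smat)
  have S1: "?S (reassoc (P \<otimes>\<^sub>m mat 1)) = et y \<otimes>\<^sub>m mat 1"
    by (simp add: et pq(3) sum_simps reassoc_sum)
  have "?S ((mat 1 \<otimes>\<^sub>m P) ** t) = P ** ?S t" for t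
    by (rule tensor_decomp[of t]) (simp add: blift_sum blift_tensors matrix_mult_sum_right)
  then show "\<Gamma> (et y) = P ** (et y \<otimes>\<^sub>m mat 1)" by (simp add: S id_\<Gamma>_P S1)
  have "?S (t ** (mat 1 \<otimes>\<^sub>m P)) = ?S t ** P" for t
    by (rule tensor_decomp[of t]) (simp add: blift_sum blift_tensors matrix_mult_sum_left)
  then show "\<Gamma> (et y) = (et y \<otimes>\<^sub>m mat 1) ** P" by (simp add: S id_\<Gamma>_P' S1)
qed

lemma \<Gamma>_N: assumes "n \<in> N" shows "\<Gamma> n = P ** (n \<otimes>\<^sub>m mat 1)" "\<Gamma> n = (n \<otimes>\<^sub>m mat 1) ** P"
  using assms \<Gamma>_et by (auto simp: N_def)

text \<open>Conversely, \<epsilon> \<otimes> id applied to \<Gamma>(n) = P (n \<otimes> 1) gives n =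
  \<epsilon>_t(n). This equational test is what makes closure of N under products and adjoints
  accessible.\<close>

lemma N_I:
  assumes n: "n \<in> M" "\<Gamma> n = P ** (n \<otimes>\<^sub>m mat 1)" shows "n \<in> N"
proof -
  have "n = blift (\<lambda>a b. \<epsilon> a \<cdot>\<^sub>C b) (P ** (n \<otimes>\<^sub>m mat 1))" using counit1[OF n(1)] n(2) by simp
  also have "\<dots> = blift (\<lambda>a b. \<epsilon> (a ** n) \<cdot>\<^sub>C b) P"
    by (rule \<Gamma>_decomp[OF one_M]) (simp add: sum_simps)
  also have "\<dots> = et n" by (simp add: et_formula n)
  finally show ?thesis using n by (auto simp: N_def)
qed

lemma fd_N: "fd_vn_algebra N"
proof -
  have "mat 1 \<in> N" by (rule N_I) (simp_all add: one_M)
  moreover have "x + y \<in> N" if "x \<in> N" "y \<in> N" for x y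
    using that N_M by (intro N_I) (simp_all add: closed_M linear_simps \<Gamma>_N(1))
  moreover have "x ** y \<in> N" if xy: "x \<in> N" "y \<in> N" for x y
  proof (rule N_I)
    have "\<Gamma> (x ** y) = (x \<otimes>\<^sub>m mat 1) ** (P ** P) ** (y \<otimes>\<^sub>m mat 1)"
      using xy N_M by (simp add: \<Gamma>_mult \<Gamma>_N(1)[of y] \<Gamma>_N(2)[of x] matrix_mul_assoc)
    also have "\<dots> = P ** (x \<otimes>\<^sub>m mat 1) ** (y \<otimes>\<^sub>m mat 1)"
      using \<Gamma>_N[OF xy(1)] by (simp add: P_idem)
    finally show "\<Gamma> (x ** y) = P ** ((x ** y) \<otimes>\<^sub>m mat 1)" by (simp add: matrix_mul_assoc[symmetric])
  qed (use xy N_M mult_M in auto)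
  moreover have "cadj x \<in> N" if x: "x \<in> N" for x
  proof (rule N_I)
    show "\<Gamma> (cadj x) = P ** (cadj x \<otimes>\<^sub>m mat 1)"
      using x N_M by (simp add: \<Gamma>_cadj \<Gamma>_N(2) P_sa)
  qed (use x N_M cadj_M in auto)
  moreover have "c \<cdot>\<^sub>C x \<in> N" if "x \<in> N" for c x
    using that N_M by (intro N_I) (simp_all add: closed_M linear_simps \<Gamma>_N(1))
  ultimately show ?thesis by (simp add: fd_vn_algebra_def)
qed

text \<open>The second leg of P is fixed by \<epsilon>_t. Consequently slicing the first leg of P
  always produces an element of N.\<close>

lemma P_in: "P \<in> alg_tensor M N"
proof -
  obtain l :: nat and p q where pq: "\<And>i. i < l \<Longrightarrow> p i \<in> M" "\<And>i. i < l \<Longrightarrow> q i \<in> M"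
    "P = (\<Sum>i<l. p i \<otimes>\<^sub>m q i)" using \<Gamma>_decomp[OF one_M] by blast
  have "P = (\<Sum>i<l. p i \<otimes>\<^sub>m et (q i))" using P_et by (simp add: pq(3) sum_simps)
  then show ?thesis using pq by (auto simp: N_def intro!: alg_tensor_sum alg_tensor_elem)
qed

lemma flip_P: "blift (\<lambda>a b. \<kappa> b \<otimes>\<^sub>m \<kappa> a) P = P"
  using \<Gamma>_\<kappa>[OF one_M] by (simp add: \<kappa>_one)

lemma \<Gamma>_\<kappa>_N:
  assumes n: "n \<in> N" shows "\<Gamma> (\<kappa> n) = P ** (mat 1 \<otimes>\<^sub>m \<kappa> n)" "\<Gamma> (\<kappa> n) = (mat 1 \<otimes>\<^sub>m \<kappa> n) ** P"
proof -
  obtain l :: nat and p q where pq: "\<And>i. i < l \<Longrightarrow> p i \<in> M" "\<And>i. i < l \<Longrightarrow> q i \<in> M"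
    "P = (\<Sum>i<l. p i \<otimes>\<^sub>m q i)" using \<Gamma>_decomp[OF one_M] by blast
  have fl: "(\<Sum>i<l. \<kappa> (q i) \<otimes>\<^sub>m \<kappa> (p i)) = P" using flip_P by (simp add: pq(3) sum_simps)
  have "\<Gamma> (\<kappa> n) = (\<Sum>i<l. \<kappa> (q i) \<otimes>\<^sub>m \<kappa> (p i)) ** (mat 1 \<otimes>\<^sub>m \<kappa> n)"
    using n N_M pq by (simp add: \<Gamma>_\<kappa> \<Gamma>_N(2) sum_simps \<kappa>_mult)
  then show "\<Gamma> (\<kappa> n) = P ** (mat 1 \<otimes>\<^sub>m \<kappa> n)" by (simp only: fl)
  have "\<Gamma> (\<kappa> n) = (mat 1 \<otimes>\<^sub>m \<kappa> n) ** (\<Sum>i<l. \<kappa> (q i) \<otimes>\<^sub>m \<kappa> (p i))"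
    using n N_M pq by (simp add: \<Gamma>_\<kappa> \<Gamma>_N(1) sum_simps \<kappa>_mult)
  then show "\<Gamma> (\<kappa> n) = (mat 1 \<otimes>\<^sub>m \<kappa> n) ** P" by (simp only: fl)
qed

text \<open>\<kappa>(m) = \<epsilon>_s(\<kappa>(a)) is a slice of P with values in the first leg,
  and there left and right multiplication of P by n agree.\<close>

lemma N_commutes:
  assumes n: "n \<in> N" and m: "m \<in> N" shows "n ** \<kappa> m = \<kappa> m ** n"
proof -
  obtain a where a: "a \<in> M" "m = et a" using m by (auto simp: N_def)
  obtain l :: nat and p q where pq: "\<And>i. i < l \<Longrightarrow> p i \<in> M" "\<And>i. i < l \<Longrightarrow> q i \<in> M"
    "P = (\<Sum>i<l. p i \<otimes>\<^sub>m q i)" using \<Gamma>_decomp[OF one_M] by blast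
  have k: "\<kappa> m = (\<Sum>i<l. \<epsilon> (\<kappa> a ** q i) \<cdot>\<^sub>C p i)"
    using a es_formula[of "\<kappa> a"] by (simp add: es_\<kappa> closed_M pq(3) sum_simps)
  have "blift (\<lambda>c b. \<epsilon> (\<kappa> a ** b) \<cdot>\<^sub>C c) (P ** (n \<otimes>\<^sub>m mat 1)) = blift (\<lambda>c b. \<epsilon> (\<kappa> a ** b) \<cdot>\<^sub>C c) ((n \<otimes>\<^sub>m mat 1) ** P)"
    using \<Gamma>_N[OF n] by simp
  then show ?thesis by (simp add: k pq(3) sum_simps)
qed

text \<open>From \<Gamma>(y n) = \<Gamma>(y) (n \<otimes> 1) one gets \<epsilon>_s(y n) =
  \<kappa>(n) \<epsilon>_s(y). Now apply \<epsilon>_s \<otimes> id to \<Gamma>(n) = P (n \<otimes>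
  1): the left side becomes (1 \<otimes> n) P, and the right side (\<kappa>(n) \<otimes> 1) P
  because (\<epsilon>_s \<otimes> id)(P) = P.\<close>

lemma P_shift:
  assumes n: "n \<in> N" shows "(mat 1 \<otimes>\<^sub>m n) ** P = (\<kappa> n \<otimes>\<^sub>m mat 1) ** P"
proof -
  obtain l :: nat and p q where pq: "\<And>i. i < l \<Longrightarrow> p i \<in> M" "\<And>i. i < l \<Longrightarrow> q i \<in> M"
    "P = (\<Sum>i<l. p i \<otimes>\<^sub>m q i)" using \<Gamma>_decomp[OF one_M] by blast
  have es: "es (y ** n) = \<kappa> n ** es y" if y: "y \<in> M" for y
  proof -
    obtain k :: nat and a b where ab: "\<And>i. i < k \<Longrightarrow> a i \<in> M" "\<And>i. i < k \<Longrightarrow> b i \<in> M"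
      "\<Gamma> y = (\<Sum>i<k. a i \<otimes>\<^sub>m b i)" using \<Gamma>_decomp[OF y] by blast
    have "\<Gamma> (y ** n) = \<Gamma> y ** P ** (n \<otimes>\<^sub>m mat 1)"
      using y n N_M by (simp add: \<Gamma>_mult \<Gamma>_N(1) matrix_mul_assoc)
    also have "\<dots> = \<Gamma> y ** (n \<otimes>\<^sub>m mat 1)" using y by (simp add: \<Gamma>_P)
    also have "\<dots> = (\<Sum>i<k. (a i ** n) \<otimes>\<^sub>m b i)" by (simp add: ab(3) sum_simps)
    finally have "es (y ** n) = (\<Sum>i<k. \<kappa> n ** \<kappa> (a i) ** b i)"
      using ab n N_M by (simp add: es_def sum_simps \<kappa>_mult)
    then show ?thesis by (simp add: es_def ab(3) sum_simps matrix_mul_assoc)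
  qed
  have "(mat 1 \<otimes>\<^sub>m n) ** P = blift (\<lambda>a b. es a \<otimes>\<^sub>m b) (P ** (n \<otimes>\<^sub>m mat 1))"
    using n N_M by (simp add: es_\<Gamma>[symmetric] \<Gamma>_N(1))
  also have "\<dots> = (\<kappa> n \<otimes>\<^sub>m mat 1) ** blift (\<lambda>a b. es a \<otimes>\<^sub>m b) P"
    by (simp add: pq sum_simps es)
  finally show ?thesis by (simp add: P_es)
qed

end

section \<open>The Haar measure: trace on N, conditional expectations, invariance\<close>

locale haar_weak_hopf = weak_hopf M \<Gamma> \<kappa> \<epsilon>
  for M :: "(complex ^ 'n ^ 'n) set" and \<Gamma> \<kappa> \<epsilon> +
  fixes h :: "complex ^ 'n ^ 'n \<Rightarrow> complex"
  assumes \<kappa>_\<kappa>: "\<And>n. n \<in> N \<Longrightarrow> \<kappa> (\<kappa> n) = n"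
    and h_lin: "linear_form_on UNIV h"
    and h_nsf: "nsf_weight M h"
    and h_\<kappa>: "\<And>x. x \<in> M \<Longrightarrow> h (\<kappa> x) = h x"
    and h_normalized: "blift (\<lambda>a b. h b \<cdot>\<^sub>C a) P = mat 1"
    and h_invariant: "\<And>x y. x \<in> M \<Longrightarrow> y \<in> M \<Longrightarrow> blift (\<lambda>a b. h b \<cdot>\<^sub>C a) ((mat 1 \<otimes>\<^sub>m y) ** \<Gamma> x)
        = \<kappa> (blift (\<lambda>a b. h b \<cdot>\<^sub>C a) (\<Gamma> y ** (mat 1 \<otimes>\<^sub>m x)))"
begin

sublocale haar: weighted_algebra M h
  by unfold_locales (rule fd, rule h_nsf)

lemma h_add: "h (x + y) = h x + h y" and h_smat: "h (c \<cdot>\<^sub>C x) = c * h x"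
  using h_lin by (simp_all add: linear_form_on_def)

lemma h_sum: "h (\<Sum>i\<in>I. f i) = (\<Sum>i\<in>I. h (f i))"
  using h_smat[of 0] by (induction I rule: infinite_finite_induct) (simp_all add: h_add)

text \<open>\<open>hr\<close> is id \<otimes> h and \<open>hl\<close> is h \<otimes> id. The
  remaining leg has a type of its own, since \<open>hl\<close> is also applied when that leg is a
  tensor square.\<close>

definition hr :: "complex ^ ('a \<times> 'n) ^ ('a \<times> 'n) \<Rightarrow> complex ^ 'a ^ 'a" where
  "hr = blift (\<lambda>a b. h b \<cdot>\<^sub>C a)"

definition hl :: "complex ^ ('n \<times> 'a) ^ ('n \<times> 'a) \<Rightarrow> complex ^ 'a ^ 'a" where
  "hl = blift (\<lambda>a b. h a \<cdot>\<^sub>C b)"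

lemma hr_tensor [simp]: "hr (A \<otimes>\<^sub>m B) = h B \<cdot>\<^sub>C A"
  unfolding hr_def by (subst blift_tensor) (simp_all add: bilin_def h_add h_smat linear_simps mult_ac)

lemma hl_tensor [simp]: "hl (A \<otimes>\<^sub>m B) = h A \<cdot>\<^sub>C B"
  unfolding hl_def by (subst blift_tensor) (simp_all add: bilin_def h_add h_smat linear_simps mult_ac)

lemma hr_sum: "hr (\<Sum>i\<in>I. t i) = (\<Sum>i\<in>I. hr (t i))"
  by (simp add: hr_def blift_sum)

lemma hl_sum: "hl (\<Sum>i\<in>I. t i) = (\<Sum>i\<in>I. hl (t i))"
  by (simp add: hl_def blift_sum)

definition Et :: "complex ^ 'n ^ 'n \<Rightarrow> complex ^ 'n ^ 'n" where "Et x = hr (\<Gamma> x)"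

definition Es :: "complex ^ 'n ^ 'n \<Rightarrow> complex ^ 'n ^ 'n" where "Es x = hl (\<Gamma> x)"

lemma E_add: "Et (x + y) = Et x + Et y" "Es (x + y) = Es x + Es y"
  and E_smat: "Et (c \<cdot>\<^sub>C x) = c \<cdot>\<^sub>C Et x" "Es (c \<cdot>\<^sub>C x) = c \<cdot>\<^sub>C Es x"
  by (simp_all add: Et_def Es_def hr_def hl_def \<Gamma>_add \<Gamma>_smat)

lemma E_sum: "Et (\<Sum>i\<in>I. f i) = (\<Sum>i\<in>I. Et (f i))" "Es (\<Sum>i\<in>I. f i) = (\<Sum>i\<in>I. Es (f i))"
  by (simp_all add: Et_def Es_def hr_sum hl_sum \<Gamma>_sum)

lemmas h_sum_simps = sum_simps hr_sum hl_sum h_sum h_smat E_sum E_smat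

lemma hr_M: "t \<in> alg_tensor M M \<Longrightarrow> hr t \<in> M"
  by (erule alg_tensor_decomp) (auto simp: h_sum_simps intro!: sum_M smat_M)

lemma Et_M: "x \<in> M \<Longrightarrow> Et x \<in> M"
  by (simp add: Et_def hr_M \<Gamma>_in)

text \<open>By \<kappa>^2 = id on N the involution law reads \<kappa>
  (\<open>cadj (\<kappa> (cadj n))\<close>) = \<kappa> (\<kappa> n), and injectivity cancels the
  outer \<kappa>.\<close>

lemma \<kappa>_cadj:
  assumes n: "n \<in> N" shows "\<kappa> (cadj n) = cadj (\<kappa> n)"
proof -
  have nM: "n \<in> M" using n N_M by blast
  have "\<kappa> (cadj (\<kappa> (cadj n))) = \<kappa> (\<kappa> n)" by (simp add: \<kappa>_star nM \<kappa>_\<kappa> n)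
  then have "cadj (\<kappa> (cadj n)) = \<kappa> n" by (rule \<kappa>_inj[rotated 2]) (simp_all add: closed_M nM)
  then show ?thesis by (metis cadj_cadj)
qed

text \<open>The adjoint of the previous shift, taken at \<open>cadj n\<close>; moving \<kappa>
  through the adjoint is where \<kappa>^2 = id enters.\<close>

lemma P_shift':
  assumes n: "n \<in> N" shows "P ** (mat 1 \<otimes>\<^sub>m n) = P ** (\<kappa> n \<otimes>\<^sub>m mat 1)"
proof -
  have "cadj n \<in> N" using n fd_cadj fd_N by blast
  from arg_cong[OF P_shift[OF this], of cadj] show ?thesis by (simp add: P_sa \<kappa>_cadj n)
qed

lemma hr_P: "hr P = mat 1"
  by (simp add: hr_def h_normalized)

lemma hr_mult_left: "hr ((a \<otimes>\<^sub>m mat 1) ** t) = a ** hr t"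
  by (rule tensor_decomp[of t]) (simp add: h_sum_simps)

lemma hr_mult_right: "hr (t ** (a \<otimes>\<^sub>m mat 1)) = hr t ** a"
  by (rule tensor_decomp[of t]) (simp add: h_sum_simps)

lemma hl_mult_left: "hl ((mat 1 \<otimes>\<^sub>m a) ** t) = a ** hl t"
  by (rule tensor_decomp[of t]) (simp add: h_sum_simps)

lemma hl_mult_right: "hl (t ** (mat 1 \<otimes>\<^sub>m a)) = hl t ** a"
  by (rule tensor_decomp[of t]) (simp add: h_sum_simps)

lemma hr_shift: "n \<in> N \<Longrightarrow> hr ((mat 1 \<otimes>\<^sub>m n) ** P) = \<kappa> n" "n \<in> N \<Longrightarrow> hr (P ** (mat 1 \<otimes>\<^sub>m n)) = \<kappa> n"
  by (simp_all add: P_shift P_shift' hr_mult_left hr_mult_right hr_P)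

text \<open>Write m as the slice of P by \<epsilon>(\<cdot> y). Then h(n m) and h(m n) both equal
  \<epsilon>(\<kappa>(n) y), because id \<otimes> h sends (1 \<otimes> n) P and P (1 \<otimes> n) to
  the same element \<kappa>(n).\<close>

lemma h_trace_N:
  assumes n: "n \<in> N" and m: "m \<in> N" shows "h (n ** m) = h (m ** n)"
proof -
  obtain y where y: "y \<in> M" "m = et y" using m by (auto simp: N_def)
  obtain l :: nat and p q where pq: "\<And>i. i < l \<Longrightarrow> p i \<in> M" "\<And>i. i < l \<Longrightarrow> q i \<in> M"
    "P = (\<Sum>i<l. p i \<otimes>\<^sub>m q i)" using \<Gamma>_decomp[OF one_M] by blast
  have m: "m = (\<Sum>i<l. \<epsilon> (p i ** y) \<cdot>\<^sub>C q i)" using y by (simp add: et_formula pq(3) sum_simps)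
  have \<epsilon>_sum: "\<epsilon> (\<Sum>i<l. f i) = (\<Sum>i<l. \<epsilon> (f i))" for f
    using \<epsilon>_smat[of 0] by (induction l) (simp_all add: \<epsilon>_add)
  have "h (n ** m) = \<epsilon> (hr ((mat 1 \<otimes>\<^sub>m n) ** P) ** y)"
    by (simp add: m pq(3) h_sum_simps \<epsilon>_sum \<epsilon>_smat mult.commute)
  also have "\<dots> = \<epsilon> (hr (P ** (mat 1 \<otimes>\<^sub>m n)) ** y)" by (simp add: hr_shift n)
  also have "\<dots> = h (m ** n)"
    by (simp add: m pq(3) h_sum_simps \<epsilon>_sum \<epsilon>_smat mult.commute)
  finally show ?thesis .
qed

lemma h_left_functional: "h (left_functional \<xi> \<xi>' t) = cinner (hr t *v \<xi>) \<xi>'"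
  by (rule tensor_decomp[of t])
    (simp add: left_functional_sum h_sum_simps matrix_vec_sum_left cinner_sum_left smat_mult_vec mult.commute)

lemma h_right_functional: "h (right_functional \<eta> \<eta>' t) = cinner (hl t *v \<eta>) \<eta>'"
  by (rule tensor_decomp[of t])
    (simp add: right_functional_sum h_sum_simps matrix_vec_sum_left cinner_sum_left smat_mult_vec mult.commute)

lemma h_left_functional_P:
  assumes "m \<in> N" shows "h (left_functional \<xi> \<xi>' P ** m) = cinner (\<kappa> m *v \<xi>) \<xi>'"
proof -
  have "left_functional \<xi> \<xi>' P ** m = left_functional \<xi> \<xi>' (P ** (mat 1 \<otimes>\<^sub>m m))"
    by (rule tensor_decomp[of P]) (simp add: left_functional_sum matrix_mult_sum_left)
  then show ?thesis by (simp add: h_left_functional hr_shift assms)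
qed

text \<open>The invariance of h at y = 1.\<close>

lemma Et_formula:
  assumes x: "x \<in> M" shows "Et x = \<kappa> (hr (P ** (mat 1 \<otimes>\<^sub>m x)))"
  using h_invariant[OF x one_M] by (simp add: Et_def hr_def)

text \<open>The first leg of P may be replaced by its image under \<epsilon>_s, and \<kappa>
  \<epsilon>_s = \<epsilon>_t \<kappa> carries the resulting slice into N.\<close>

lemma Et_N:
  assumes x: "x \<in> M" shows "Et x \<in> N"
proof -
  obtain l :: nat and p q where pq: "\<And>i. i < l \<Longrightarrow> p i \<in> M" "\<And>i. i < l \<Longrightarrow> q i \<in> M"
    "P = (\<Sum>i<l. p i \<otimes>\<^sub>m q i)" using \<Gamma>_decomp[OF one_M] by blast
  have P: "P = (\<Sum>i<l. es (p i) \<otimes>\<^sub>m q i)" using P_es by (simp add: pq(3) sum_simps)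
  have "Et x = et (\<Sum>i<l. h (q i ** x) \<cdot>\<^sub>C \<kappa> (p i))"
    unfolding Et_formula[OF x] by (subst P) (simp add: h_sum_simps \<kappa>_smat et_smat et_\<kappa> pq)
  then show ?thesis using pq by (auto simp: N_def intro!: imageI sum_M smat_M \<kappa>_M)
qed

text \<open>P is invariant under \<kappa> \<otimes> \<kappa> followed by the flip, and h under
  \<kappa>. So normalization in one leg says that \<kappa> sends (h \<otimes> id)(P) to 1 =
  \<kappa>(1), and \<kappa> is injective.\<close>

lemma hl_P: "hl P = mat 1"
proof -
  obtain l :: nat and p q where pq: "\<And>i. i < l \<Longrightarrow> p i \<in> M" "\<And>i. i < l \<Longrightarrow> q i \<in> M"
    "P = (\<Sum>i<l. p i \<otimes>\<^sub>m q i)" using \<Gamma>_decomp[OF one_M] by blast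
  have P: "P = (\<Sum>i<l. \<kappa> (q i) \<otimes>\<^sub>m \<kappa> (p i))" using flip_P by (simp add: pq(3) sum_simps)
  have hl: "hl P = (\<Sum>i<l. h (p i) \<cdot>\<^sub>C q i)" by (simp add: pq(3) h_sum_simps)
  have "\<kappa> (hl P) = hr (\<Sum>i<l. \<kappa> (q i) \<otimes>\<^sub>m \<kappa> (p i))"
    by (simp add: hl h_sum_simps \<kappa>_smat h_\<kappa> pq)
  also have "\<dots> = \<kappa> (mat 1)" using hr_P P \<kappa>_one by simp
  finally show ?thesis by (rule \<kappa>_inj[rotated 2]) (auto simp: hl one_M pq(2) intro!: sum_M smat_M)
qed

text \<open>Invariance of h removes the outer \<kappa> from the formula for \<open>Et\<close>,
  leaving (h \<otimes> h)(P (1 \<otimes> x)); this is h(x) by normalization in the first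
  leg.\<close>

lemma h_Et:
  assumes x: "x \<in> M" shows "h (Et x) = h x"
proof -
  obtain l :: nat and p q where pq: "\<And>i. i < l \<Longrightarrow> p i \<in> M" "\<And>i. i < l \<Longrightarrow> q i \<in> M"
    "P = (\<Sum>i<l. p i \<otimes>\<^sub>m q i)" using \<Gamma>_decomp[OF one_M] by blast
  have hr: "hr (P ** (mat 1 \<otimes>\<^sub>m x)) = (\<Sum>i<l. h (q i ** x) \<cdot>\<^sub>C p i)" by (simp add: pq(3) h_sum_simps)
  have "hr (P ** (mat 1 \<otimes>\<^sub>m x)) \<in> M" unfolding hr using pq by (auto intro!: sum_M smat_M)
  then have "h (Et x) = h (hr (P ** (mat 1 \<otimes>\<^sub>m x)))" using x by (simp add: Et_formula h_\<kappa>)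
  also have "\<dots> = h (hl P ** x)" by (simp add: hr pq(3) h_sum_simps mult.commute)
  finally show ?thesis by (simp add: hl_P)
qed

text \<open>\<kappa> interchanges the two expectations, so that facts about \<open>Es\<close> can be
  transported from \<open>Et\<close> through a preimage under \<kappa>.\<close>

lemma Es_\<kappa>:
  assumes x: "x \<in> M" shows "Es (\<kappa> x) = \<kappa> (Et x)"
  by (rule \<Gamma>_decomp[OF x]) (simp add: Es_def Et_def \<Gamma>_\<kappa> x h_sum_simps h_\<kappa> \<kappa>_smat)

lemma Es_\<kappa>_N: "x \<in> M \<Longrightarrow> Es x \<in> \<kappa> ` N"
proof -
  assume x: "x \<in> M"
  obtain a where a: "a \<in> M" "\<kappa> a = x" using \<kappa>_surj[OF x] .
  then show ?thesis using Es_\<kappa>[of a] Et_N[of a] by simp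
qed

lemma Es_M: "x \<in> M \<Longrightarrow> Es x \<in> M"
  by (drule Es_\<kappa>_N) (auto simp: N_M \<kappa>_M)

lemma h_Es:
  assumes x: "x \<in> M" shows "h (Es x) = h x"
proof -
  obtain a where a: "a \<in> M" "\<kappa> a = x" using \<kappa>_surj[OF x] .
  then show ?thesis using Es_\<kappa>[of a] h_\<kappa>[of a] h_\<kappa>[OF Et_M[of a]] h_Et[of a] by simp
qed

lemma Et_mult:
  assumes n: "n \<in> N" and x: "x \<in> M"
  shows "Et (n ** x) = n ** Et x" "Et (x ** n) = Et x ** n"
proof -
  have "\<Gamma> (n ** x) = (n \<otimes>\<^sub>m mat 1) ** (P ** \<Gamma> x)"
    using n x N_M by (simp add: \<Gamma>_mult \<Gamma>_N(2) matrix_mul_assoc)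
  then show "Et (n ** x) = n ** Et x" by (simp add: Et_def P_\<Gamma> x hr_mult_left)
  have "\<Gamma> (x ** n) = (\<Gamma> x ** P) ** (n \<otimes>\<^sub>m mat 1)"
    using n x N_M by (simp add: \<Gamma>_mult \<Gamma>_N(1) matrix_mul_assoc)
  then show "Et (x ** n) = Et x ** n" by (simp add: Et_def \<Gamma>_P x hr_mult_right)
qed

lemma Es_mult:
  assumes n: "n \<in> N" and x: "x \<in> M"
  shows "Es (\<kappa> n ** x) = \<kappa> n ** Es x" "Es (x ** \<kappa> n) = Es x ** \<kappa> n"
proof -
  have "\<Gamma> (\<kappa> n ** x) = (mat 1 \<otimes>\<^sub>m \<kappa> n) ** (P ** \<Gamma> x)"
    using n x N_M by (simp add: \<Gamma>_mult \<Gamma>_\<kappa>_N(2) \<kappa>_M matrix_mul_assoc)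
  then show "Es (\<kappa> n ** x) = \<kappa> n ** Es x" by (simp add: Es_def P_\<Gamma> x hl_mult_left)
  have "\<Gamma> (x ** \<kappa> n) = (\<Gamma> x ** P) ** (mat 1 \<otimes>\<^sub>m \<kappa> n)"
    using n x N_M by (simp add: \<Gamma>_mult \<Gamma>_\<kappa>_N(1) \<kappa>_M matrix_mul_assoc)
  then show "Es (x ** \<kappa> n) = Es x ** \<kappa> n" by (simp add: Es_def \<Gamma>_P x hl_mult_right)
qed

text \<open>\<open>Et\<close> is an N-bimodule map preserving h, so both sides can be moved into N,
  where h is tracial.\<close>

lemma h_central_N:
  assumes n: "n \<in> N" and b: "b \<in> M" shows "h (n ** b) = h (b ** n)"
proof -
  have "h (n ** b) = h (Et (n ** b))" using n b N_M by (simp add: h_Et closed_M)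
  also have "\<dots> = h (Et (b ** n))" using n b by (simp add: Et_mult h_trace_N Et_N)
  also have "\<dots> = h (b ** n)" using n b N_M by (simp add: h_Et closed_M)
  finally show ?thesis .
qed

lemma h_central_\<kappa>_N:
  assumes n: "n \<in> N" and b: "b \<in> M" shows "h (\<kappa> n ** b) = h (b ** \<kappa> n)"
proof -
  obtain a where a: "a \<in> M" "\<kappa> a = b" using \<kappa>_surj[OF b] .
  have "h (\<kappa> (a ** n)) = h (\<kappa> (n ** a))"
    using n a N_M h_central_N[OF n a(1)] by (simp add: h_\<kappa> closed_M)
  then show ?thesis using n a N_M by (simp add: \<kappa>_mult)
qed

lemma hr_central:
  assumes "n \<in> N" "t \<in> alg_tensor M M"
  shows "hr ((mat 1 \<otimes>\<^sub>m \<kappa> n) ** t) = hr (t ** (mat 1 \<otimes>\<^sub>m \<kappa> n))"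
  using assms(2) by (rule alg_tensor_decomp) (simp add: h_sum_simps h_central_\<kappa>_N[OF assms(1)])

lemma hl_central:
  assumes "n \<in> N" "t \<in> alg_tensor M M"
  shows "hl ((n \<otimes>\<^sub>m mat 1) ** t) = hl (t ** (n \<otimes>\<^sub>m mat 1))"
  using assms(2) by (rule alg_tensor_decomp) (simp add: h_sum_simps h_central_N[OF assms(1)])

text \<open>\<kappa>(n) touches only the leg of \<Gamma>(x) on which h is evaluated, and \<kappa>(N)
  centralizes h. Hence \<kappa>(N) lies in the centralizer of \<phi> composed with
  \<open>Et\<close>, whatever \<phi> is.\<close>

lemma Et_central:
  assumes n: "n \<in> N" and x: "x \<in> M" shows "Et (\<kappa> n ** x) = Et (x ** \<kappa> n)"
proof -
  have "\<Gamma> (\<kappa> n ** x) = (mat 1 \<otimes>\<^sub>m \<kappa> n) ** (P ** \<Gamma> x)"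
    using n x N_M by (simp add: \<Gamma>_mult \<Gamma>_\<kappa>_N(2) \<kappa>_M matrix_mul_assoc)
  moreover have "\<Gamma> (x ** \<kappa> n) = (\<Gamma> x ** P) ** (mat 1 \<otimes>\<^sub>m \<kappa> n)"
    using n x N_M by (simp add: \<Gamma>_mult \<Gamma>_\<kappa>_N(1) \<kappa>_M matrix_mul_assoc)
  ultimately show ?thesis using n x by (simp add: Et_def P_\<Gamma> \<Gamma>_P hr_central \<Gamma>_in)
qed

lemma Es_central:
  assumes n: "n \<in> N" and x: "x \<in> M" shows "Es (n ** x) = Es (x ** n)"
proof -
  have "\<Gamma> (n ** x) = (n \<otimes>\<^sub>m mat 1) ** (P ** \<Gamma> x)"
    using n x N_M by (simp add: \<Gamma>_mult \<Gamma>_N(2) matrix_mul_assoc)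
  moreover have "\<Gamma> (x ** n) = (\<Gamma> x ** P) ** (n \<otimes>\<^sub>m mat 1)"
    using n x N_M by (simp add: \<Gamma>_mult \<Gamma>_N(1) matrix_mul_assoc)
  ultimately show ?thesis using n x by (simp add: Es_def P_\<Gamma> \<Gamma>_P hl_central \<Gamma>_in)
qed

lemma \<Gamma>_psd:
  assumes "x \<in> M" "psd x" shows "psd (\<Gamma> x)"
proof -
  obtain s where s: "s \<in> M" "cadj s = s" "s ** s = x" using psd_factor[OF fd assms] .
  then have "\<Gamma> x = cadj (\<Gamma> s) ** \<Gamma> s" using \<Gamma>_mult \<Gamma>_cadj by metis
  then show ?thesis by (simp add: psd_adj_mult_self)
qed

text \<open>(Et(x) \<xi> | \<xi>) is the value of h at the slice of \<Gamma>(x) by \<xi>, and a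
  vector functional slices a positive operator to a positive one.\<close>

lemma Et_psd:
  assumes x: "x \<in> M" "psd x" shows "psd (Et x)"
  unfolding psd_def
proof
  fix \<xi>
  have "psd (left_functional \<xi> \<xi> (\<Gamma> x))"
    using \<Gamma>_psd[OF x] by (simp add: psd_def cinner_left_functional)
  then have "h (left_functional \<xi> \<xi> (\<Gamma> x)) \<in> \<real>\<^sub>\<ge>\<^sub>0"
    using x by (intro haar.\<psi>_nonneg left_functional_in[OF fd \<Gamma>_in])
  then show "cinner (Et x *v \<xi>) \<xi> \<in> \<real>\<^sub>\<ge>\<^sub>0" by (simp add: h_left_functional Et_def)
qed

lemma Es_psd:
  assumes x: "x \<in> M" "psd x" shows "psd (Es x)"
  unfolding psd_def
proof
  fix \<eta>
  have "psd (right_functional \<eta> \<eta> (\<Gamma> x))"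
    using \<Gamma>_psd[OF x] by (simp add: psd_def cinner_right_functional)
  then have "h (right_functional \<eta> \<eta> (\<Gamma> x)) \<in> \<real>\<^sub>\<ge>\<^sub>0"
    using x by (intro haar.\<psi>_nonneg right_functional_in[OF fd \<Gamma>_in])
  then show "cinner (Es x *v \<eta>) \<eta> \<in> \<real>\<^sub>\<ge>\<^sub>0" by (simp add: h_right_functional Es_def)
qed

lemma bilin_hr: "bilin (\<lambda>a u. a \<otimes>\<^sub>m hr u)"
  by (simp add: bilin_def hr_def linear_simps)

text \<open>Evaluate h on the third leg of coassociativity: (\<Gamma> \<otimes> id) \<Gamma>(x)
  yields \<Gamma>(Et(x)), while (id \<otimes> \<Gamma>) \<Gamma>(x) yields \<open>Et\<close> in the
  second leg.\<close>

lemma \<Gamma>_Et: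
  assumes x: "x \<in> M" shows "\<Gamma> (Et x) = blift (\<lambda>a b. a \<otimes>\<^sub>m Et b) (\<Gamma> x)"
proof -
  obtain k :: nat and a b where ab: "\<And>i. i < k \<Longrightarrow> a i \<in> M" "\<And>i. i < k \<Longrightarrow> b i \<in> M"
    "\<Gamma> x = (\<Sum>i<k. a i \<otimes>\<^sub>m b i)" using \<Gamma>_decomp[OF x(1)] by blast
  have [simp]: "blift (\<lambda>a b. a \<otimes>\<^sub>m Et b) (A \<otimes>\<^sub>m B) = A \<otimes>\<^sub>m Et B" for A B :: "complex ^ 'n ^ 'n"
    by (subst blift_tensor) (simp_all add: bilin_def E_add E_smat linear_simps)
  have R: "blift (\<lambda>a u. a \<otimes>\<^sub>m hr u) (reassoc (t \<otimes>\<^sub>m c)) = h c \<cdot>\<^sub>C t"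
    for t :: "complex ^ ('n \<times> 'n) ^ ('n \<times> 'n)" and c
    by (rule tensor_decomp[of t])
      (simp add: h_sum_simps reassoc_sum blift_tensor[OF bilin_hr])
  have "\<Gamma> (Et x) = blift (\<lambda>a u. a \<otimes>\<^sub>m hr u) (reassoc (blift (\<lambda>a b. \<Gamma> a \<otimes>\<^sub>m b) (\<Gamma> x)))"
    by (simp add: Et_def ab(3) h_sum_simps reassoc_sum R \<Gamma>_smat)
  also have "\<dots> = blift (\<lambda>a b. a \<otimes>\<^sub>m Et b) (\<Gamma> x)"
    by (simp add: coassoc[OF x]) (simp add: Et_def[symmetric] ab(3) h_sum_simps blift_tensor[OF bilin_hr])
  finally show ?thesis .
qed

lemma \<Gamma>_Es:
  assumes x: "x \<in> M" shows "\<Gamma> (Es x) = blift (\<lambda>a b. Es a \<otimes>\<^sub>m b) (\<Gamma> x)"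
proof -
  obtain k :: nat and a b where ab: "\<And>i. i < k \<Longrightarrow> a i \<in> M" "\<And>i. i < k \<Longrightarrow> b i \<in> M"
    "\<Gamma> x = (\<Sum>i<k. a i \<otimes>\<^sub>m b i)" using \<Gamma>_decomp[OF x(1)] by blast
  have [simp]: "blift (\<lambda>a b. Es a \<otimes>\<^sub>m b) (A \<otimes>\<^sub>m B) = Es A \<otimes>\<^sub>m B" for A B :: "complex ^ 'n ^ 'n"
    by (subst blift_tensor) (simp_all add: bilin_def E_add E_smat linear_simps)
  have L: "hl (reassoc (t \<otimes>\<^sub>m c)) = hl t \<otimes>\<^sub>m c"
    for t :: "complex ^ ('n \<times> 'n) ^ ('n \<times> 'n)" and c :: "complex ^ 'n ^ 'n"
    by (rule tensor_decomp[of t]) (simp add: h_sum_simps reassoc_sum)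
  have "\<Gamma> (Es x) = hl (blift (\<lambda>a b. a \<otimes>\<^sub>m \<Gamma> b) (\<Gamma> x))"
    by (simp add: Es_def ab(3) h_sum_simps \<Gamma>_smat)
  also have "\<dots> = blift (\<lambda>a b. Es a \<otimes>\<^sub>m b) (\<Gamma> x)"
    by (simp add: coassoc[OF x, symmetric]) (simp add: Es_def[symmetric] ab(3) h_sum_simps reassoc_sum L)
  finally show ?thesis .
qed

lemma Et_left_functional:
  assumes x: "x \<in> M" shows "Et (left_functional \<xi> \<xi>' (\<Gamma> x)) = left_functional \<xi> \<xi>' (\<Gamma> (Et x))"
proof -
  have [simp]: "blift (\<lambda>a b. a \<otimes>\<^sub>m Et b) (A \<otimes>\<^sub>m B) = A \<otimes>\<^sub>m Et B" for A B :: "complex ^ 'n ^ 'n"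
    by (subst blift_tensor) (simp_all add: bilin_def E_add E_smat linear_simps)
  show ?thesis
    by (rule \<Gamma>_decomp[OF x]) (simp add: \<Gamma>_Et[OF x] left_functional_sum h_sum_simps)
qed

lemma Es_right_functional:
  assumes x: "x \<in> M" shows "Es (right_functional \<eta> \<eta>' (\<Gamma> x)) = right_functional \<eta> \<eta>' (\<Gamma> (Es x))"
proof -
  have [simp]: "blift (\<lambda>a b. Es a \<otimes>\<^sub>m b) (A \<otimes>\<^sub>m B) = Es A \<otimes>\<^sub>m B" for A B :: "complex ^ 'n ^ 'n"
    by (subst blift_tensor) (simp_all add: bilin_def E_add E_smat linear_simps)
  show ?thesis
    by (rule \<Gamma>_decomp[OF x]) (simp add: \<Gamma>_Es[OF x] right_functional_sum h_sum_simps)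
qed

end

section \<open>The adapted measured quantum groupoid\<close>

context rel_tensor
begin

lemma left_slice_eq: "A \<in> rtp_ops N \<psi> \<beta> \<alpha> \<Longrightarrow> left_slice N \<psi> \<beta> \<alpha> \<xi> A = left_functional \<xi> \<xi> A"
  by (rule matrix_cinner_eqI) (simp add: cinner_left_slice cinner_left_functional)

lemma right_slice_eq: "A \<in> rtp_ops N \<psi> \<beta> \<alpha> \<Longrightarrow> right_slice N \<psi> \<beta> \<alpha> \<eta> A = right_functional \<eta> \<eta> A"
  by (rule matrix_cinner_eqI) (simp add: cinner_right_slice cinner_right_functional)

end

lemma nsf_weight_subalgebra: "nsf_weight M \<psi> \<Longrightarrow> N \<subseteq> M \<Longrightarrow> nsf_weight N \<psi>"
  unfolding nsf_weight_def positive_form_on_def faithful_form_on_def linear_form_on_def by blast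

lemma nsf_weight_comp:
  assumes T: "nsf_op_valued_weight M P T" and \<phi>: "nsf_weight P \<phi>"
  shows "nsf_weight M (\<phi> \<circ> T)"
  using assms
  by (auto simp: nsf_op_valued_weight_def nsf_weight_def positive_form_on_def faithful_form_on_def
      linear_form_on_def linear_map_on_def)

text \<open>The hypothesis puts x into the centralizer of \<phi> composed with T for every \<phi>,
  so all automorphisms fix x. One nsf weight \<phi> is supplied as a witness: if there were none,
  every y would satisfy the description.\<close>

lemma op_weight_modular_aut_central:
  assumes T: "nsf_op_valued_weight M P T" and \<phi>: "nsf_weight P \<phi>"
    and x: "x \<in> M" and central: "\<And>a. a \<in> M \<Longrightarrow> T (x ** a) = T (a ** x)"
  shows "op_weight_modular_aut M P T t x = x"
proof -
  have *: "modular_aut M (\<phi> \<circ> T) t x = x" if "nsf_weight P \<phi>" for \<phi>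
  proof -
    interpret weighted_algebra M "\<phi> \<circ> T"
      using T nsf_weight_comp[OF T that] by unfold_locales (auto simp: nsf_op_valued_weight_def)
    show ?thesis by (rule modular_aut_centralizer) (use x central in auto)
  qed
  show ?thesis
    unfolding op_weight_modular_aut_def
    by (rule the_equality) (use * \<phi> in auto)
qed

text \<open>The functions with index 0 are the given structure maps, which agree with the total linear
  extensions only on the algebra.\<close>

locale restricted_haar_weak_hopf = haar_weak_hopf M \<Gamma> \<kappa> \<epsilon> h
  for M :: "(complex ^ 'n ^ 'n) set" and \<Gamma> \<kappa> \<epsilon> h +
  fixes \<Gamma>\<^sub>0 :: "complex ^ 'n ^ 'n \<Rightarrow> complex ^ ('n \<times> 'n) ^ ('n \<times> 'n)"
    and \<kappa>\<^sub>0 T\<^sub>L T\<^sub>R :: "complex ^ 'n ^ 'n \<Rightarrow> complex ^ 'n ^ 'n" and h\<^sub>0 :: "complex ^ 'n ^ 'n \<Rightarrow> complex"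
  assumes \<Gamma>\<^sub>0: "\<And>x. x \<in> M \<Longrightarrow> \<Gamma>\<^sub>0 x = \<Gamma> x" and \<kappa>\<^sub>0: "\<And>x. x \<in> M \<Longrightarrow> \<kappa>\<^sub>0 x = \<kappa> x"
    and h\<^sub>0: "\<And>x. x \<in> M \<Longrightarrow> h\<^sub>0 x = h x"
    and T\<^sub>L: "\<And>x. x \<in> M \<Longrightarrow> T\<^sub>L x = Et x" and T\<^sub>R: "\<And>x. x \<in> M \<Longrightarrow> T\<^sub>R x = Es x"
begin

lemmas N_closed = fd_one[OF fd_N] fd_zero[OF fd_N] fd_add[OF fd_N] fd_mult[OF fd_N] fd_cadj[OF fd_N]
  fd_smat[OF fd_N]

lemmas to_total = \<Gamma>\<^sub>0 \<kappa>\<^sub>0 h\<^sub>0 T\<^sub>L T\<^sub>R N_M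

lemma nsf_M: "nsf_weight M h\<^sub>0"
  using h_nsf by (auto simp: nsf_weight_def positive_form_on_def faithful_form_on_def linear_form_on_def
      h\<^sub>0 closed_M)

lemma nsf_N: "nsf_weight N h\<^sub>0"
  using nsf_weight_subalgebra[OF nsf_M] N_M by blast

sublocale N: traced_algebra N h\<^sub>0
  by unfold_locales (auto simp: fd_N nsf_N to_total N_closed h_trace_N)

lemma \<kappa>\<^sub>0_antihom: "star_antihom_on N \<kappa>\<^sub>0"
  by (auto simp: star_antihom_on_def linear_map_on_def to_total N_closed \<kappa>_add \<kappa>_smat \<kappa>_mult \<kappa>_cadj)

lemma id_hom: "star_hom_on A (\<lambda>n. n)"
  by (simp add: star_hom_on_def linear_map_on_def)

text \<open>The witness for \<open>gram\<close> is a slice of P. It lies in N because the second leg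
  of P does, and \<open>h_left_functional_P\<close> is its trace condition.\<close>

sublocale rtp: rel_tensor N h\<^sub>0 \<kappa>\<^sub>0 "\<lambda>n. n" P
proof
  fix \<xi> \<xi>'
  have n: "left_functional \<xi> \<xi>' P \<in> N" by (rule left_functional_in[OF fd_N P_in])
  show "\<exists>n\<in>N. (\<forall>m\<in>N. h\<^sub>0 (n ** m) = cinner (\<kappa>\<^sub>0 m *v \<xi>) \<xi>') \<and>
      (\<forall>\<eta> \<eta>'. cinner (P *v (\<xi> \<otimes>\<^sub>v \<eta>)) (\<xi>' \<otimes>\<^sub>v \<eta>') = cinner (n *v \<eta>) \<eta>')"
    by (rule bexI[OF _ n])
      (simp add: cinner_left_functional to_total N_closed n h_left_functional_P)
qed (simp_all add: \<kappa>\<^sub>0_antihom id_hom P_idem P_sa)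

lemma \<Gamma>_ops: "x \<in> M \<Longrightarrow> \<Gamma> x \<in> rtp_ops N h\<^sub>0 \<kappa>\<^sub>0 (\<lambda>n. n)"
  by (simp add: rtp.rtp_ops_iff P_\<Gamma> \<Gamma>_P)

lemma P_commutes:
  assumes "n \<in> N" "m \<in> N" shows "P ** (n \<otimes>\<^sub>m \<kappa> m) = (n \<otimes>\<^sub>m \<kappa> m) ** P"
proof -
  have "n \<otimes>\<^sub>m \<kappa> m = (n \<otimes>\<^sub>m mat 1) ** (mat 1 \<otimes>\<^sub>m \<kappa> m)" by simp
  then show ?thesis using \<Gamma>_N[OF assms(1)] \<Gamma>_\<kappa>_N[OF assms(2)] by (metis matrix_mul_assoc)
qed

lemma rtp_op_N: "n \<in> N \<Longrightarrow> m \<in> N \<Longrightarrow> rtp_op N h\<^sub>0 \<kappa>\<^sub>0 (\<lambda>n. n) n (\<kappa> m) = (n \<otimes>\<^sub>m \<kappa> m) ** P"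
  by (rule rtp.rtp_op_eq) (rule P_commutes)

lemma \<Gamma>_N_\<kappa>_N:
  assumes "n \<in> N" "m \<in> N" shows "\<Gamma> (n ** \<kappa> m) = (n \<otimes>\<^sub>m \<kappa> m) ** P"
proof -
  have "\<Gamma> (n ** \<kappa> m) = (n \<otimes>\<^sub>m mat 1) ** (P ** \<Gamma> (\<kappa> m))"
    using assms by (simp add: \<Gamma>_mult N_M \<kappa>_M \<Gamma>_N(2) matrix_mul_assoc)
  also have "\<dots> = (n \<otimes>\<^sub>m mat 1) ** ((mat 1 \<otimes>\<^sub>m \<kappa> m) ** P)"
    using assms by (simp add: P_\<Gamma> N_M \<kappa>_M flip: \<Gamma>_\<kappa>_N(2))
  finally show ?thesis by (simp add: matrix_mul_assoc)
qed

lemma rtp_op_left: "n \<in> N \<Longrightarrow> rtp_op N h\<^sub>0 \<kappa>\<^sub>0 (\<lambda>n. n) n (mat 1) = \<Gamma> n"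
  using rtp_op_N[of n "mat 1"] \<Gamma>_N(2)[of n] by (simp add: N_closed \<kappa>_one)

lemma rtp_op_right: "n \<in> N \<Longrightarrow> rtp_op N h\<^sub>0 \<kappa>\<^sub>0 (\<lambda>n. n) (mat 1) (\<kappa> n) = \<Gamma> (\<kappa> n)"
  using rtp_op_N[of "mat 1" n] \<Gamma>_\<kappa>_N(2)[of n] by (simp add: N_closed)

lemma commutant_tensor:
  assumes "t \<in> alg_tensor M M" "x \<in> commutant M" "y \<in> commutant M"
  shows "t ** (x \<otimes>\<^sub>m y) = (x \<otimes>\<^sub>m y) ** t"
  using assms(1)
proof (rule alg_tensor_decomp)
  fix k :: nat and a b assume "\<And>i. i < k \<Longrightarrow> a i \<in> M" "\<And>i. i < k \<Longrightarrow> b i \<in> M" "t = (\<Sum>i<k. a i \<otimes>\<^sub>m b i)"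
  moreover have "z ** x = x ** z" "z ** y = y ** z" if "z \<in> M" for z
    using assms(2,3) that by (auto simp: commutant_def)
  ultimately show ?thesis by (simp add: matrix_mult_sum_left matrix_mult_sum_right)
qed

text \<open>Elementary tensors of commutants commute with everything in M \<otimes> M, in particular
  with P, so their relative tensor product is the ordinary one times P.\<close>

lemma \<Gamma>_fiber_product: "x \<in> M \<Longrightarrow> \<Gamma> x \<in> fiber_product N h\<^sub>0 \<kappa>\<^sub>0 (\<lambda>n. n) M M"
proof -
  assume x: "x \<in> M"
  have "\<Gamma> x ** rtp_op N h\<^sub>0 \<kappa>\<^sub>0 (\<lambda>n. n) a b = rtp_op N h\<^sub>0 \<kappa>\<^sub>0 (\<lambda>n. n) a b ** \<Gamma> x"
    if ab: "a \<in> commutant M" "b \<in> commutant M" for a b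
  proof -
    have "rtp_op N h\<^sub>0 \<kappa>\<^sub>0 (\<lambda>n. n) a b = (a \<otimes>\<^sub>m b) ** P"
      by (rule rtp.rtp_op_eq) (rule commutant_tensor[OF \<Gamma>_in[OF one_M] ab])
    moreover have "\<Gamma> x ** ((a \<otimes>\<^sub>m b) ** P) = (a \<otimes>\<^sub>m b) ** (\<Gamma> x ** P)"
      using commutant_tensor[OF \<Gamma>_in[OF x] ab] by (simp add: matrix_mul_assoc)
    moreover have "(a \<otimes>\<^sub>m b) ** P ** \<Gamma> x = (a \<otimes>\<^sub>m b) ** (P ** \<Gamma> x)"
      by (simp add: matrix_mul_assoc)
    ultimately show ?thesis using x by (simp add: \<Gamma>_P P_\<Gamma>)
  qed
  then show ?thesis using \<Gamma>_ops[OF x] by (simp add: fiber_product_def)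
qed

abbreviation \<Gamma>_id where "\<Gamma>_id \<equiv> blift (\<lambda>a (b :: complex ^ 'n ^ 'n). \<Gamma> a \<otimes>\<^sub>m b)"

abbreviation id_\<Gamma> where "id_\<Gamma> \<equiv> blift (\<lambda>(a :: complex ^ 'n ^ 'n) b. a \<otimes>\<^sub>m \<Gamma> b)"

lemma \<Gamma>_id_mult:
  assumes "s \<in> alg_tensor M M" "t \<in> alg_tensor M M" shows "\<Gamma>_id (s ** t) = \<Gamma>_id s ** \<Gamma>_id t"
  by (rule alg_tensor_decomp[OF assms(1)], rule alg_tensor_decomp[OF assms(2)])
    (simp add: sum_simps \<Gamma>_mult)

lemma id_\<Gamma>_mult:
  assumes "s \<in> alg_tensor M M" "t \<in> alg_tensor M M" shows "id_\<Gamma> (s ** t) = id_\<Gamma> s ** id_\<Gamma> t"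
  by (rule alg_tensor_decomp[OF assms(1)], rule alg_tensor_decomp[OF assms(2)])
    (simp add: sum_simps \<Gamma>_mult)

lemma \<Gamma>_id_cadj: "t \<in> alg_tensor M M \<Longrightarrow> \<Gamma>_id (cadj t) = cadj (\<Gamma>_id t)"
  by (erule alg_tensor_decomp) (simp add: sum_simps cadj_sum \<Gamma>_cadj)

lemma id_\<Gamma>_cadj: "t \<in> alg_tensor M M \<Longrightarrow> id_\<Gamma> (cadj t) = cadj (id_\<Gamma> t)"
  by (erule alg_tensor_decomp) (simp add: sum_simps cadj_sum \<Gamma>_cadj)

lemma right_functional_\<Gamma>_id: "right_functional \<eta> \<eta>' (\<Gamma>_id t) = \<Gamma> (right_functional \<eta> \<eta>' t)"
  by (rule tensor_decomp[of t]) (simp add: right_functional_sum sum_simps \<Gamma>_smat)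

lemma left_functional_id_\<Gamma>: "left_functional \<xi> \<xi>' (id_\<Gamma> t) = \<Gamma> (left_functional \<xi> \<xi>' t)"
  by (rule tensor_decomp[of t]) (simp add: left_functional_sum sum_simps \<Gamma>_smat)

abbreviation \<beta>\<^sub>2 where "\<beta>\<^sub>2 \<equiv> \<lambda>n. rtp_op N h\<^sub>0 \<kappa>\<^sub>0 (\<lambda>n. n) (mat 1) (\<kappa>\<^sub>0 n)"

abbreviation \<alpha>\<^sub>2 where "\<alpha>\<^sub>2 \<equiv> \<lambda>n. rtp_op N h\<^sub>0 \<kappa>\<^sub>0 (\<lambda>n. n) n (mat 1)"

lemma \<beta>\<^sub>2_eq: "n \<in> N \<Longrightarrow> \<beta>\<^sub>2 n = \<Gamma> (\<kappa> n)"
  by (simp add: to_total rtp_op_right)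

text \<open>On the relative square, 1 \<otimes> \<beta>(n) is \<Gamma>(\<kappa>(n)), so the
  antirepresentation laws are inherited from \<Gamma> and \<kappa>; its value at the unit is P and
  not the identity matrix. The witness is a slice of (\<Gamma> \<otimes> id)(P), and its trace
  condition is the identity (id \<otimes> h)(P (1 \<otimes> m)) = \<kappa>(m) with \<Gamma> applied
  to both sides.\<close>

sublocale rtp_left: rel_tensor N h\<^sub>0 \<beta>\<^sub>2 "\<lambda>n. n" "\<Gamma>_id P"
proof
  show "star_antihom_on N \<beta>\<^sub>2"
    by (simp add: star_antihom_on_def linear_map_on_def \<beta>\<^sub>2_eq N_closed \<kappa>_add \<kappa>_smat \<Gamma>_add \<Gamma>_smat
        \<kappa>_mult \<kappa>_cadj \<Gamma>_mult \<Gamma>_cadj N_M \<kappa>_M)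
  show "\<Gamma>_id P ** \<Gamma>_id P = \<Gamma>_id P"
    using \<Gamma>_id_mult[OF \<Gamma>_in[OF one_M] \<Gamma>_in[OF one_M]] by (simp add: P_idem)
  show "cadj (\<Gamma>_id P) = \<Gamma>_id P"
    using \<Gamma>_id_cadj[OF \<Gamma>_in[OF one_M]] by (simp add: P_sa)
  fix \<xi> \<xi>' :: "complex ^ ('n \<times> 'n)"
  obtain l :: nat and p q where pq: "\<And>i. i < l \<Longrightarrow> p i \<in> M" "\<And>i. i < l \<Longrightarrow> q i \<in> N"
    "P = (\<Sum>i<l. p i \<otimes>\<^sub>m q i)" using alg_tensor_decomp[OF P_in] by blast
  define n where "n = left_functional \<xi> \<xi>' (\<Gamma>_id P)"
  have n_sum: "n = (\<Sum>i<l. cinner (\<Gamma> (p i) *v \<xi>) \<xi>' \<cdot>\<^sub>C q i)"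
    by (simp add: n_def pq(3) sum_simps left_functional_sum)
  have n: "n \<in> N" unfolding n_sum using pq(2) by (auto intro!: fd_sum[OF fd_N] fd_smat[OF fd_N])
  have "h (n ** m) = cinner (\<Gamma> (\<kappa> m) *v \<xi>) \<xi>'" if m: "m \<in> N" for m
  proof -
    have "h (n ** m) = cinner (\<Gamma> (\<Sum>i<l. h (q i ** m) \<cdot>\<^sub>C p i) *v \<xi>) \<xi>'"
      by (simp add: n_sum h_sum_simps \<Gamma>_smat smat_mult_vec matrix_vec_sum_left cinner_sum_left mult.commute)
    also have "(\<Sum>i<l. h (q i ** m) \<cdot>\<^sub>C p i) = hr (P ** (mat 1 \<otimes>\<^sub>m m))"
      by (simp add: pq(3) h_sum_simps)
    finally show ?thesis by (simp add: hr_shift m)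
  qed
  then show "\<exists>n\<in>N. (\<forall>m\<in>N. h\<^sub>0 (n ** m) = cinner (\<beta>\<^sub>2 m *v \<xi>) \<xi>') \<and>
      (\<forall>\<eta> \<eta>'. cinner (\<Gamma>_id P *v (\<xi> \<otimes>\<^sub>v \<eta>)) (\<xi>' \<otimes>\<^sub>v \<eta>') = cinner (n *v \<eta>) \<eta>')"
    using n by (intro bexI[of _ n]) (simp_all add: \<beta>\<^sub>2_eq h\<^sub>0 N_M N_closed n_def cinner_left_functional)
qed (rule id_hom)

text \<open>The slice of P used for the relative square serves again: on N the representation n
  \<mapsto> \<alpha>(n) \<otimes> 1 is \<Gamma>, and \<Gamma> of a slice of P is the slice of (id
  \<otimes> \<Gamma>)(P).\<close>

sublocale rtp_right: rel_tensor N h\<^sub>0 \<kappa>\<^sub>0 \<alpha>\<^sub>2 "id_\<Gamma> P"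
proof
  show "star_hom_on N \<alpha>\<^sub>2"
    by (simp add: star_hom_on_def linear_map_on_def rtp_op_left N_closed \<Gamma>_add \<Gamma>_smat \<Gamma>_mult \<Gamma>_cadj N_M)
  show "id_\<Gamma> P ** id_\<Gamma> P = id_\<Gamma> P"
    using id_\<Gamma>_mult[OF \<Gamma>_in[OF one_M] \<Gamma>_in[OF one_M]] by (simp add: P_idem)
  show "cadj (id_\<Gamma> P) = id_\<Gamma> P"
    using id_\<Gamma>_cadj[OF \<Gamma>_in[OF one_M]] by (simp add: P_sa)
  fix \<xi> \<xi>' :: "complex ^ 'n"
  have n: "left_functional \<xi> \<xi>' P \<in> N" by (rule left_functional_in[OF fd_N P_in])
  show "\<exists>n\<in>N. (\<forall>m\<in>N. h\<^sub>0 (n ** m) = cinner (\<kappa>\<^sub>0 m *v \<xi>) \<xi>') \<and>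
      (\<forall>\<eta> \<eta>'. cinner (id_\<Gamma> P *v (\<xi> \<otimes>\<^sub>v \<eta>)) (\<xi>' \<otimes>\<^sub>v \<eta>') = cinner (\<alpha>\<^sub>2 n *v \<eta>) \<eta>')"
    by (rule bexI[OF _ n])
      (simp add: to_total N_closed n h_left_functional_P rtp_op_left cinner_left_functional
        flip: left_functional_id_\<Gamma>)
qed (rule \<kappa>\<^sub>0_antihom)

text \<open>Slices determine an operator under the range projection, and slicing the last leg
  commutes with \<Gamma> on the first. The slices of \<Gamma>(x) lie in M, where the given
  co-product agrees with its extension.\<close>

lemma cop_star_id_eq:
  assumes x: "x \<in> M" shows "cop_star_id N h\<^sub>0 \<kappa>\<^sub>0 (\<lambda>n. n) \<Gamma>\<^sub>0 (\<Gamma> x) = \<Gamma>_id (\<Gamma> x)"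
  unfolding cop_star_id_def Let_def rtp.bounded_left
proof (rule the_equality)
  have "\<Gamma>_id P ** \<Gamma>_id (\<Gamma> x) ** \<Gamma>_id P = \<Gamma>_id (\<Gamma> x)"
    using x by (simp add: \<Gamma>_in one_M P_\<Gamma> \<Gamma>_P flip: \<Gamma>_id_mult)
  then have ops: "\<Gamma>_id (\<Gamma> x) \<in> rtp_ops N h\<^sub>0 \<beta>\<^sub>2 (\<lambda>n. n)" by (simp add: rtp_left.rtp_ops_iff)
  have "right_functional \<eta> \<eta> (\<Gamma> x) \<in> M" for \<eta> by (rule right_functional_in[OF fd \<Gamma>_in[OF x]])
  then have sl: "right_slice N h\<^sub>0 \<beta>\<^sub>2 (\<lambda>n. n) \<eta> (\<Gamma>_id (\<Gamma> x)) = \<Gamma>\<^sub>0 (right_slice N h\<^sub>0 \<kappa>\<^sub>0 (\<lambda>n. n) \<eta> (\<Gamma> x))" for \<eta>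
    using x by (simp add: rtp_left.right_slice_eq[OF ops] rtp.right_slice_eq \<Gamma>_ops right_functional_\<Gamma>_id \<Gamma>\<^sub>0)
  show "\<Gamma>_id (\<Gamma> x) \<in> rtp_ops N h\<^sub>0 \<beta>\<^sub>2 (\<lambda>n. n) \<and> (\<forall>\<eta>\<in>UNIV.
      right_slice N h\<^sub>0 \<beta>\<^sub>2 (\<lambda>n. n) \<eta> (\<Gamma>_id (\<Gamma> x)) = \<Gamma>\<^sub>0 (right_slice N h\<^sub>0 \<kappa>\<^sub>0 (\<lambda>n. n) \<eta> (\<Gamma> x)))"
    using ops sl by blast
  fix B assume "B \<in> rtp_ops N h\<^sub>0 \<beta>\<^sub>2 (\<lambda>n. n) \<and> (\<forall>\<eta>\<in>UNIV.
      right_slice N h\<^sub>0 \<beta>\<^sub>2 (\<lambda>n. n) \<eta> B = \<Gamma>\<^sub>0 (right_slice N h\<^sub>0 \<kappa>\<^sub>0 (\<lambda>n. n) \<eta> (\<Gamma> x)))"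
  then show "B = \<Gamma>_id (\<Gamma> x)" using ops sl by (intro rtp_left.rtp_ops_right_slice_eqI) auto
qed

lemma id_star_cop_eq:
  assumes x: "x \<in> M" shows "id_star_cop N h\<^sub>0 \<kappa>\<^sub>0 (\<lambda>n. n) \<Gamma>\<^sub>0 (\<Gamma> x) = id_\<Gamma> (\<Gamma> x)"
  unfolding id_star_cop_def Let_def rtp.bounded_right
proof (rule the_equality)
  have "id_\<Gamma> P ** id_\<Gamma> (\<Gamma> x) ** id_\<Gamma> P = id_\<Gamma> (\<Gamma> x)"
    using x by (simp add: \<Gamma>_in one_M P_\<Gamma> \<Gamma>_P flip: id_\<Gamma>_mult)
  then have ops: "id_\<Gamma> (\<Gamma> x) \<in> rtp_ops N h\<^sub>0 \<kappa>\<^sub>0 \<alpha>\<^sub>2" by (simp add: rtp_right.rtp_ops_iff)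
  have "left_functional \<xi> \<xi> (\<Gamma> x) \<in> M" for \<xi> by (rule left_functional_in[OF fd \<Gamma>_in[OF x]])
  then have sl: "left_slice N h\<^sub>0 \<kappa>\<^sub>0 \<alpha>\<^sub>2 \<xi> (id_\<Gamma> (\<Gamma> x)) = \<Gamma>\<^sub>0 (left_slice N h\<^sub>0 \<kappa>\<^sub>0 (\<lambda>n. n) \<xi> (\<Gamma> x))" for \<xi>
    using x by (simp add: rtp_right.left_slice_eq[OF ops] rtp.left_slice_eq \<Gamma>_ops left_functional_id_\<Gamma> \<Gamma>\<^sub>0)
  show "id_\<Gamma> (\<Gamma> x) \<in> rtp_ops N h\<^sub>0 \<kappa>\<^sub>0 \<alpha>\<^sub>2 \<and> (\<forall>\<xi>\<in>UNIV.
      left_slice N h\<^sub>0 \<kappa>\<^sub>0 \<alpha>\<^sub>2 \<xi> (id_\<Gamma> (\<Gamma> x)) = \<Gamma>\<^sub>0 (left_slice N h\<^sub>0 \<kappa>\<^sub>0 (\<lambda>n. n) \<xi> (\<Gamma> x)))"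
    using ops sl by blast
  fix B assume "B \<in> rtp_ops N h\<^sub>0 \<kappa>\<^sub>0 \<alpha>\<^sub>2 \<and> (\<forall>\<xi>\<in>UNIV.
      left_slice N h\<^sub>0 \<kappa>\<^sub>0 \<alpha>\<^sub>2 \<xi> B = \<Gamma>\<^sub>0 (left_slice N h\<^sub>0 \<kappa>\<^sub>0 (\<lambda>n. n) \<xi> (\<Gamma> x)))"
  then show "B = id_\<Gamma> (\<Gamma> x)" using ops sl by (intro rtp_right.rtp_ops_left_slice_eqI) auto
qed

lemma hopf_bimodule: "hopf_bimodule N M (\<lambda>n. n) \<kappa>\<^sub>0 \<Gamma>\<^sub>0 h\<^sub>0"
proof -
  have "star_hom_on M \<Gamma>\<^sub>0"
    by (simp add: star_hom_on_def linear_map_on_def \<Gamma>\<^sub>0 closed_M \<Gamma>_add \<Gamma>_smat \<Gamma>_mult \<Gamma>_cadj)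
  moreover have "inj_on \<kappa>\<^sub>0 N"
    by (rule inj_onI) (metis \<kappa>_\<kappa> \<kappa>\<^sub>0 N_M)
  moreover have "\<Gamma>\<^sub>0 (n ** \<kappa>\<^sub>0 m) = rtp_op N h\<^sub>0 \<kappa>\<^sub>0 (\<lambda>n. n) n (\<kappa>\<^sub>0 m)" if "n \<in> N" "m \<in> N" for n m
    using that by (simp add: to_total mult_M \<kappa>_M \<Gamma>_N_\<kappa>_N rtp_op_N)
  moreover have "reassoc (cop_star_id N h\<^sub>0 \<kappa>\<^sub>0 (\<lambda>n. n) \<Gamma>\<^sub>0 (\<Gamma>\<^sub>0 x)) = id_star_cop N h\<^sub>0 \<kappa>\<^sub>0 (\<lambda>n. n) \<Gamma>\<^sub>0 (\<Gamma>\<^sub>0 x)"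
    if "x \<in> M" for x
    using that by (simp add: \<Gamma>\<^sub>0 cop_star_id_eq id_star_cop_eq coassoc)
  ultimately show ?thesis
    unfolding hopf_bimodule_def
    by (auto simp: fd_N fd id_hom \<kappa>\<^sub>0_antihom to_total one_M \<kappa>_one \<kappa>_M N_commutes \<Gamma>_fiber_product)
qed

section \<open>The Haar expectations as invariant operator-valued weights\<close>

lemma fd_\<kappa>_N: "fd_vn_algebra (\<kappa> ` N)"
proof -
  have "mat 1 \<in> \<kappa> ` N" using \<kappa>_one N_closed(1) by (metis image_eqI)
  moreover have "\<kappa> n + \<kappa> m \<in> \<kappa> ` N" "\<kappa> n ** \<kappa> m \<in> \<kappa> ` N" if "n \<in> N" "m \<in> N" for n m
    using that by (simp_all add: N_closed N_M flip: \<kappa>_add \<kappa>_mult)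
  moreover have "cadj (\<kappa> n) \<in> \<kappa> ` N" "c \<cdot>\<^sub>C \<kappa> n \<in> \<kappa> ` N" if "n \<in> N" for n c
    using that by (simp_all add: N_closed flip: \<kappa>_cadj \<kappa>_smat)
  ultimately show ?thesis by (auto simp: fd_vn_algebra_def)
qed

lemma \<kappa>\<^sub>0_image: "\<kappa>\<^sub>0 ` N = \<kappa> ` N"
  by (rule image_cong) (auto simp: to_total)

lemma T\<^sub>L_weight: "nsf_op_valued_weight M N T\<^sub>L"
  unfolding nsf_op_valued_weight_def
proof (intro conjI ballI impI)
  show "linear_map_on M T\<^sub>L" by (simp add: linear_map_on_def T\<^sub>L closed_M E_add E_smat)
  fix x assume x: "x \<in> M"
  show "T\<^sub>L x \<in> N" by (simp add: T\<^sub>L x Et_N)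
  show "psd (T\<^sub>L x)" if "psd x" by (simp add: T\<^sub>L x Et_psd that)
  show "T\<^sub>L (cadj a ** x ** a) = cadj a ** T\<^sub>L x ** a" if "a \<in> N" for a
    using that x by (simp add: T\<^sub>L N_M closed_M Et_mult N_closed)
  \<comment> \<open>Faithfulness reduces to that of h, because h is preserved by
    \<open>Et\<close>.\<close>
  show "x = 0" if "psd x" "T\<^sub>L x = 0"
    using that x h_Et[OF x] h_nsf by (simp add: T\<^sub>L nsf_weight_def faithful_form_on_def)
qed (use fd fd_N N_M in auto)

lemma T\<^sub>R_weight: "nsf_op_valued_weight M (\<kappa> ` N) T\<^sub>R"
  unfolding nsf_op_valued_weight_def
proof (intro conjI ballI impI)
  show "linear_map_on M T\<^sub>R" by (simp add: linear_map_on_def T\<^sub>R closed_M E_add E_smat)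
  fix x assume x: "x \<in> M"
  show "T\<^sub>R x \<in> \<kappa> ` N" by (simp add: T\<^sub>R x Es_\<kappa>_N)
  show "psd (T\<^sub>R x)" if "psd x" by (simp add: T\<^sub>R x Es_psd that)
  show "T\<^sub>R (cadj a ** x ** a) = cadj a ** T\<^sub>R x ** a" if a: "a \<in> \<kappa> ` N" for a
  proof -
    obtain n where n: "n \<in> N" "a = \<kappa> n" using a by blast
    then show ?thesis using x
      by (simp add: T\<^sub>R N_M closed_M Es_mult N_closed flip: \<kappa>_cadj)
  qed
  show "x = 0" if "psd x" "T\<^sub>R x = 0"
    using that x h_Es[OF x] h_nsf by (simp add: T\<^sub>R nsf_weight_def faithful_form_on_def)
qed (use fd fd_\<kappa>_N N_M \<kappa>_M in auto)

text \<open>Both sides are \<Gamma>(Et(x)): slicing \<Gamma>(x) and then applying the weight is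
  slicing \<Gamma>(Et(x)), and as Et(x) lies in N this operator is also Et(x) \<otimes> 1 on the
  relative square.\<close>

lemma left_invariant: "left_invariant N M (\<lambda>n. n) \<kappa>\<^sub>0 \<Gamma>\<^sub>0 h\<^sub>0 T\<^sub>L"
  unfolding left_invariant_def
proof
  fix x assume "x \<in> op_weight_domain M ((\<lambda>n. n) ` N) T\<^sub>L"
  then have x: "x \<in> M" "psd x" by (auto simp: op_weight_domain_def)
  have EM: "Et x \<in> M" and EN: "Et x \<in> N" using x Et_M Et_N by auto
  have T: "T\<^sub>L (left_slice N h\<^sub>0 \<kappa>\<^sub>0 (\<lambda>n. n) \<xi> (\<Gamma> x)) = left_functional \<xi> \<xi> (\<Gamma> (Et x))" for \<xi>
    using x by (simp add: rtp.left_slice_eq \<Gamma>_ops T\<^sub>L left_functional_in[OF fd \<Gamma>_in] Et_left_functional)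
  have "id_star_weight N h\<^sub>0 \<kappa>\<^sub>0 (\<lambda>n. n) T\<^sub>L (\<Gamma> x) = \<Gamma> (Et x)"
  proof (rule rtp.id_star_weight_eq)
    show "psd (\<Gamma> (Et x))" using x EM by (simp add: \<Gamma>_psd Et_psd)
    then show "psd (T\<^sub>L (left_slice N h\<^sub>0 \<kappa>\<^sub>0 (\<lambda>n. n) \<xi> (\<Gamma> x)))" for \<xi>
      unfolding T by (simp add: psd_def cinner_left_functional)
  qed (simp_all add: \<Gamma>_ops EM T cinner_left_functional)
  then show "id_star_weight N h\<^sub>0 \<kappa>\<^sub>0 (\<lambda>n. n) T\<^sub>L (\<Gamma>\<^sub>0 x) = rtp_op N h\<^sub>0 \<kappa>\<^sub>0 (\<lambda>n. n) (T\<^sub>L x) (mat 1)"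
    using x EN by (simp add: \<Gamma>\<^sub>0 T\<^sub>L rtp_op_left)
qed

lemma right_invariant: "right_invariant N M (\<lambda>n. n) \<kappa>\<^sub>0 \<Gamma>\<^sub>0 h\<^sub>0 T\<^sub>R"
  unfolding right_invariant_def
proof
  fix x assume "x \<in> op_weight_domain M (\<kappa>\<^sub>0 ` N) T\<^sub>R"
  then have x: "x \<in> M" "psd x" by (auto simp: op_weight_domain_def)
  obtain n where n: "n \<in> N" "Es x = \<kappa> n" using Es_\<kappa>_N[OF x(1)] by blast
  have EM: "Es x \<in> M" using x Es_M by auto
  have T: "T\<^sub>R (right_slice N h\<^sub>0 \<kappa>\<^sub>0 (\<lambda>n. n) \<eta> (\<Gamma> x)) = right_functional \<eta> \<eta> (\<Gamma> (Es x))" for \<eta>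
    using x by (simp add: rtp.right_slice_eq \<Gamma>_ops T\<^sub>R right_functional_in[OF fd \<Gamma>_in] Es_right_functional)
  have "weight_star_id N h\<^sub>0 \<kappa>\<^sub>0 (\<lambda>n. n) T\<^sub>R (\<Gamma> x) = \<Gamma> (Es x)"
  proof (rule rtp.weight_star_id_eq)
    show "psd (\<Gamma> (Es x))" using x EM by (simp add: \<Gamma>_psd Es_psd)
    then show "psd (T\<^sub>R (right_slice N h\<^sub>0 \<kappa>\<^sub>0 (\<lambda>n. n) \<eta> (\<Gamma> x)))" for \<eta>
      unfolding T by (simp add: psd_def cinner_right_functional)
  qed (simp_all add: \<Gamma>_ops EM T cinner_right_functional)
  then show "weight_star_id N h\<^sub>0 \<kappa>\<^sub>0 (\<lambda>n. n) T\<^sub>R (\<Gamma>\<^sub>0 x) = rtp_op N h\<^sub>0 \<kappa>\<^sub>0 (\<lambda>n. n) (mat 1) (T\<^sub>R x)"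
    using x n by (simp add: \<Gamma>\<^sub>0 T\<^sub>R rtp_op_right)
qed

theorem adapted: "adapted_mqg N M (\<lambda>n. n) \<kappa>\<^sub>0 \<Gamma>\<^sub>0 h\<^sub>0 T\<^sub>L T\<^sub>R"
proof -
  have "op_weight_modular_aut M N T\<^sub>L t (\<kappa>\<^sub>0 n) = \<kappa>\<^sub>0 (modular_aut N h\<^sub>0 (- t) n)" if n: "n \<in> N" for t n
  proof -
    have "op_weight_modular_aut M N T\<^sub>L t (\<kappa> n) = \<kappa> n"
      using n by (intro op_weight_modular_aut_central[OF T\<^sub>L_weight nsf_N])
        (simp_all add: N_M T\<^sub>L closed_M Et_central)
    then show ?thesis using n by (simp add: N.modular_aut_eq to_total)
  qed
  moreover have "op_weight_modular_aut M (\<kappa> ` N) T\<^sub>R t n = modular_aut N h\<^sub>0 t n" if n: "n \<in> N" for t n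
  proof -
    have "nsf_weight (\<kappa> ` N) h\<^sub>0"
      by (rule nsf_weight_subalgebra[OF nsf_M]) (auto simp: N_M \<kappa>_M)
    then have "op_weight_modular_aut M (\<kappa> ` N) T\<^sub>R t n = n"
      using n by (intro op_weight_modular_aut_central[OF T\<^sub>R_weight])
        (simp_all add: N_M T\<^sub>R closed_M Es_central)
    then show ?thesis using n by (simp add: N.modular_aut_eq)
  qed
  ultimately show ?thesis
    by (simp add: adapted_mqg_def nsf_N hopf_bimodule T\<^sub>L_weight T\<^sub>R_weight left_invariant right_invariant \<kappa>\<^sub>0_image)
qed

end

section \<open>Passage from the given structure maps to their linear extensions\<close>

theorem theorem11p2:
  fixes M :: "(complex ^ 'n ^ 'n) set"
    and \<Gamma> :: "complex ^ 'n ^ 'n \<Rightarrow> complex ^ ('n \<times> 'n) ^ ('n \<times> 'n)"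
    and \<kappa> :: "complex ^ 'n ^ 'n \<Rightarrow> complex ^ 'n ^ 'n"
    and \<epsilon> h :: "complex ^ 'n ^ 'n \<Rightarrow> complex"
  assumes "weak_hopf_cstar M \<Gamma> \<kappa> \<epsilon>"
    and "\<forall>x \<in> eps_t M \<Gamma> \<kappa> ` M. \<kappa> (\<kappa> x) = x"
    and "haar_measure M \<Gamma> \<kappa> h"
  shows "let N = eps_t M \<Gamma> \<kappa> ` M;
             \<alpha> = (\<lambda>n :: complex ^ 'n ^ 'n. n);
             \<beta> = \<kappa>;
             \<mu> = h \<circ> \<alpha>
         in (\<forall>n\<in>N. \<mu> n = (h \<circ> \<beta>) n) \<and>
            adapted_mqg N M \<alpha> \<beta> \<Gamma> \<mu> (haar_range_exp M \<Gamma> h) (haar_source_exp M \<Gamma> h)"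
proof -
  note wh = assms(1)[unfolded weak_hopf_cstar_def]
  note hm = assms(3)[unfolded haar_measure_def]
  have fd: "fd_vn_algebra M" using wh by blast
  have hom: "star_hom_on M \<Gamma>" using wh by blast
  have cop_in: "\<Gamma> x \<in> alg_tensor M M" if "x \<in> M" for x using wh that by blast
  \<comment> \<open>Outside M the given maps are arbitrary. Primes denote complex-linear extensions,
    for which \<open>blift\<close> is available.\<close>
  obtain \<Gamma>' where \<Gamma>': "linear_map_on UNIV \<Gamma>'" "\<And>x. x \<in> M \<Longrightarrow> \<Gamma> x = \<Gamma>' x"
    using linear_map_on_extend[OF fd, of \<Gamma>] hom by (metis star_hom_on_def)
  have "linear_map_on M \<kappa>" "linear_form_on M \<epsilon>" "linear_form_on M h"
    using wh hm by (auto simp: positive_form_on_def)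
  note ext = linear_map_on_extend[OF fd this(1)] linear_form_on_extend[OF fd this(2)]
    linear_form_on_extend[OF fd this(3)]
  obtain \<kappa>' where \<kappa>': "linear_map_on UNIV \<kappa>'" "\<And>x. x \<in> M \<Longrightarrow> \<kappa> x = \<kappa>' x"
    using ext(1) by auto
  obtain \<epsilon>' where \<epsilon>': "linear_form_on UNIV \<epsilon>'" "\<And>x. x \<in> M \<Longrightarrow> \<epsilon> x = \<epsilon>' x"
    using ext(2) by auto
  obtain h' where h': "linear_form_on UNIV h'" "\<And>x. x \<in> M \<Longrightarrow> h x = h' x"
    using ext(3) by auto
  note lin = linear_map_onD[OF \<Gamma>'(1)] linear_map_onD[OF \<kappa>'(1)] linear_form_onD[OF \<epsilon>'(1)] linear_form_onD[OF h'(1)]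
    matrix_add_ldistrib matrix_add_rdistrib_complex tensor_add_left tensor_add_right smat_add_left smat_add_right
  note tl = tensor_lift_eq_blift[of _ M M]
  have one: "mat 1 \<in> M" using fd_one[OF fd] .
  have \<kappa>M: "\<kappa>' x \<in> M" if "x \<in> M" for x using wh that \<kappa>'(2) by metis
  have tl_\<Gamma>1: "tensor_lift M M (\<lambda>a b. \<Gamma> a \<otimes>\<^sub>m b) t = blift (\<lambda>a b. \<Gamma>' a \<otimes>\<^sub>m b) t" if "t \<in> alg_tensor M M" for t
    by (rule tl[OF that]) (simp_all add: \<Gamma>' bilin_def lin)
  have tl_\<Gamma>2: "tensor_lift M M (\<lambda>a b. a \<otimes>\<^sub>m \<Gamma> b) t = blift (\<lambda>a b. a \<otimes>\<^sub>m \<Gamma>' b) t" if "t \<in> alg_tensor M M" for t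
    by (rule tl[OF that]) (simp_all add: \<Gamma>' bilin_def lin)
  have tl_\<epsilon>1: "tensor_lift M M (\<lambda>a b. \<epsilon> a \<cdot>\<^sub>C b) t = blift (\<lambda>a b. \<epsilon>' a \<cdot>\<^sub>C b) t" if "t \<in> alg_tensor M M" for t
    by (rule tl[OF that]) (simp_all add: \<epsilon>' bilin_def lin mult_ac)
  have tl_\<epsilon>2: "tensor_lift M M (\<lambda>a b. \<epsilon> b \<cdot>\<^sub>C a) t = blift (\<lambda>a b. \<epsilon>' b \<cdot>\<^sub>C a) t" if "t \<in> alg_tensor M M" for t
    by (rule tl[OF that]) (simp_all add: \<epsilon>' bilin_def lin mult_ac)
  have tl_\<kappa>: "tensor_lift M M (\<lambda>a b. \<kappa> b \<otimes>\<^sub>m \<kappa> a) t = blift (\<lambda>a b. \<kappa>' b \<otimes>\<^sub>m \<kappa>' a) t" if "t \<in> alg_tensor M M" for t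
    by (rule tl[OF that]) (simp_all add: \<kappa>' bilin_def lin)
  have tl_s: "tensor_lift M M (\<lambda>a b. \<kappa> a ** b) t = blift (\<lambda>a b. \<kappa>' a ** b) t" if "t \<in> alg_tensor M M" for t
    by (rule tl[OF that]) (simp_all add: \<kappa>' bilin_def lin)
  have tl_t: "tensor_lift M M (\<lambda>a b. a ** \<kappa> b) t = blift (\<lambda>a b. a ** \<kappa>' b) t" if "t \<in> alg_tensor M M" for t
    by (rule tl[OF that]) (simp_all add: \<kappa>' bilin_def lin)
  have tl_h: "tensor_lift M M (\<lambda>a b. h b \<cdot>\<^sub>C a) t = blift (\<lambda>a b. h' b \<cdot>\<^sub>C a) t" if "t \<in> alg_tensor M M" for t
    by (rule tl[OF that]) (simp_all add: h' bilin_def lin mult_ac)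
  have tl_h': "tensor_lift M M (\<lambda>a b. h a \<cdot>\<^sub>C b) t = blift (\<lambda>a b. h' a \<cdot>\<^sub>C b) t" if "t \<in> alg_tensor M M" for t
    by (rule tl[OF that]) (simp_all add: h' bilin_def lin mult_ac)
  have antipode_total: "blift (\<lambda>a b. blift (\<lambda>a b. \<kappa>' a ** b) (\<Gamma>' a) \<otimes>\<^sub>m b) (\<Gamma>' x) = (mat 1 \<otimes>\<^sub>m x) ** \<Gamma>' (mat 1)"
    if x: "x \<in> M" for x
  proof -
    obtain k :: nat and a b where ab: "\<And>i. i < k \<Longrightarrow> a i \<in> M" "\<And>i. i < k \<Longrightarrow> b i \<in> M"
      "\<Gamma> x = (\<Sum>i<k. a i \<otimes>\<^sub>m b i)" using alg_tensor_decomp[OF cop_in[OF x]] by blast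
    have b1: "bilin (\<lambda>a (b :: complex ^ 'n ^ 'n). \<Gamma>' a \<otimes>\<^sub>m b)"
      and b2: "bilin (\<lambda>t (c :: complex ^ 'n ^ 'n). blift (\<lambda>a b. \<kappa>' a ** b) t \<otimes>\<^sub>m c)"
      and b3: "bilin (\<lambda>a (b :: complex ^ 'n ^ 'n). blift (\<lambda>a b. \<kappa>' a ** b) (\<Gamma>' a) \<otimes>\<^sub>m b)"
      by (simp_all add: bilin_def lin)
    have t: "blift (\<lambda>a b. \<Gamma>' a \<otimes>\<^sub>m b) (\<Gamma> x) = (\<Sum>i<k. \<Gamma>' (a i) \<otimes>\<^sub>m b i)"
      by (simp add: ab(3) blift_sum blift_tensor[OF b1])
    \<comment> \<open>The outer lift in the antipode law accepts first legs from M \<otimes> M only,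
      and there the inner lift is known to equal its total variant; hence this membership.\<close>
    have in_t: "(\<Sum>i<k. \<Gamma>' (a i) \<otimes>\<^sub>m b i) \<in> alg_tensor (alg_tensor M M) M"
      using ab cop_in by (auto intro!: alg_tensor_sum alg_tensor_elem simp flip: \<Gamma>'(2))
    have "(mat 1 \<otimes>\<^sub>m x) ** \<Gamma> (mat 1) = tensor_lift (alg_tensor M M) M
        (\<lambda>t c. tensor_lift M M (\<lambda>a b. \<kappa> a ** b) t \<otimes>\<^sub>m c) (tensor_lift M M (\<lambda>a b. \<Gamma> a \<otimes>\<^sub>m b) (\<Gamma> x))"
      using wh x by simp
    also have "\<dots> = blift (\<lambda>t c. blift (\<lambda>a b. \<kappa>' a ** b) t \<otimes>\<^sub>m c) (\<Sum>i<k. \<Gamma>' (a i) \<otimes>\<^sub>m b i)"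
      unfolding tl_\<Gamma>1[OF cop_in[OF x]] t
      by (rule tensor_lift_eq_blift[OF in_t _ b2]) (simp add: tl_s)
    also have "\<dots> = blift (\<lambda>a b. blift (\<lambda>a b. \<kappa>' a ** b) (\<Gamma>' a) \<otimes>\<^sub>m b) (\<Gamma> x)"
      by (simp add: ab(3) blift_sum blift_tensor[OF b2] blift_tensor[OF b3])
    finally show ?thesis using x one by (simp add: \<Gamma>')
  qed
  have WH: "weak_hopf M \<Gamma>' \<kappa>' \<epsilon>'"
  proof
    fix x y assume x: "x \<in> M" and y: "y \<in> M"
    have "\<Gamma> (x ** y) = \<Gamma> x ** \<Gamma> y" using hom x y unfolding star_hom_on_def by blast
    then show "\<Gamma>' (x ** y) = \<Gamma>' x ** \<Gamma>' y"
      using x y fd_mult[OF fd x y] by (simp add: \<Gamma>')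
    have "\<kappa> (x ** y) = \<kappa> y ** \<kappa> x" using wh x y by blast
    then show "\<kappa>' (x ** y) = \<kappa>' y ** \<kappa>' x"
      using x y fd_mult[OF fd x y] by (simp add: \<kappa>')
  next
    fix x assume x: "x \<in> M"
    show "\<Gamma>' x \<in> alg_tensor M M" using cop_in[OF x] x by (simp add: \<Gamma>')
    have "\<Gamma> (cadj x) = cadj (\<Gamma> x)" using hom x unfolding star_hom_on_def by blast
    then show "\<Gamma>' (cadj x) = cadj (\<Gamma>' x)"
      using x fd_cadj[OF fd x] by (simp add: \<Gamma>')
    have "reassoc (tensor_lift M M (\<lambda>a b. \<Gamma> a \<otimes>\<^sub>m b) (\<Gamma> x)) = tensor_lift M M (\<lambda>a b. a \<otimes>\<^sub>m \<Gamma> b) (\<Gamma> x)"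
      using wh x by blast
    then show "reassoc (blift (\<lambda>a b. \<Gamma>' a \<otimes>\<^sub>m b) (\<Gamma>' x)) = blift (\<lambda>a b. a \<otimes>\<^sub>m \<Gamma>' b) (\<Gamma>' x)"
      unfolding tl_\<Gamma>1[OF cop_in[OF x]] tl_\<Gamma>2[OF cop_in[OF x]] using x by (simp add: \<Gamma>')
    have "tensor_lift M M (\<lambda>a b. \<epsilon> a \<cdot>\<^sub>C b) (\<Gamma> x) = x \<and> tensor_lift M M (\<lambda>a b. \<epsilon> b \<cdot>\<^sub>C a) (\<Gamma> x) = x"
      using wh x by blast
    then show "blift (\<lambda>a b. \<epsilon>' a \<cdot>\<^sub>C b) (\<Gamma>' x) = x" "blift (\<lambda>a b. \<epsilon>' b \<cdot>\<^sub>C a) (\<Gamma>' x) = x"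
      unfolding tl_\<epsilon>1[OF cop_in[OF x]] tl_\<epsilon>2[OF cop_in[OF x]] using x by (simp_all add: \<Gamma>')
    show \<kappa>x: "\<kappa>' x \<in> M" by (rule \<kappa>M[OF x])
    have "\<Gamma> (\<kappa> x) = tensor_lift M M (\<lambda>a b. \<kappa> b \<otimes>\<^sub>m \<kappa> a) (\<Gamma> x)" using wh x by blast
    then show "\<Gamma>' (\<kappa>' x) = blift (\<lambda>a b. \<kappa>' b \<otimes>\<^sub>m \<kappa>' a) (\<Gamma>' x)"
      unfolding tl_\<kappa>[OF cop_in[OF x]] using x \<kappa>x by (simp add: \<Gamma>' \<kappa>')
    have "\<kappa> (cadj (\<kappa> (cadj x))) = x" using wh x by blast
    then show "\<kappa>' (cadj (\<kappa>' (cadj x))) = x"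
      using fd_cadj[OF fd x] \<kappa>M fd_cadj[OF fd] by (simp add: \<kappa>')
  qed (use fd \<Gamma>' \<kappa>' \<epsilon>' antipode_total in auto)
  interpret weak_hopf M \<Gamma>' \<kappa>' \<epsilon>' by (rule WH)
  have N: "eps_t M \<Gamma> \<kappa> ` M = N"
    unfolding N_def by (rule image_cong) (simp_all add: eps_t_def tl_t cop_in et_def \<Gamma>'(2)[symmetric])
  have hnsf: "nsf_weight M h'"
    using hm h' fd by (auto simp: nsf_weight_def positive_form_on_def faithful_form_on_def linear_form_on_def)
  have \<Gamma>y: "t ** (mat 1 \<otimes>\<^sub>m x) \<in> alg_tensor M M" "(mat 1 \<otimes>\<^sub>m x) ** t \<in> alg_tensor M M"
    if "t \<in> alg_tensor M M" "x \<in> M" for t x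
    by (rule alg_tensor_decomp[OF that(1)],
        auto simp: matrix_mult_sum_left matrix_mult_sum_right intro!: alg_tensor_sum alg_tensor_elem fd_mult[OF fd] that(2))+
  interpret haar_weak_hopf M \<Gamma>' \<kappa>' \<epsilon>' h'
  proof
    fix n assume n: "n \<in> N"
    then have "\<kappa> (\<kappa> n) = n" using assms(2) N by blast
    then show "\<kappa>' (\<kappa>' n) = n" using n N_M \<kappa>M by (simp add: \<kappa>')
  next
    have "tensor_lift M M (\<lambda>a b. h b \<cdot>\<^sub>C a) (\<Gamma> (mat 1)) = mat 1" using hm by blast
    then show "blift (\<lambda>a b. h' b \<cdot>\<^sub>C a) (\<Gamma>' (mat 1)) = mat 1"
      unfolding tl_h[OF cop_in[OF one]] using one by (simp add: \<Gamma>')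
  next
    fix x assume x: "x \<in> M"
    have "h (\<kappa> x) = h x" using hm x by blast
    then show "h' (\<kappa>' x) = h' x" using x \<kappa>M by (simp add: \<kappa>' h')
    fix y assume y: "y \<in> M"
    have ts: "(mat 1 \<otimes>\<^sub>m y) ** \<Gamma> x \<in> alg_tensor M M" "\<Gamma> y ** (mat 1 \<otimes>\<^sub>m x) \<in> alg_tensor M M"
      using \<Gamma>y cop_in x y by auto
    \<comment> \<open>\<kappa> and its extension agree on M only, so the argument of \<kappa> in the
      invariance law has to be located in M.\<close>
    have inM: "blift (\<lambda>a b. h' b \<cdot>\<^sub>C a) t \<in> M" if "t \<in> alg_tensor M M" for t
    proof (rule alg_tensor_decomp[OF that])
      fix k :: nat and a b assume "\<And>i. i < k \<Longrightarrow> a i \<in> M" "\<And>i. i < k \<Longrightarrow> b i \<in> M"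
        and t: "t = (\<Sum>i<k. a i \<otimes>\<^sub>m b i)"
      moreover have "bilin (\<lambda>(a :: complex ^ 'n ^ 'n) b. h' b \<cdot>\<^sub>C a)" by (simp add: bilin_def lin mult_ac)
      note blift_tensor[OF this]
      ultimately show ?thesis by (auto simp: blift_sum intro!: sum_M smat_M)
    qed
    have "tensor_lift M M (\<lambda>a b. h b \<cdot>\<^sub>C a) ((mat 1 \<otimes>\<^sub>m y) ** \<Gamma> x)
        = \<kappa> (tensor_lift M M (\<lambda>a b. h b \<cdot>\<^sub>C a) (\<Gamma> y ** (mat 1 \<otimes>\<^sub>m x)))"
      using hm x y by blast
    then show "blift (\<lambda>a b. h' b \<cdot>\<^sub>C a) ((mat 1 \<otimes>\<^sub>m y) ** \<Gamma>' x)
        = \<kappa>' (blift (\<lambda>a b. h' b \<cdot>\<^sub>C a) (\<Gamma>' y ** (mat 1 \<otimes>\<^sub>m x)))"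
      unfolding tl_h[OF ts(1)] tl_h[OF ts(2)] using inM[OF ts(2)] x y by (simp add: \<Gamma>' \<kappa>')
  qed (use h' hnsf in auto)
  \<comment> \<open>The conclusion speaks of the original functions; they enter here as maps that
    agree with the extensions on M.\<close>
  interpret restricted_haar_weak_hopf M \<Gamma>' \<kappa>' \<epsilon>' h' \<Gamma> \<kappa> "haar_range_exp M \<Gamma> h" "haar_source_exp M \<Gamma> h" h
    by unfold_locales
      (simp_all add: \<Gamma>' \<kappa>' h' haar_range_exp_def haar_source_exp_def tl_h tl_h' cop_in Et_def Es_def hr_def hl_def
        flip: \<Gamma>'(2))
  have "h n = h (\<kappa> n)" if "n \<in> N" for n
    using that N_M hm by metis
  then show ?thesis using adapted by (simp add: N Let_def comp_def)
qed

end
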